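(* Let $R$ be a commutative ring and let $\mathcal{P}$ be an operad over $R$. Let $\mathsf{ALG}_{\mathcal{P}}$ be the category of $\mathcal{P}$-algebras. Consider: (i) the functor $\mathsf{T}:\mathsf{ALG}_{\mathcal{P}}\to\mathsf{ALG}_{\mathcal{P}}$ given by $\mathsf{T}(A)=A\ltimes A$ and $\mathsf{T}(f)(a,b)=(f(a),f(b))$; (ii) the projection $p_A:A\ltimes A\to A$, $p_A(a,b)=a$, with $n$-fold pullback $\mathsf{T}_n(A)=A\ltimes A^n$ and pullback projections $q_j:A\ltimes A^n\to A\ltimes A$, $q_j(a,b_1,\dots,b_n)=(a,b_j)$; (iii) the sum $s_A:A\ltimes A^2\to A\ltimes A$, $s_A(a,b_1,b_2)=(a,b_1+b_2)$; (iv) the zero map $z_A:A\to A\ltimes A$, $z_A(a)=(a,0)$; (v) the vertical lift $l_A:A\ltimes A\to(A\ltimes A)\ltimes(A\ltimes A)$, $l_A(a,b)=(a,0,0,b)$; (vi) the canonical flip $c_A:(A\ltimes A)\ltimes(A\ltimes A)\to(A\ltimes A)\ltimes(A\ltimes A)$, $c_A(a,b,c,d)=(a,c,b,d)$; (vii) the negative map $n_A:A\ltimes A\to A\ltimes A$, $n_A(a,b)=(a,-b)$. Then $\mathbb{T}=(\mathsf{T},p,s,z,l,c,n)$ is a Rosický tangent structure on $\mathsf{ALG}_{\mathcal{P}}$, and $(\mathsf{ALG}_{\mathcal{P}},\mathbb{T})$ is a Cartesian Rosický tangent category.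
   Context: **Operads and algebras.** $R$ is a commutative ring. An operad $\mathcal{P}$ is a symmetric operad in $R$-modules: a sequence of $R$-modules $\mathcal{P}(n)$, $n\ge 0$, with right $\Sigma(n)$-actions, a unit $1_{\mathcal{P}}\in\mathcal{P}(1)$ and partial compositions $\circ_i:\mathcal{P}(m)\otimes\mathcal{P}(n)\to\mathcal{P}(m+n-1)$ satisfying the usual equivariance, associativity and unit axioms; $\mu(\nu_1,\dots,\nu_k)$ denotes the complete composition. For an $R$-module $V$, $\mathsf{S}(\mathcal{P},V)=\bigoplus_{n\ge0}(\mathcal{P}(n)\otimes V^{\otimes n})_{\Sigma(n)}$ and $(\mu;v_1,\dots,v_n)$ is the class of $\mu\otimes v_1\otimes\cdots\otimes v_n$. A $\mathcal{P}$-algebra is an $R$-module $A$ with an $R$-linear map $\mathsf{S}(\mathcal{P},A)\to A$, written $(\mu;a_1,\dots,a_n)\mapsto\mu(a_1,\dots,a_n)$, such that $1_{\mathcal{P}}(a)=a$ and $\mu(\nu_1(a_{1,1},\dots,a_{1,n_1}),\dots,\nu_k(a_{k,1},\dots,a_{k,n_k}))=\mu(\nu_1,\dots,\nu_k)(a_{1,1},\dots,a_{k,n_k})$. A $\mathcal{P}$-algebra morphism is an $R$-linear map $f$ with $f(\mu(a_1,\dots,a_n))=\mu(f(a_1),\dots,f(a_n))$. **Semi-direct products.** $A\ltimes A^n$ is the $R$-module $A\times A^n$ with $\mathcal{P}$-algebra structure whose first component of $\mu((a_1,\vec b_1),\dots,(a_m,\vec b_m))$, with $\vec b_i=(b_{i,1},\dots,b_{i,n})$,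 is $\mu(a_1,\dots,a_m)$ and whose $(j+1)$-th component is $\sum_{i=1}^m\mu(a_1,\dots,b_{i,j},\dots,a_m)$ ($b_{i,j}$ in position $i$), $1\le j\le n$. $A\ltimes A$ is the case $n=1$. **Tangent structures.** A tangent structure on a category $\mathbb{X}$ consists of an endofunctor $\mathsf{T}$; a natural transformation $p_A:\mathsf{T}(A)\to A$ such that all $n$-fold pullbacks $\mathsf{T}_n(A)$ of $p_A$ (with projections $q_j:\mathsf{T}_n(A)\to\mathsf{T}(A)$) exist and are preserved by every power $\mathsf{T}^m$; and natural transformations $s_A:\mathsf{T}_2(A)\to\mathsf{T}(A)$, $z_A:A\to\mathsf{T}(A)$, $l_A:\mathsf{T}(A)\to\mathsf{T}^2(A)$, $c_A:\mathsf{T}^2(A)\to\mathsf{T}^2(A)$ such that: (1) $(p_A,s_A,z_A)$ makes $\mathsf{T}(A)$ a commutative monoid object in the slice category over $A$; (2) $\mathsf{T}(p_A) l_A=z_A p_A$, $l_A s_A=\mathsf{T}(s_A)\langle l_Aq_1,l_Aq_2\rangle$, $l_Az_A=\mathsf{T}(z_A)z_A$; (3) $p_{\mathsf{T}(A)}c_A=\mathsf{T}(p_A)$, $c_A\mathsf{T}(s_A)=s_{\mathsf{T}(A)}\langle c_A\mathsf{T}(q_1),c_A\mathsf{T}(q_2)\rangle$, $c_A\mathsf{T}(z_A)=z_{\mathsf{T}(A)}$; (4) $c_Ac_A=1$, $c_Al_A=l_A$, $\mathsf{T}(l_A)l_A=l_{\mathsf{T}(A)}l_A$, $\mathsf{T}(c_A)c_{\mathsf{T}(A)}\mathsf{T}(c_A)=c_{\mathsf{T}(A)}\mathsf{T}(c_A)c_{\mathsf{T}(A)}$,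 $c_{\mathsf{T}(A)}\mathsf{T}(c_A)l_{\mathsf{T}(A)}=\mathsf{T}(l_A)c_A$; (5) (universality of the lift) $\mathsf{T}(s_A)\langle l_Aq_1,z_{\mathsf{T}(A)}q_2\rangle:\mathsf{T}_2(A)\to\mathsf{T}^2(A)$ is an equalizer of $\mathsf{T}(p_A)$ and $z_Ap_Ap_{\mathsf{T}(A)}:\mathsf{T}^2(A)\to\mathsf{T}(A)$. It is a Rosický tangent structure if moreover there is a natural $n_A:\mathsf{T}(A)\to\mathsf{T}(A)$ with $p_An_A=p_A$ and $s_A\langle 1,n_A\rangle=z_Ap_A$. A (Rosický) tangent category is a category with a (Rosický) tangent structure; it is Cartesian if $\mathbb{X}$ has finite products and $\mathsf{T}$ preserves them (the canonical comparison maps are isomorphisms). *)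

theory Defs
  imports "HOL-Algebra.Module" "HOL-Algebra.AbelCoset" "HOL-Combinatorics.Permutations"
begin

section \<open>Categories\<close>

text \<open>
  Arrows carry their domain and codomain. \<open>g \<cdot> f\<close> is only meaningful when
  \<open>Cod f = Dom g\<close>.
\<close>

record ('o, 'm) category =
  Obj :: "'o set"
  Arr :: "'m set"
  Dom :: "'m \<Rightarrow> 'o"
  Cod :: "'m \<Rightarrow> 'o"
  Id :: "'o \<Rightarrow> 'm"
  Comp :: "'m \<Rightarrow> 'm \<Rightarrow> 'm"  (infixr \<open>\<cdot>\<index>\<close> 75)

definition Hom :: "('o, 'm, 'x) category_scheme \<Rightarrow> 'o \<Rightarrow> 'o \<Rightarrow> 'm set"
  where "Hom C A B = {f \<in> Arr C. Dom C f = A \<and> Cod C f = B}"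

locale category =
  fixes C :: "('o, 'm, 'x) category_scheme" (structure)
  assumes Dom_Obj: "f \<in> Arr C \<Longrightarrow> Dom C f \<in> Obj C"
    and Cod_Obj: "f \<in> Arr C \<Longrightarrow> Cod C f \<in> Obj C"
    and Id_Hom: "A \<in> Obj C \<Longrightarrow> Id C A \<in> Hom C A A"
    and Comp_Hom: "\<lbrakk>f \<in> Hom C A B; g \<in> Hom C B D\<rbrakk> \<Longrightarrow> g \<cdot> f \<in> Hom C A D"
    and Comp_Id_right: "f \<in> Hom C A B \<Longrightarrow> f \<cdot> Id C A = f"
    and Comp_Id_left: "f \<in> Hom C A B \<Longrightarrow> Id C B \<cdot> f = f"
    and Comp_assoc: "\<lbrakk>f \<in> Hom C A B; g \<in> Hom C B D; h \<in> Hom C D E\<rbrakk>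
          \<Longrightarrow> (h \<cdot> g) \<cdot> f = h \<cdot> (g \<cdot> f)"

definition is_iso :: "('o, 'm, 'x) category_scheme \<Rightarrow> 'm \<Rightarrow> bool"
  where "is_iso C f \<longleftrightarrow> f \<in> Arr C \<and>
    (\<exists>g \<in> Hom C (Cod C f) (Dom C f).
       g \<cdot>\<^bsub>C\<^esub> f = Id C (Dom C f) \<and> f \<cdot>\<^bsub>C\<^esub> g = Id C (Cod C f))"

definition endofunctor ::
    "('o, 'm, 'x) category_scheme \<Rightarrow> ('o \<Rightarrow> 'o) \<Rightarrow> ('m \<Rightarrow> 'm) \<Rightarrow> bool"
  where "endofunctor C F Fm \<longleftrightarrow>
    (\<forall>A \<in> Obj C. F A \<in> Obj C) \<and>
    (\<forall>A B. \<forall>f \<in> Hom C A B. Fm f \<in> Hom C (F A) (F B)) \<and>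
    (\<forall>A \<in> Obj C. Fm (Id C A) = Id C (F A)) \<and>
    (\<forall>A B D. \<forall>f \<in> Hom C A B. \<forall>g \<in> Hom C B D. Fm (g \<cdot>\<^bsub>C\<^esub> f) = Fm g \<cdot>\<^bsub>C\<^esub> Fm f)"

definition nat_trans ::
    "('o, 'm, 'x) category_scheme \<Rightarrow> ('o \<Rightarrow> 'o) \<Rightarrow> ('m \<Rightarrow> 'm) \<Rightarrow>
      ('o \<Rightarrow> 'o) \<Rightarrow> ('m \<Rightarrow> 'm) \<Rightarrow> ('o \<Rightarrow> 'm) \<Rightarrow> bool"
  where "nat_trans C F Fm G Gm \<alpha> \<longleftrightarrow>
    (\<forall>A \<in> Obj C. \<alpha> A \<in> Hom C (F A) (G A)) \<and>
    (\<forall>A B. \<forall>f \<in> Hom C A B. \<alpha> B \<cdot>\<^bsub>C\<^esub> Fm f = Gm f \<cdot>\<^bsub>C\<^esub> \<alpha> A)"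

definition is_product ::
    "('o, 'm, 'x) category_scheme \<Rightarrow> 'o list \<Rightarrow> 'o \<Rightarrow> (nat \<Rightarrow> 'm) \<Rightarrow> bool"
  where "is_product C As P \<pi> \<longleftrightarrow>
    P \<in> Obj C \<and> (\<forall>i < length As. \<pi> i \<in> Hom C P (As ! i)) \<and>
    (\<forall>X \<in> Obj C. \<forall>f. (\<forall>i < length As. f i \<in> Hom C X (As ! i)) \<longrightarrow>
       (\<exists>!h. h \<in> Hom C X P \<and> (\<forall>i < length As. \<pi> i \<cdot>\<^bsub>C\<^esub> h = f i)))"

definition has_finite_products :: "('o, 'm, 'x) category_scheme \<Rightarrow> bool"
  where "has_finite_products C \<longleftrightarrow>
    (\<forall>As. set As \<subseteq> Obj C \<longrightarrow> (\<exists>P \<pi>. is_product C As P \<pi>))"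

text \<open>The arrow \<open>h\<close> below is the canonical comparison map \<open>F(\<Prod>A\<^sub>i) \<rightarrow> \<Prod>F(A\<^sub>i)\<close>.\<close>

definition preserves_finite_products ::
    "('o, 'm, 'x) category_scheme \<Rightarrow> ('o \<Rightarrow> 'o) \<Rightarrow> ('m \<Rightarrow> 'm) \<Rightarrow> bool"
  where "preserves_finite_products C F Fm \<longleftrightarrow>
    (\<forall>As P \<pi> Q \<rho>. set As \<subseteq> Obj C \<and> is_product C As P \<pi> \<and> is_product C (map F As) Q \<rho> \<longrightarrow>
       is_iso C (THE h. h \<in> Hom C (F P) Q \<and>
                        (\<forall>i < length As. \<rho> i \<cdot>\<^bsub>C\<^esub> h = Fm (\<pi> i))))"

definition is_equalizer ::
    "('o, 'm, 'x) category_scheme \<Rightarrow> 'm \<Rightarrow> 'm \<Rightarrow> 'm \<Rightarrow> bool"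
  where "is_equalizer C e f g \<longleftrightarrow>
    f \<in> Arr C \<and> g \<in> Hom C (Dom C f) (Cod C f) \<and>
    e \<in> Arr C \<and> Cod C e = Dom C f \<and> f \<cdot>\<^bsub>C\<^esub> e = g \<cdot>\<^bsub>C\<^esub> e \<and>
    (\<forall>X. \<forall>k \<in> Hom C X (Dom C f). f \<cdot>\<^bsub>C\<^esub> k = g \<cdot>\<^bsub>C\<^esub> k \<longrightarrow>
       (\<exists>!h. h \<in> Hom C X (Dom C e) \<and> e \<cdot>\<^bsub>C\<^esub> h = k))"

text \<open>
  \<open>n\<close>-fold pullback of a single arrow \<open>p\<close>, with projections \<open>q 1, \<dots>, q n\<close>. The definition is
  only meaningful for \<open>n \<ge> 1\<close>, since there is no separate leg to the base.
\<close>

definition is_nfold_pullback ::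
    "('o, 'm, 'x) category_scheme \<Rightarrow> nat \<Rightarrow> 'm \<Rightarrow> 'o \<Rightarrow> (nat \<Rightarrow> 'm) \<Rightarrow> bool"
  where "is_nfold_pullback C n p P q \<longleftrightarrow>
    p \<in> Arr C \<and> P \<in> Obj C \<and>
    (\<forall>j \<in> {1..n}. q j \<in> Hom C P (Dom C p)) \<and>
    (\<forall>j \<in> {1..n}. \<forall>k \<in> {1..n}. p \<cdot>\<^bsub>C\<^esub> q j = p \<cdot>\<^bsub>C\<^esub> q k) \<and>
    (\<forall>X \<in> Obj C. \<forall>f.
       (\<forall>j \<in> {1..n}. f j \<in> Hom C X (Dom C p)) \<and>
       (\<forall>j \<in> {1..n}. \<forall>k \<in> {1..n}. p \<cdot>\<^bsub>C\<^esub> f j = p \<cdot>\<^bsub>C\<^esub> f k) \<longrightarrow>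
       (\<exists>!h. h \<in> Hom C X P \<and> (\<forall>j \<in> {1..n}. q j \<cdot>\<^bsub>C\<^esub> h = f j)))"

text \<open>The induced arrow \<open>\<langle>f, g\<rangle>\<close> into a pullback \<open>P\<close> with projections \<open>\<pi>\<^sub>1, \<pi>\<^sub>2\<close>.\<close>

definition pairing ::
    "('o, 'm, 'x) category_scheme \<Rightarrow> 'o \<Rightarrow> 'm \<Rightarrow> 'm \<Rightarrow> 'm \<Rightarrow> 'm \<Rightarrow> 'm"
  where "pairing C P \<pi>1 \<pi>2 f g =
    (THE h. h \<in> Hom C (Dom C f) P \<and> \<pi>1 \<cdot>\<^bsub>C\<^esub> h = f \<and> \<pi>2 \<cdot>\<^bsub>C\<^esub> h = g)"

text \<open>
  Commutative monoid object \<open>p : E \<rightarrow> B\<close> in the slice category over \<open>B\<close>, with multiplication \<open>s\<close>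
  and unit \<open>z\<close>. The terminal object of the slice is \<open>Id B\<close>, and the binary and ternary products
  of \<open>p\<close> with itself are its pullbacks \<open>E2\<close> (projections \<open>\<pi>\<close>) and \<open>E3\<close> (projections \<open>\<rho>\<close>).
\<close>

definition comm_monoid_in_slice ::
    "('o, 'm, 'x) category_scheme \<Rightarrow> 'm \<Rightarrow> 'o \<Rightarrow> (nat \<Rightarrow> 'm) \<Rightarrow> 'o \<Rightarrow> (nat \<Rightarrow> 'm) \<Rightarrow>
      'm \<Rightarrow> 'm \<Rightarrow> bool"
  where "comm_monoid_in_slice C p E2 \<pi> E3 \<rho> s z \<longleftrightarrow>
    (let E = Dom C p; B = Cod C p; pair = pairing C E2 (\<pi> 1) (\<pi> 2) in
      is_nfold_pullback C 2 p E2 \<pi> \<and> is_nfold_pullback C 3 p E3 \<rho> \<and>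
      s \<in> Hom C E2 E \<and> p \<cdot>\<^bsub>C\<^esub> s = p \<cdot>\<^bsub>C\<^esub> \<pi> 1 \<and>
      z \<in> Hom C B E \<and> p \<cdot>\<^bsub>C\<^esub> z = Id C B \<and>
      s \<cdot>\<^bsub>C\<^esub> pair (s \<cdot>\<^bsub>C\<^esub> pair (\<rho> 1) (\<rho> 2)) (\<rho> 3)
        = s \<cdot>\<^bsub>C\<^esub> pair (\<rho> 1) (s \<cdot>\<^bsub>C\<^esub> pair (\<rho> 2) (\<rho> 3)) \<and>
      s \<cdot>\<^bsub>C\<^esub> pair (z \<cdot>\<^bsub>C\<^esub> p) (Id C E) = Id C E \<and>
      s \<cdot>\<^bsub>C\<^esub> pair (Id C E) (z \<cdot>\<^bsub>C\<^esub> p) = Id C E \<and>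
      s \<cdot>\<^bsub>C\<^esub> pair (\<pi> 2) (\<pi> 1) = s)"


section \<open>Tangent structures\<close>

text \<open>
  \<open>T\<close> and \<open>Tm\<close> are the object and arrow parts of the endofunctor; \<open>Tn n A\<close> with projections
  \<open>q n 1 A, \<dots>, q n n A\<close> is the \<open>n\<close>-fold pullback of \<open>p A\<close>.
\<close>

locale tangent_structure = category C
  for C :: "('o, 'm, 'x) category_scheme" (structure) +
  fixes T :: "'o \<Rightarrow> 'o" and Tm :: "'m \<Rightarrow> 'm"
    and Tn :: "nat \<Rightarrow> 'o \<Rightarrow> 'o" and q :: "nat \<Rightarrow> nat \<Rightarrow> 'o \<Rightarrow> 'm"
    and p s z l c :: "'o \<Rightarrow> 'm"
  assumes T_functor: "endofunctor C T Tm"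
    and p_natural: "nat_trans C T Tm (\<lambda>A. A) (\<lambda>f. f) p"
    and pullback_preserved:
      "\<lbrakk>A \<in> Obj C; n \<ge> 1\<rbrakk> \<Longrightarrow>
         is_nfold_pullback C n ((Tm ^^ k) (p A)) ((T ^^ k) (Tn n A)) (\<lambda>j. (Tm ^^ k) (q n j A))"
    and s_natural:
      "nat_trans C (Tn 2)
         (\<lambda>f. pairing C (Tn 2 (Cod C f)) (q 2 1 (Cod C f)) (q 2 2 (Cod C f))
                (Tm f \<cdot> q 2 1 (Dom C f)) (Tm f \<cdot> q 2 2 (Dom C f)))
         T Tm s"
    and z_natural: "nat_trans C (\<lambda>A. A) (\<lambda>f. f) T Tm z"
    and l_natural: "nat_trans C T Tm (\<lambda>A. T (T A)) (\<lambda>f. Tm (Tm f)) l"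
    and c_natural: "nat_trans C (\<lambda>A. T (T A)) (\<lambda>f. Tm (Tm f)) (\<lambda>A. T (T A)) (\<lambda>f. Tm (Tm f)) c"
    and additive_bundle:
      "A \<in> Obj C \<Longrightarrow>
         comm_monoid_in_slice C (p A) (Tn 2 A) (\<lambda>j. q 2 j A) (Tn 3 A) (\<lambda>j. q 3 j A) (s A) (z A)"
    and lift_p: "A \<in> Obj C \<Longrightarrow> Tm (p A) \<cdot> l A = z A \<cdot> p A"
    and lift_s: "A \<in> Obj C \<Longrightarrow>
         l A \<cdot> s A = Tm (s A) \<cdot>
           pairing C (T (Tn 2 A)) (Tm (q 2 1 A)) (Tm (q 2 2 A)) (l A \<cdot> q 2 1 A) (l A \<cdot> q 2 2 A)"
    and lift_z: "A \<in> Obj C \<Longrightarrow> l A \<cdot> z A = Tm (z A) \<cdot> z A"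
    and flip_p: "A \<in> Obj C \<Longrightarrow> p (T A) \<cdot> c A = Tm (p A)"
    and flip_s: "A \<in> Obj C \<Longrightarrow>
         c A \<cdot> Tm (s A) = s (T A) \<cdot>
           pairing C (Tn 2 (T A)) (q 2 1 (T A)) (q 2 2 (T A))
             (c A \<cdot> Tm (q 2 1 A)) (c A \<cdot> Tm (q 2 2 A))"
    and flip_z: "A \<in> Obj C \<Longrightarrow> c A \<cdot> Tm (z A) = z (T A)"
    and flip_flip: "A \<in> Obj C \<Longrightarrow> c A \<cdot> c A = Id C (T (T A))"
    and flip_lift: "A \<in> Obj C \<Longrightarrow> c A \<cdot> l A = l A"
    and lift_lift: "A \<in> Obj C \<Longrightarrow> Tm (l A) \<cdot> l A = l (T A) \<cdot> l A"
    and yang_baxter: "A \<in> Obj C \<Longrightarrow>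
         Tm (c A) \<cdot> c (T A) \<cdot> Tm (c A) = c (T A) \<cdot> Tm (c A) \<cdot> c (T A)"
    and flip_flip_lift: "A \<in> Obj C \<Longrightarrow> c (T A) \<cdot> Tm (c A) \<cdot> l (T A) = Tm (l A) \<cdot> c A"
    and lift_universal: "A \<in> Obj C \<Longrightarrow>
         is_equalizer C
           (Tm (s A) \<cdot>
              pairing C (T (Tn 2 A)) (Tm (q 2 1 A)) (Tm (q 2 2 A))
                (l A \<cdot> q 2 1 A) (z (T A) \<cdot> q 2 2 A))
           (Tm (p A)) (z A \<cdot> p A \<cdot> p (T A))"

locale rosicky_tangent_structure = tangent_structure C T Tm Tn q p s z l c
  for C :: "('o, 'm, 'x) category_scheme" (structure) and T Tm Tn q p s z l c +
  fixes n :: "'o \<Rightarrow> 'm"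
  assumes n_natural: "nat_trans C T Tm T Tm n"
    and p_n: "A \<in> Obj C \<Longrightarrow> p A \<cdot> n A = p A"
    and s_n: "A \<in> Obj C \<Longrightarrow>
         s A \<cdot> pairing C (Tn 2 A) (q 2 1 A) (q 2 2 A) (Id C (T A)) (n A) = z A \<cdot> p A"

locale cartesian_rosicky_tangent_category =
  rosicky_tangent_structure C T Tm Tn q p s z l c n
  for C :: "('o, 'm, 'x) category_scheme" (structure) and T Tm Tn q p s z l c n +
  assumes finite_products: "has_finite_products C"
    and T_preserves_products: "preserves_finite_products C T Tm"


section \<open>Operads\<close>

text \<open>
  HOL-Algebra modules are records that extend rings; their fields \<open>mult\<close> and \<open>one\<close> play no role
  for modules, so the modules constructed here leave them unspecified.
\<close>

definition linear_maps ::
    "('r, 'x) ring_scheme \<Rightarrow> ('r, 'a, 'y) module_scheme \<Rightarrow> ('r, 'b, 'w) module_scheme \<Rightarrow>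
      ('a \<Rightarrow> 'b) set"
  where "linear_maps R M N =
    {f \<in> carrier M \<rightarrow> carrier N.
       (\<forall>x \<in> carrier M. \<forall>y \<in> carrier M. f (x \<oplus>\<^bsub>M\<^esub> y) = f x \<oplus>\<^bsub>N\<^esub> f y) \<and>
       (\<forall>r \<in> carrier R. \<forall>x \<in> carrier M. f (r \<odot>\<^bsub>M\<^esub> x) = r \<odot>\<^bsub>N\<^esub> f x)}"

text \<open>
  Inputs are numbered from \<open>0\<close>. \<open>pcomp P m n i \<mu> \<nu>\<close> is the partial composition of \<open>\<mu>\<close> (arity \<open>m\<close>)
  and \<open>\<nu>\<close> (arity \<open>n\<close>) at input \<open>i\<close>, and \<open>sym P n \<mu> \<sigma>\<close> is the right action of \<open>\<sigma>\<close> on \<open>\<mu>\<close>.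
\<close>

record ('r, 'p) operad_data =
  ops :: "nat \<Rightarrow> ('r, 'p) module"
  unit :: "'p"
  sym :: "nat \<Rightarrow> 'p \<Rightarrow> (nat \<Rightarrow> nat) \<Rightarrow> 'p"
  pcomp :: "nat \<Rightarrow> nat \<Rightarrow> nat \<Rightarrow> 'p \<Rightarrow> 'p \<Rightarrow> 'p"

text \<open>
  The block permutation \<open>\<sigma> \<circ>\<^sub>i \<tau>\<close>. The convention is that input \<open>k\<close> of \<open>\<mu>\<sigma>\<close> is fed to input \<open>\<sigma> k\<close>
  of \<open>\<mu>\<close>, i.e. \<open>(\<mu>\<sigma>)(v) = \<mu>(v \<circ> \<sigma>\<inverse>)\<close>. An input of \<open>\<mu>\<sigma> \<circ>\<^sub>i \<nu>\<tau>\<close> is either one of the \<open>n\<close> inputs of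
  \<open>\<nu>\<tau>\<close>, or an input of \<open>\<mu>\<sigma>\<close> other than \<open>i\<close>.
\<close>

definition perm_pcomp ::
    "nat \<Rightarrow> nat \<Rightarrow> nat \<Rightarrow> (nat \<Rightarrow> nat) \<Rightarrow> (nat \<Rightarrow> nat) \<Rightarrow> nat \<Rightarrow> nat"
  where "perm_pcomp m n i \<sigma> \<tau> = (\<lambda>a.
    if a < m + n - 1 then
      if i \<le> a \<and> a < i + n then \<sigma> i + \<tau> (a - i)
      else let k = \<sigma> (if a < i then a else a + 1 - n)
           in if k < \<sigma> i then k else k + n - 1
    else a)"

locale operad = cring R
  for R :: "('r, 'x) ring_scheme" (structure) +
  fixes P :: "('r, 'p) operad_data"
  assumes ops_module: "module R (ops P n)"
    and sym_linear: "\<sigma> permutes {..<n} \<Longrightarrow>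
          (\<lambda>\<mu>. sym P n \<mu> \<sigma>) \<in> linear_maps R (ops P n) (ops P n)"
    and sym_id: "\<mu> \<in> carrier (ops P n) \<Longrightarrow> sym P n \<mu> id = \<mu>"
    and sym_comp: "\<lbrakk>\<mu> \<in> carrier (ops P n); \<sigma> permutes {..<n}; \<tau> permutes {..<n}\<rbrakk> \<Longrightarrow>
          sym P n (sym P n \<mu> \<sigma>) \<tau> = sym P n \<mu> (\<sigma> \<circ> \<tau>)"
    and unit_closed: "unit P \<in> carrier (ops P 1)"
    and pcomp_linear_left: "\<lbrakk>i < m; \<nu> \<in> carrier (ops P n)\<rbrakk> \<Longrightarrow>
          (\<lambda>\<mu>. pcomp P m n i \<mu> \<nu>) \<in> linear_maps R (ops P m) (ops P (m + n - 1))"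
    and pcomp_linear_right: "\<lbrakk>i < m; \<mu> \<in> carrier (ops P m)\<rbrakk> \<Longrightarrow>
          (\<lambda>\<nu>. pcomp P m n i \<mu> \<nu>) \<in> linear_maps R (ops P n) (ops P (m + n - 1))"
    and pcomp_sym:
      "\<lbrakk>i < m; \<mu> \<in> carrier (ops P m); \<nu> \<in> carrier (ops P n);
        \<sigma> permutes {..<m}; \<tau> permutes {..<n}\<rbrakk> \<Longrightarrow>
          pcomp P m n i (sym P m \<mu> \<sigma>) (sym P n \<nu> \<tau>) =
            sym P (m + n - 1) (pcomp P m n (\<sigma> i) \<mu> \<nu>) (perm_pcomp m n i \<sigma> \<tau>)"
    and pcomp_assoc_sequential:
      "\<lbrakk>i < k; j < m;
        \<kappa> \<in> carrier (ops P k); \<mu> \<in> carrier (ops P m); \<nu> \<in> carrier (ops P n)\<rbrakk> \<Longrightarrow>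
          pcomp P (k + m - 1) n (i + j) (pcomp P k m i \<kappa> \<mu>) \<nu> =
            pcomp P k (m + n - 1) i \<kappa> (pcomp P m n j \<mu> \<nu>)"
    and pcomp_assoc_parallel:
      "\<lbrakk>i < j; j < k;
        \<kappa> \<in> carrier (ops P k); \<mu> \<in> carrier (ops P m); \<nu> \<in> carrier (ops P n)\<rbrakk> \<Longrightarrow>
          pcomp P (k + m - 1) n (j + m - 1) (pcomp P k m i \<kappa> \<mu>) \<nu> =
            pcomp P (k + n - 1) m i (pcomp P k n j \<kappa> \<nu>) \<mu>"
    and unit_left: "\<nu> \<in> carrier (ops P n) \<Longrightarrow> pcomp P 1 n 0 (unit P) \<nu> = \<nu>"
    and unit_right: "\<lbrakk>i < m; \<mu> \<in> carrier (ops P m)\<rbrakk> \<Longrightarrow> pcomp P m 1 i \<mu> (unit P) = \<mu>"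

text \<open>
  Complete composition
  \<open>\<mu>(\<nu>\<^sub>1, \<dots>, \<nu>\<^sub>k) = (\<cdots>((\<mu> \<circ>\<^sub>k \<nu>\<^sub>k) \<circ>\<^bsub>k-1\<^esub> \<nu>\<^bsub>k-1\<^esub>)\<cdots>) \<circ>\<^sub>1 \<nu>\<^sub>1\<close>; each \<open>\<nu>\<^sub>i\<close> is given together with its
  arity, and the fold keeps track of the arity of the intermediate result.
\<close>

definition full_comp :: "('r, 'p) operad_data \<Rightarrow> 'p \<Rightarrow> (nat \<times> 'p) list \<Rightarrow> 'p"
  where "full_comp P \<mu> \<nu>s =
    snd (foldr (\<lambda>(i, n, \<nu>) (m, \<kappa>). (m + n - 1, pcomp P m n i \<kappa> \<nu>))
           (zip [0..<length \<nu>s] \<nu>s) (length \<nu>s, \<mu>))"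


section \<open>The module \<open>S(P, V)\<close>\<close>

definition free_module :: "('r, 'x) ring_scheme \<Rightarrow> 'b set \<Rightarrow> ('r, 'b \<Rightarrow> 'r) module"
  where "free_module R B =
    \<lparr>carrier = {f. f \<in> B \<rightarrow> carrier R \<and> (\<forall>b. b \<notin> B \<longrightarrow> f b = \<zero>\<^bsub>R\<^esub>) \<and>
                   finite {b. f b \<noteq> \<zero>\<^bsub>R\<^esub>}},
     monoid.mult = undefined, one = undefined,
     zero = (\<lambda>b. \<zero>\<^bsub>R\<^esub>), add = (\<lambda>f g b. f b \<oplus>\<^bsub>R\<^esub> g b),
     smult = (\<lambda>r f b. r \<otimes>\<^bsub>R\<^esub> f b)\<rparr>"

definition basis_elt :: "('r, 'x) ring_scheme \<Rightarrow> 'b \<Rightarrow> 'b \<Rightarrow> 'r"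
  where "basis_elt R b = (\<lambda>b'. if b' = b then \<one>\<^bsub>R\<^esub> else \<zero>\<^bsub>R\<^esub>)"

definition generated_submodule ::
    "('r, 'x) ring_scheme \<Rightarrow> ('r, 'a, 'y) module_scheme \<Rightarrow> 'a set \<Rightarrow> 'a set"
  where "generated_submodule R M K = \<Inter>{N. submodule N R M \<and> K \<subseteq> N}"

definition quotient_module ::
    "('r, 'a, 'y) module_scheme \<Rightarrow> 'a set \<Rightarrow> ('r, 'a set) module"
  where "quotient_module M N =
    \<lparr>carrier = a_rcosets\<^bsub>M\<^esub> N, monoid.mult = undefined, one = undefined,
     zero = N, add = set_add M,
     smult = (\<lambda>r X. \<Union>x \<in> X. N +>\<^bsub>M\<^esub> (r \<odot>\<^bsub>M\<^esub> x))\<rparr>"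

text \<open>
  A direct sum of quotients of free modules is a quotient of the free module on the disjoint union
  of the bases, so \<open>S(P, V)\<close> is presented by the symbols \<open>(\<mu>; v\<^sub>1, \<dots>, v\<^sub>n)\<close> with \<open>\<mu> \<in> P(n)\<close>, for all
  \<open>n\<close> at once, subject to multilinearity (tensor product) and to the identification
  \<open>(\<mu>\<sigma>; v\<^bsub>\<sigma> 1\<^esub>, \<dots>, v\<^bsub>\<sigma> n\<^esub>) \<sim> (\<mu>; v\<^sub>1, \<dots>, v\<^sub>n)\<close> (coinvariants of the diagonal action).
  The arity of \<open>\<mu>\<close> is the length of the list.
\<close>

definition S_symbols ::
    "('r, 'p) operad_data \<Rightarrow> ('r, 'a, 'y) module_scheme \<Rightarrow> ('p \<times> 'a list) set"
  where "S_symbols P V = {(\<mu>, vs). \<mu> \<in> carrier (ops P (length vs)) \<and> set vs \<subseteq> carrier V}"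

definition S_free ::
    "('r, 'x) ring_scheme \<Rightarrow> ('r, 'p) operad_data \<Rightarrow> ('r, 'a, 'y) module_scheme \<Rightarrow>
      ('r, 'p \<times> 'a list \<Rightarrow> 'r) module"
  where "S_free R P V = free_module R (S_symbols P V)"

inductive_set S_relations ::
    "('r, 'x) ring_scheme \<Rightarrow> ('r, 'p) operad_data \<Rightarrow> ('r, 'a, 'y) module_scheme \<Rightarrow>
      ('p \<times> 'a list \<Rightarrow> 'r) set"
  for R P V
  where
    op_add:
      "\<lbrakk>(\<mu>, vs) \<in> S_symbols P V; (\<mu>', vs) \<in> S_symbols P V\<rbrakk> \<Longrightarrow>
         basis_elt R (\<mu> \<oplus>\<^bsub>ops P (length vs)\<^esub> \<mu>', vs) \<ominus>\<^bsub>S_free R P V\<^esub>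
           (basis_elt R (\<mu>, vs) \<oplus>\<^bsub>S_free R P V\<^esub> basis_elt R (\<mu>', vs)) \<in> S_relations R P V"
  | op_smult:
      "\<lbrakk>r \<in> carrier R; (\<mu>, vs) \<in> S_symbols P V\<rbrakk> \<Longrightarrow>
         basis_elt R (r \<odot>\<^bsub>ops P (length vs)\<^esub> \<mu>, vs) \<ominus>\<^bsub>S_free R P V\<^esub>
           (r \<odot>\<^bsub>S_free R P V\<^esub> basis_elt R (\<mu>, vs)) \<in> S_relations R P V"
  | arg_add:
      "\<lbrakk>(\<mu>, vs) \<in> S_symbols P V; i < length vs; v \<in> carrier V; v' \<in> carrier V\<rbrakk> \<Longrightarrow>
         basis_elt R (\<mu>, vs[i := v \<oplus>\<^bsub>V\<^esub> v']) \<ominus>\<^bsub>S_free R P V\<^esub>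
           (basis_elt R (\<mu>, vs[i := v]) \<oplus>\<^bsub>S_free R P V\<^esub> basis_elt R (\<mu>, vs[i := v']))
           \<in> S_relations R P V"
  | arg_smult:
      "\<lbrakk>r \<in> carrier R; (\<mu>, vs) \<in> S_symbols P V; i < length vs; v \<in> carrier V\<rbrakk> \<Longrightarrow>
         basis_elt R (\<mu>, vs[i := r \<odot>\<^bsub>V\<^esub> v]) \<ominus>\<^bsub>S_free R P V\<^esub>
           (r \<odot>\<^bsub>S_free R P V\<^esub> basis_elt R (\<mu>, vs[i := v])) \<in> S_relations R P V"
  | symmetry:
      "\<lbrakk>(\<mu>, vs) \<in> S_symbols P V; \<sigma> permutes {..<length vs}\<rbrakk> \<Longrightarrow>
         basis_elt R (sym P (length vs) \<mu> \<sigma>, permute_list \<sigma> vs) \<ominus>\<^bsub>S_free R P V\<^esub>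
           basis_elt R (\<mu>, vs) \<in> S_relations R P V"

definition S_submodule ::
    "('r, 'x) ring_scheme \<Rightarrow> ('r, 'p) operad_data \<Rightarrow> ('r, 'a, 'y) module_scheme \<Rightarrow>
      ('p \<times> 'a list \<Rightarrow> 'r) set"
  where "S_submodule R P V = generated_submodule R (S_free R P V) (S_relations R P V)"

definition S_module ::
    "('r, 'x) ring_scheme \<Rightarrow> ('r, 'p) operad_data \<Rightarrow> ('r, 'a, 'y) module_scheme \<Rightarrow>
      ('r, ('p \<times> 'a list \<Rightarrow> 'r) set) module"
  where "S_module R P V = quotient_module (S_free R P V) (S_submodule R P V)"

definition S_class ::
    "('r, 'x) ring_scheme \<Rightarrow> ('r, 'p) operad_data \<Rightarrow> ('r, 'a, 'y) module_scheme \<Rightarrow>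
      'p \<Rightarrow> 'a list \<Rightarrow> ('p \<times> 'a list \<Rightarrow> 'r) set"
  where "S_class R P V \<mu> vs = S_submodule R P V +>\<^bsub>S_free R P V\<^esub> basis_elt R (\<mu>, vs)"


section \<open>Algebras over an operad\<close>

text \<open>
  \<open>act A \<mu> [a\<^sub>1, \<dots>, a\<^sub>n]\<close> is \<open>\<mu>(a\<^sub>1, \<dots>, a\<^sub>n)\<close>, the value of the structure map on the class
  \<open>(\<mu>; a\<^sub>1, \<dots>, a\<^sub>n)\<close>. As these classes generate \<open>S(P, A)\<close>, it determines the structure map.
\<close>

record ('r, 'a, 'p) alg_data = "('r, 'a) module" +
  act :: "'p \<Rightarrow> 'a list \<Rightarrow> 'a"

locale operad_algebra = module R A
  for R :: "('r, 'x) ring_scheme" (structure) and P :: "('r, 'p) operad_data"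
    and A :: "('r, 'a, 'p) alg_data" +
  assumes structure_map:
      "\<exists>\<theta> \<in> linear_maps R (S_module R P A) A.
         \<forall>(\<mu>, as) \<in> S_symbols P A. \<theta> (S_class R P A \<mu> as) = act A \<mu> as"
    and act_unit: "a \<in> carrier A \<Longrightarrow> act A (unit P) [a] = a"
    and act_comp:
      "\<lbrakk>\<mu> \<in> carrier (ops P k); length \<nu>s = k; length ass = k;
        \<And>i. i < k \<Longrightarrow> \<nu>s ! i \<in> carrier (ops P (length (ass ! i))) \<and> set (ass ! i) \<subseteq> carrier A\<rbrakk>
       \<Longrightarrow> act A \<mu> (map2 (act A) \<nu>s ass) =
             act A (full_comp P \<mu> (zip (map length ass) \<nu>s)) (concat ass)"

definition alg_homs ::
    "('r, 'x) ring_scheme \<Rightarrow> ('r, 'p) operad_data \<Rightarrow>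
      ('r, 'a, 'p) alg_data \<Rightarrow> ('r, 'b, 'p) alg_data \<Rightarrow> ('a \<Rightarrow> 'b) set"
  where "alg_homs R P A B =
    {f \<in> linear_maps R A B.
       \<forall>(\<mu>, as) \<in> S_symbols P A. f (act A \<mu> as) = act B \<mu> (map f as)}"


section \<open>The category of algebras and its tangent structure\<close>

text \<open>
  A category of algebras has to have all its carriers inside one type, and that type must be closed
  under tupling. The carriers are therefore arbitrary subsets of the type of nested finite tuples
  over an arbitrary type \<open>'a\<close>; in particular every set of elements of \<open>'a\<close> is available as a carrier,
  via \<open>Atom\<close>.
\<close>

datatype 'a universe = Atom 'a | Tup "'a universe list"

primrec untup :: "'a universe \<Rightarrow> 'a universe list"
  where
    "untup (Atom a) = []"
  | "untup (Tup xs) = xs"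

text \<open>Arrows are functions that are \<open>undefined\<close> outside the carrier of their source.\<close>

record ('r, 'a, 'p) alg_arrow =
  src :: "('r, 'a, 'p) alg_data"
  tgt :: "('r, 'a, 'p) alg_data"
  fn :: "'a \<Rightarrow> 'a"

definition mk_arrow ::
    "('r, 'a, 'p) alg_data \<Rightarrow> ('r, 'a, 'p) alg_data \<Rightarrow> ('a \<Rightarrow> 'a) \<Rightarrow> ('r, 'a, 'p) alg_arrow"
  where "mk_arrow A B f = \<lparr>src = A, tgt = B, fn = restrict f (carrier A)\<rparr>"

definition ALG ::
    "('r, 'x) ring_scheme \<Rightarrow> ('r, 'p) operad_data \<Rightarrow>
      (('r, 'a universe, 'p) alg_data, ('r, 'a universe, 'p) alg_arrow) category"
  where "ALG R P =
    \<lparr>Obj = {A. operad_algebra R P A},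
     Arr = {\<phi>. operad_algebra R P (src \<phi>) \<and> operad_algebra R P (tgt \<phi>) \<and>
               fn \<phi> \<in> alg_homs R P (src \<phi>) (tgt \<phi>) \<and> fn \<phi> \<in> extensional (carrier (src \<phi>))},
     Dom = src, Cod = tgt,
     Id = (\<lambda>A. mk_arrow A A (\<lambda>a. a)),
     Comp = (\<lambda>\<psi> \<phi>. mk_arrow (src \<phi>) (tgt \<psi>) (\<lambda>a. fn \<psi> (fn \<phi> a)))\<rparr>"

text \<open>\<open>semidirect n A\<close> is \<open>A \<ltimes> A\<^sup>n\<close>; its elements are the tuples \<open>Tup [a, b\<^sub>1, \<dots>, b\<^sub>n]\<close>.\<close>

definition semidirect ::
    "nat \<Rightarrow> ('r, 'a universe, 'p) alg_data \<Rightarrow> ('r, 'a universe, 'p) alg_data"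
  where "semidirect n A =
    \<lparr>carrier = {Tup xs | xs. length xs = n + 1 \<and> set xs \<subseteq> carrier A},
     monoid.mult = undefined, one = undefined,
     zero = Tup (replicate (n + 1) \<zero>\<^bsub>A\<^esub>),
     add = (\<lambda>x y. Tup (map2 (add A) (untup x) (untup y))),
     smult = (\<lambda>r x. Tup (map (smult A r) (untup x))),
     act = (\<lambda>\<mu> xs.
       let as = map (\<lambda>x. untup x ! 0) xs in
         Tup (act A \<mu> as #
              map (\<lambda>j. \<Oplus>\<^bsub>A\<^esub>i \<in> {..<length xs}. act A \<mu> (as[i := untup (xs ! i) ! j]))
                [1..<n + 1]))\<rparr>"

definition tan_T :: "('r, 'a universe, 'p) alg_data \<Rightarrow> ('r, 'a universe, 'p) alg_data"
  where "tan_T A = semidirect 1 A"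

definition tan_Tm :: "('r, 'a universe, 'p) alg_arrow \<Rightarrow> ('r, 'a universe, 'p) alg_arrow"
  where "tan_Tm \<phi> = mk_arrow (tan_T (src \<phi>)) (tan_T (tgt \<phi>))
    (\<lambda>x. case x of Tup [a, b] \<Rightarrow> Tup [fn \<phi> a, fn \<phi> b])"

definition tan_p :: "('r, 'a universe, 'p) alg_data \<Rightarrow> ('r, 'a universe, 'p) alg_arrow"
  where "tan_p A = mk_arrow (tan_T A) A (\<lambda>x. case x of Tup [a, b] \<Rightarrow> a)"

definition tan_q ::
    "nat \<Rightarrow> nat \<Rightarrow> ('r, 'a universe, 'p) alg_data \<Rightarrow> ('r, 'a universe, 'p) alg_arrow"
  where "tan_q n j A = mk_arrow (semidirect n A) (tan_T A)
    (\<lambda>x. case x of Tup (a # bs) \<Rightarrow> Tup [a, bs ! (j - 1)])"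

definition tan_s :: "('r, 'a universe, 'p) alg_data \<Rightarrow> ('r, 'a universe, 'p) alg_arrow"
  where "tan_s A = mk_arrow (semidirect 2 A) (tan_T A)
    (\<lambda>x. case x of Tup [a, b1, b2] \<Rightarrow> Tup [a, b1 \<oplus>\<^bsub>A\<^esub> b2])"

definition tan_z :: "('r, 'a universe, 'p) alg_data \<Rightarrow> ('r, 'a universe, 'p) alg_arrow"
  where "tan_z A = mk_arrow A (tan_T A) (\<lambda>a. Tup [a, \<zero>\<^bsub>A\<^esub>])"

definition tan_l :: "('r, 'a universe, 'p) alg_data \<Rightarrow> ('r, 'a universe, 'p) alg_arrow"
  where "tan_l A = mk_arrow (tan_T A) (tan_T (tan_T A))
    (\<lambda>x. case x of Tup [a, b] \<Rightarrow> Tup [Tup [a, \<zero>\<^bsub>A\<^esub>], Tup [\<zero>\<^bsub>A\<^esub>, b]])"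

definition tan_c :: "('r, 'a universe, 'p) alg_data \<Rightarrow> ('r, 'a universe, 'p) alg_arrow"
  where "tan_c A = mk_arrow (tan_T (tan_T A)) (tan_T (tan_T A))
    (\<lambda>x. case x of Tup [Tup [a, b], Tup [c, d]] \<Rightarrow> Tup [Tup [a, c], Tup [b, d]])"

definition tan_n :: "('r, 'a universe, 'p) alg_data \<Rightarrow> ('r, 'a universe, 'p) alg_arrow"
  where "tan_n A = mk_arrow (tan_T A) (tan_T A)
    (\<lambda>x. case x of Tup [a, b] \<Rightarrow> Tup [a, \<ominus>\<^bsub>A\<^esub> b])"

end

(*
  The derivative of an operation mu, in direction b at the point a, is the Leibniz sum
  mu(b_1, a_2, ..., a_m) + ... + mu(a_1, ..., a_(m-1), b_m). It is linear in mu and in b, satisfies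
  the chain rule for full compositions, and its iterate is symmetric in the two directions. The first
  two facts make the semi-direct products algebras, and the symmetry makes the canonical flip a
  morphism. Everything else is a calculation with elements: limits of algebras are computed on
  underlying sets, so a jointly injective family of morphisms through which every compatible family of
  elements lifts is a limit cone, and T preserves this property.
*)
theory Submission
  imports Defs
begin


section \<open>Linear maps\<close>

text \<open>Two obstacles shape the argument. The structure map of an algebra is only postulated to
  exist, on a quotient of a free module, so before any calculation
  \<open>structure_map_iff_multilinear_action\<close> trades it for conditions on \<open>act\<close>
  alone. And \<open>coord j\<close> with \<open>j \<ge> 1\<close> is linear but in general not a
  morphism on a semi-direct product, so the algebra axioms of \<open>semidirect n A\<close> cannot
  be pulled back along projections, as they are for finite products; linearity, symmetry and the
  chain rule of \<open>leibniz\<close> take the place of that argument. The recurring device is a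
  jointly injective family of maps: it transports linearity, the morphism property and equations,
  leaving only closure and existence to check. Finally, all powers of the functor have to preserve
  pullbacks, and the comparison maps are required for every product cone, not just the constructed
  one. Universal properties say nothing about elements and are not visibly preserved by
  \<open>tan_T\<close>, so the induction over powers runs on \<open>limit_cone\<close>, and an
  arbitrary product cone is first shown to be concrete by comparing it with
  \<open>product_algebra\<close>.\<close>

lemma linear_mapsI:
  assumes "\<And>x. x \<in> carrier M \<Longrightarrow> f x \<in> carrier N"
    and "\<And>x y. \<lbrakk>x \<in> carrier M; y \<in> carrier M\<rbrakk> \<Longrightarrow> f (x \<oplus>\<^bsub>M\<^esub> y) = f x \<oplus>\<^bsub>N\<^esub> f y"
    and "\<And>r x. \<lbrakk>r \<in> carrier R; x \<in> carrier M\<rbrakk> \<Longrightarrow> f (r \<odot>\<^bsub>M\<^esub> x) = r \<odot>\<^bsub>N\<^esub> f x"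
  shows "f \<in> linear_maps R M N"
  using assms by (auto simp: linear_maps_def)

lemma linear_mapsD:
  assumes "f \<in> linear_maps R M N"
  shows linear_maps_closed: "x \<in> carrier M \<Longrightarrow> f x \<in> carrier N"
    and linear_maps_add:
      "\<lbrakk>x \<in> carrier M; y \<in> carrier M\<rbrakk> \<Longrightarrow> f (x \<oplus>\<^bsub>M\<^esub> y) = f x \<oplus>\<^bsub>N\<^esub> f y"
    and linear_maps_smult:
      "\<lbrakk>r \<in> carrier R; x \<in> carrier M\<rbrakk> \<Longrightarrow> f (r \<odot>\<^bsub>M\<^esub> x) = r \<odot>\<^bsub>N\<^esub> f x"
  using assms by (auto simp: linear_maps_def)

lemma linear_maps_cong:
  assumes "module R M" and "f \<in> linear_maps R M N" and "\<And>x. x \<in> carrier M \<Longrightarrow> g x = f x"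
  shows "g \<in> linear_maps R M N"
proof -
  interpret module R M by fact
  show ?thesis
    using assms(2,3) by (auto intro!: linear_mapsI simp: linear_mapsD[OF assms(2)])
qed

lemma linear_maps_comp:
  assumes "f \<in> linear_maps R L M" and "g \<in> linear_maps R M N"
  shows "(\<lambda>x. g (f x)) \<in> linear_maps R L N"
  using assms by (auto simp: linear_maps_def Pi_def)

lemma linear_maps_zero:
  assumes "module R M" and "module R N" and "f \<in> linear_maps R M N"
  shows "f \<zero>\<^bsub>M\<^esub> = \<zero>\<^bsub>N\<^esub>"
proof -
  interpret M: module R M by fact
  interpret N: module R N by fact
  have "f (\<zero>\<^bsub>R\<^esub> \<odot>\<^bsub>M\<^esub> \<zero>\<^bsub>M\<^esub>) = \<zero>\<^bsub>R\<^esub> \<odot>\<^bsub>N\<^esub> f \<zero>\<^bsub>M\<^esub>"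
    by (rule linear_maps_smult[OF assms(3)]) auto
  then show ?thesis
    using linear_maps_closed[OF assms(3)] by simp
qed

lemma linear_maps_minus:
  assumes "module R M" and "module R N" and "f \<in> linear_maps R M N" and "x \<in> carrier M"
  shows "f (\<ominus>\<^bsub>M\<^esub> x) = \<ominus>\<^bsub>N\<^esub> f x"
proof -
  interpret M: module R M by fact
  interpret N: module R N by fact
  have "f (\<ominus>\<^bsub>M\<^esub> x) \<oplus>\<^bsub>N\<^esub> f x = \<zero>\<^bsub>N\<^esub>"
    using linear_maps_add[OF assms(3), of "\<ominus>\<^bsub>M\<^esub> x" x] assms(4)
    by (simp add: M.M.l_neg linear_maps_zero[OF assms(1-3)])
  then show ?thesis
    using assms(4) linear_maps_closed[OF assms(3)] by (metis N.M.minus_equality M.M.a_inv_closed)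
qed

text \<open>An identity in \<open>N\<close> may be tested after every \<open>\<pi> i\<close>. There
  both sides agree because \<open>\<pi> i\<close> and its composite with \<open>f\<close> are
  linear, so \<open>f\<close> inherits linearity without being known explicitly.\<close>

lemma linear_maps_by_components:
  assumes "module R L" and "module R N"
    and closed: "\<And>x. x \<in> carrier L \<Longrightarrow> f x \<in> carrier N"
    and \<pi>: "\<And>i. i \<in> I \<Longrightarrow> \<pi> i \<in> linear_maps R N (M i)"
    and inj: "\<And>x y. \<lbrakk>x \<in> carrier N; y \<in> carrier N; \<And>i. i \<in> I \<Longrightarrow> \<pi> i x = \<pi> i y\<rbrakk> \<Longrightarrow> x = y"
    and f: "\<And>i. i \<in> I \<Longrightarrow> (\<lambda>x. \<pi> i (f x)) \<in> linear_maps R L (M i)"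
  shows "f \<in> linear_maps R L N"
proof -
  interpret L: module R L by fact
  interpret N: module R N by fact
  show ?thesis
    by (rule linear_mapsI; (rule inj)?)
      (auto simp: closed linear_mapsD(2,3)[OF \<pi>] linear_mapsD(2,3)[OF f])
qed

lemma linear_maps_finsum:
  assumes "module R M" and "module R N" and "f \<in> linear_maps R M N"
    and "g \<in> I \<rightarrow> carrier M"
  shows "f (\<Oplus>\<^bsub>M\<^esub>i \<in> I. g i) = (\<Oplus>\<^bsub>N\<^esub>i \<in> I. f (g i))"
proof -
  interpret M: module R M by fact
  interpret N: module R N by fact
  show ?thesis
    using assms(4)
  proof (induction I rule: infinite_finite_induct)
    \<comment> \<open>\<open>finsum\<close> over an infinite index set is zero by convention, so
      this case, like the empty one, says that \<open>f\<close> preserves zero.\<close>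
    case (infinite I)
    then show ?case
      using linear_maps_zero[OF assms(1-3)] by simp
  next
    case empty
    then show ?case
      using linear_maps_zero[OF assms(1-3)] by simp
  next
    case (insert i I)
    have "finsum M g I \<in> carrier M"
      using insert by (auto intro!: M.M.finsum_closed)
    then show ?case
      using insert linear_mapsD[OF assms(3)] by (simp add: Pi_def)
  qed
qed

section \<open>Finite sums: exchange and collapse\<close>

lemma (in abelian_monoid) finsum_swap:
  assumes "finite I" and "finite J" and "\<And>i j. \<lbrakk>i \<in> I; j \<in> J\<rbrakk> \<Longrightarrow> f i j \<in> carrier G"
  shows "(\<Oplus>i \<in> I. \<Oplus>j \<in> J. f i j) = (\<Oplus>j \<in> J. \<Oplus>i \<in> I. f i j)"
  using assms(1,3)
proof (induction I)
  case empty
  then show ?case by simp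
next
  case (insert k I)
  have "(\<Oplus>i \<in> insert k I. \<Oplus>j \<in> J. f i j) = (\<Oplus>j \<in> J. f k j) \<oplus> (\<Oplus>j \<in> J. \<Oplus>i \<in> I. f i j)"
    using insert by (simp add: Pi_def)
  also have "\<dots> = (\<Oplus>j \<in> J. f k j \<oplus> (\<Oplus>i \<in> I. f i j))"
    using insert by (subst finsum_addf) (auto intro!: finsum_closed)
  also have "\<dots> = (\<Oplus>j \<in> J. \<Oplus>i \<in> insert k I. f i j)"
    using insert by (intro finsum_cong') (auto intro!: finsum_closed)
  finally show ?case .
qed

text \<open>Needed for the vertical lift, where all terms of an inner Leibniz sum but one
  vanish.\<close>

lemma (in abelian_monoid) finsum_eq_single:
  assumes "finite I" and "k \<in> I" and "\<And>i. \<lbrakk>i \<in> I; i \<noteq> k\<rbrakk> \<Longrightarrow> f i = \<zero>" and "f k \<in> carrier G"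
  shows "(\<Oplus>i \<in> I. f i) = f k"
proof -
  have "(\<Oplus>i \<in> I. f i) = (\<Oplus>i \<in> I. if i = k then f i else \<zero>)"
    using assms by (intro finsum_cong') auto
  also have "\<dots> = (\<Oplus>i \<in> I. if i = k then f k else \<zero>)"
    using assms by (intro finsum_cong') auto
  finally show ?thesis
    using add.finprod_singleton_swap[of k I "\<lambda>_. f k"] assms by simp
qed

text \<open>Rings are not modules in HOL-Algebra, since the record type lacks a scalar multiplication.\<close>

definition regular_module :: "('r, 'x) ring_scheme \<Rightarrow> ('r, 'r) module"
  where "regular_module R =
    \<lparr>carrier = carrier R, monoid.mult = undefined, one = undefined,
     zero = \<zero>\<^bsub>R\<^esub>, add = add R, smult = monoid.mult R\<rparr>"

lemma regular_module_simps [simp]: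
  "carrier (regular_module R) = carrier R"
  "zero (regular_module R) = zero R"
  "add (regular_module R) = add R"
  "smult (regular_module R) = monoid.mult R"
  by (simp_all add: regular_module_def)

lemma (in cring) regular_module: "module R (regular_module R)"
proof -
  have "\<exists>y \<in> carrier R. y \<oplus> x = \<zero>" if "x \<in> carrier R" for x
    using that l_neg by blast
  then show ?thesis
    by (intro moduleI abelian_groupI) (auto simp: is_cring a_ac l_distr r_distr m_assoc)
qed

text \<open>No inverse map is part of a module record, so existence of negatives is a hypothesis.\<close>

lemma module_by_components:
  assumes "cring R"
    and M: "\<And>i. i \<in> I \<Longrightarrow> module R (M i)"
    and closed: "\<And>i x. \<lbrakk>i \<in> I; x \<in> carrier N\<rbrakk> \<Longrightarrow> \<pi> i x \<in> carrier (M i)"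
    and inj: "\<And>x y. \<lbrakk>x \<in> carrier N; y \<in> carrier N; \<And>i. i \<in> I \<Longrightarrow> \<pi> i x = \<pi> i y\<rbrakk> \<Longrightarrow> x = y"
    and zero: "\<zero>\<^bsub>N\<^esub> \<in> carrier N" "\<And>i. i \<in> I \<Longrightarrow> \<pi> i \<zero>\<^bsub>N\<^esub> = \<zero>\<^bsub>M i\<^esub>"
    and add_closed: "\<And>x y. \<lbrakk>x \<in> carrier N; y \<in> carrier N\<rbrakk> \<Longrightarrow> x \<oplus>\<^bsub>N\<^esub> y \<in> carrier N"
    and add: "\<And>i x y. \<lbrakk>i \<in> I; x \<in> carrier N; y \<in> carrier N\<rbrakk> \<Longrightarrow>
      \<pi> i (x \<oplus>\<^bsub>N\<^esub> y) = \<pi> i x \<oplus>\<^bsub>M i\<^esub> \<pi> i y"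
    and smult_closed: "\<And>r x. \<lbrakk>r \<in> carrier R; x \<in> carrier N\<rbrakk> \<Longrightarrow> r \<odot>\<^bsub>N\<^esub> x \<in> carrier N"
    and smult: "\<And>i r x. \<lbrakk>i \<in> I; r \<in> carrier R; x \<in> carrier N\<rbrakk> \<Longrightarrow>
      \<pi> i (r \<odot>\<^bsub>N\<^esub> x) = r \<odot>\<^bsub>M i\<^esub> \<pi> i x"
    and neg: "\<And>x. x \<in> carrier N \<Longrightarrow> \<exists>y \<in> carrier N. \<forall>i \<in> I. \<pi> i y = \<ominus>\<^bsub>M i\<^esub> \<pi> i x"
  shows "module R N"
proof -
  interpret cring R by fact
  note ag = module.axioms(2)[OF M]
  note am = abelian_group.axioms(1)[OF ag]
  show ?thesis
  proof (rule moduleI[OF \<open>cring R\<close> abelian_groupI])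
    fix x assume x: "x \<in> carrier N"
    from neg[OF x] obtain y where y: "y \<in> carrier N" "\<And>i. i \<in> I \<Longrightarrow> \<pi> i y = \<ominus>\<^bsub>M i\<^esub> \<pi> i x"
      by blast
    show "\<exists>y \<in> carrier N. y \<oplus>\<^bsub>N\<^esub> x = \<zero>\<^bsub>N\<^esub>"
      using x y by (intro bexI[of _ y] inj) (auto simp: add zero add_closed closed
          abelian_group.l_neg[OF ag])
  qed (auto intro!: inj add_closed smult_closed zero(1)
      simp: add zero smult closed add_closed smult_closed abelian_monoid.a_assoc[OF am]
        abelian_monoid.a_comm[OF am] abelian_monoid.l_zero[OF am]
        module.smult_l_distr[OF M] module.smult_r_distr[OF M] module.smult_assoc1[OF M]
        module.smult_one[OF M])
qed


section \<open>Free modules and quotients\<close>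

lemma free_module_simps [simp]:
  "zero (free_module R B) = (\<lambda>b. \<zero>\<^bsub>R\<^esub>)"
  "add (free_module R B) = (\<lambda>f g b. f b \<oplus>\<^bsub>R\<^esub> g b)"
  "smult (free_module R B) = (\<lambda>r f b. r \<otimes>\<^bsub>R\<^esub> f b)"
  by (simp_all add: free_module_def)

lemma in_free_module_iff:
  "f \<in> carrier (free_module R B) \<longleftrightarrow>
    (\<forall>b \<in> B. f b \<in> carrier R) \<and> (\<forall>b. b \<notin> B \<longrightarrow> f b = \<zero>\<^bsub>R\<^esub>) \<and> finite {b. f b \<noteq> \<zero>\<^bsub>R\<^esub>}"
  by (auto simp: free_module_def)

text \<open>Both negatives are the same description over the same carrier, addition and zero, so
  unfolding the definitions suffices.\<close>

lemma a_inv_regular_module: "\<ominus>\<^bsub>regular_module R\<^esub> x = \<ominus>\<^bsub>R\<^esub> x"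
  by (simp add: a_inv_def m_inv_def regular_module_def)

text \<open>A finite superset of the support is enough; for a sum of two functions the union of
  their supports serves, although cancellation may make the true support smaller.\<close>

lemma free_module_closedI:
  assumes "\<And>b. b \<in> B \<Longrightarrow> f b \<in> carrier R" and "\<And>b. b \<notin> S \<Longrightarrow> f b = \<zero>\<^bsub>R\<^esub>" and "finite S" and "S \<subseteq> B"
  shows "f \<in> carrier (free_module R B)"
proof -
  have "{b. f b \<noteq> \<zero>\<^bsub>R\<^esub>} \<subseteq> S"
    using assms(2) by blast
  then have "finite {b. f b \<noteq> \<zero>\<^bsub>R\<^esub>}"
    using assms(3) by (rule finite_subset)
  then show ?thesis
    using assms by (auto simp: in_free_module_iff)
qed

lemma (in cring) module_free_module: "module R (free_module R B)"
proof -
  have closed: "f b \<in> carrier R" if "f \<in> carrier (free_module R B)" for f b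
    using that by (cases "b \<in> B") (auto simp: in_free_module_iff)
  have supp: "finite {b. f b \<noteq> \<zero>}" "{b. f b \<noteq> \<zero>} \<subseteq> B" if "f \<in> carrier (free_module R B)" for f
    using that by (auto simp: in_free_module_iff)
  show ?thesis
  \<comment> \<open>The components are evaluations at all points, not only those of
    \<open>B\<close>: off \<open>B\<close> the value is zero, which lies in \<open>R\<close>, and
    joint injectivity becomes extensionality of functions.\<close>
  proof (rule module_by_components[where I = UNIV and M = "\<lambda>_. regular_module R" and \<pi> = "\<lambda>b f. f b"])
    show "\<zero>\<^bsub>free_module R B\<^esub> \<in> carrier (free_module R B)"
      by (rule free_module_closedI[of _ _ _ "{}"]) auto
  next
    fix f g assume fg: "f \<in> carrier (free_module R B)" "g \<in> carrier (free_module R B)"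
    show "f \<oplus>\<^bsub>free_module R B\<^esub> g \<in> carrier (free_module R B)"
      by (rule free_module_closedI[of _ _ _ "{b. f b \<noteq> \<zero>} \<union> {b. g b \<noteq> \<zero>}"])
        (use closed supp fg in simp_all)
  next
    fix r f assume rf: "r \<in> carrier R" "f \<in> carrier (free_module R B)"
    show "r \<odot>\<^bsub>free_module R B\<^esub> f \<in> carrier (free_module R B)"
      by (rule free_module_closedI[of _ _ _ "{b. f b \<noteq> \<zero>}"]) (use closed supp rf in simp_all)
  next
    fix f assume f: "f \<in> carrier (free_module R B)"
    have "(\<lambda>b. \<ominus> f b) \<in> carrier (free_module R B)"
      by (rule free_module_closedI[of _ _ _ "{b. f b \<noteq> \<zero>}"]) (use closed supp f in simp_all)
    then show "\<exists>g \<in> carrier (free_module R B).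
        \<forall>b \<in> UNIV. g b = \<ominus>\<^bsub>regular_module R\<^esub> f b"
      by (auto simp: a_inv_regular_module)
  qed (simp_all add: is_cring regular_module closed ext)
qed

lemma (in cring) basis_elt_closed:
  assumes "b \<in> B"
  shows "basis_elt R b \<in> carrier (free_module R B)"
  by (rule free_module_closedI[of _ _ _ "{b}"]) (use assms in \<open>auto simp: basis_elt_def\<close>)

section \<open>Linear extension from a basis, and generated submodules\<close>

definition linear_ext ::
    "('r, 'x) ring_scheme \<Rightarrow> ('r, 'a, 'y) module_scheme \<Rightarrow> ('b \<Rightarrow> 'a) \<Rightarrow> ('b \<Rightarrow> 'r) \<Rightarrow> 'a"
  where "linear_ext R M \<phi> f = (\<Oplus>\<^bsub>M\<^esub>b \<in> {b. f b \<noteq> \<zero>\<^bsub>R\<^esub>}. f b \<odot>\<^bsub>M\<^esub> \<phi> b)"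

context module
begin

text \<open>Points of \<open>S\<close> outside the support contribute zero. This frees the sum from
  the exact support, which is different for \<open>f\<close>, \<open>g\<close> and their
  sum.\<close>

lemma linear_ext_eq_finsum:
  assumes "f \<in> carrier (free_module R B)" and "\<phi> \<in> B \<rightarrow> carrier M"
    and "finite S" and "S \<subseteq> B" and "{b. f b \<noteq> \<zero>} \<subseteq> S"
  shows "linear_ext R M \<phi> f = (\<Oplus>\<^bsub>M\<^esub>b \<in> S. f b \<odot>\<^bsub>M\<^esub> \<phi> b)"
  unfolding linear_ext_def
proof (rule M.add.finprod_mono_neutral_cong_left)
  show "f b \<odot>\<^bsub>M\<^esub> \<phi> b = \<zero>\<^bsub>M\<^esub>" if "b \<in> S - {b. f b \<noteq> \<zero>}" for b
    using that assms by (auto intro!: smult_l_null)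
  show "(\<lambda>b. f b \<odot>\<^bsub>M\<^esub> \<phi> b) \<in> S \<rightarrow> carrier M"
    using assms by (auto simp: in_free_module_iff intro!: smult_closed)
qed (use assms in auto)

lemma linear_ext_linear:
  assumes "\<phi> \<in> B \<rightarrow> carrier M"
  shows "linear_ext R M \<phi> \<in> linear_maps R (free_module R B) M"
proof -
  interpret F: module R "free_module R B"
    by (rule R.module_free_module)
  have supp: "{b. f b \<noteq> \<zero>} \<subseteq> B" "finite {b. f b \<noteq> \<zero>}" "b \<in> B \<Longrightarrow> f b \<in> carrier R"
    if "f \<in> carrier (free_module R B)" for f b
    using that by (auto simp: in_free_module_iff)
  show ?thesis
  proof (rule linear_mapsI)
    fix f assume f: "f \<in> carrier (free_module R B)"
    show "linear_ext R M \<phi> f \<in> carrier M"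
      unfolding linear_ext_def using supp[OF f] assms by (intro M.finsum_closed) auto
  next
    fix f g assume fg: "f \<in> carrier (free_module R B)" "g \<in> carrier (free_module R B)"
    let ?S = "{b. f b \<noteq> \<zero>} \<union> {b. g b \<noteq> \<zero>}"
    have S: "finite ?S" "?S \<subseteq> B"
      using supp fg by auto
    then have closed: "f b \<in> carrier R" "g b \<in> carrier R" "\<phi> b \<in> carrier M" if "b \<in> ?S" for b
      using that supp(3) fg assms by blast+
    have "{b. f b \<oplus> g b \<noteq> \<zero>} \<subseteq> ?S"
      by auto
    then have "linear_ext R M \<phi> (f \<oplus>\<^bsub>free_module R B\<^esub> g) = (\<Oplus>\<^bsub>M\<^esub>b \<in> ?S. (f b \<oplus> g b) \<odot>\<^bsub>M\<^esub> \<phi> b)"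
      using linear_ext_eq_finsum[OF F.M.a_closed[OF fg] assms S] by simp
    also have "\<dots> = (\<Oplus>\<^bsub>M\<^esub>b \<in> ?S. f b \<odot>\<^bsub>M\<^esub> \<phi> b \<oplus>\<^bsub>M\<^esub> g b \<odot>\<^bsub>M\<^esub> \<phi> b)"
      using closed by (intro M.finsum_cong') (blast intro!: smult_l_distr smult_closed M.a_closed)+
    also have "\<dots> = (\<Oplus>\<^bsub>M\<^esub>b \<in> ?S. f b \<odot>\<^bsub>M\<^esub> \<phi> b) \<oplus>\<^bsub>M\<^esub> (\<Oplus>\<^bsub>M\<^esub>b \<in> ?S. g b \<odot>\<^bsub>M\<^esub> \<phi> b)"
      using closed by (intro M.finsum_addf) (blast intro!: smult_closed)+
    also have "\<dots> = linear_ext R M \<phi> f \<oplus>\<^bsub>M\<^esub> linear_ext R M \<phi> g"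
      using linear_ext_eq_finsum[OF fg(1) assms S] linear_ext_eq_finsum[OF fg(2) assms S] by auto
    finally show "linear_ext R M \<phi> (f \<oplus>\<^bsub>free_module R B\<^esub> g) =
      linear_ext R M \<phi> f \<oplus>\<^bsub>M\<^esub> linear_ext R M \<phi> g" .
  next
    fix r f assume r: "r \<in> carrier R" and f: "f \<in> carrier (free_module R B)"
    let ?S = "{b. f b \<noteq> \<zero>}"
    have "{b. r \<otimes> f b \<noteq> \<zero>} \<subseteq> ?S"
      using r by auto
    then have "linear_ext R M \<phi> (r \<odot>\<^bsub>free_module R B\<^esub> f) = (\<Oplus>\<^bsub>M\<^esub>b \<in> ?S. (r \<otimes> f b) \<odot>\<^bsub>M\<^esub> \<phi> b)"
      using linear_ext_eq_finsum[OF F.smult_closed[OF r f] assms supp(2)[OF f] supp(1)[OF f]]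
      by simp
    also have "\<dots> = (\<Oplus>\<^bsub>M\<^esub>b \<in> ?S. r \<odot>\<^bsub>M\<^esub> (f b \<odot>\<^bsub>M\<^esub> \<phi> b))"
      using assms supp[OF f] r by (intro M.finsum_cong') (auto intro!: smult_assoc1 smult_closed)
    also have "\<dots> = r \<odot>\<^bsub>M\<^esub> linear_ext R M \<phi> f"
      unfolding linear_ext_def using assms supp[OF f] r
      by (intro finsum_smult_ldistr[symmetric]) (auto intro!: smult_closed)
    finally show "linear_ext R M \<phi> (r \<odot>\<^bsub>free_module R B\<^esub> f) = r \<odot>\<^bsub>M\<^esub> linear_ext R M \<phi> f" .
  qed
qed

lemma linear_ext_basis_elt:
  assumes "\<phi> \<in> B \<rightarrow> carrier M" and "b \<in> B"
  shows "linear_ext R M \<phi> (basis_elt R b) = \<phi> b"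
proof -
  have "linear_ext R M \<phi> (basis_elt R b) = (\<Oplus>\<^bsub>M\<^esub>b' \<in> {b}. basis_elt R b b' \<odot>\<^bsub>M\<^esub> \<phi> b')"
    using assms by (intro linear_ext_eq_finsum[OF R.basis_elt_closed[OF assms(2)]])
      (auto simp: basis_elt_def)
  then show ?thesis
    using assms by (simp add: basis_elt_def Pi_def)
qed

lemma submodule_Inter:
  assumes "\<And>N. N \<in> \<N> \<Longrightarrow> submodule N R M" and "\<N> \<noteq> {}"
  shows "submodule (\<Inter>\<N>) R M"
proof (rule submoduleI)
  note sub = submoduleE[OF assms(1)]
  show "\<Inter>\<N> \<subseteq> carrier M"
    using assms(2) sub(1) by blast
  show "\<zero>\<^bsub>M\<^esub> \<in> \<Inter>\<N>"
    using subgroup.one_closed[OF submodule.axioms(1)[OF assms(1)]] by simp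
  show "\<ominus>\<^bsub>M\<^esub> x \<in> \<Inter>\<N>" if "x \<in> \<Inter>\<N>" for x
    using that sub(3) by simp
  show "x \<oplus>\<^bsub>M\<^esub> y \<in> \<Inter>\<N>" if "x \<in> \<Inter>\<N>" "y \<in> \<Inter>\<N>" for x y
    using that sub(5) by simp
  show "r \<odot>\<^bsub>M\<^esub> x \<in> \<Inter>\<N>" if "r \<in> carrier R" "x \<in> \<Inter>\<N>" for r x
    using that sub(4) by simp
qed

text \<open>The intersection runs over a nonempty family because the whole module is a submodule
  containing \<open>K\<close>.\<close>

lemma generated_submodule:
  assumes "K \<subseteq> carrier M"
  shows submodule_generated_submodule: "submodule (generated_submodule R M K) R M"
    and generators_subset: "K \<subseteq> generated_submodule R M K"
  unfolding generated_submodule_def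
  using carrier_is_submodule assms by (auto intro!: submodule_Inter)

lemma generated_submodule_least:
  assumes "submodule N R M" and "K \<subseteq> N"
  shows "generated_submodule R M K \<subseteq> N"
  using assms by (auto simp: generated_submodule_def)

text \<open>Together with \<open>generated_submodule_least\<close> this shows that a linear map
  killing the generators of a submodule kills the whole submodule.\<close>

lemma submodule_kernel:
  assumes "module R A" and "f \<in> linear_maps R M A"
  shows "submodule {x \<in> carrier M. f x = \<zero>\<^bsub>A\<^esub>} R M"
proof -
  interpret A: module R A by fact
  show ?thesis
    using linear_maps_zero[OF module_axioms assms] linear_maps_minus[OF module_axioms assms]
    by (intro submoduleI) (auto simp: linear_mapsD[OF assms(2)])
qed

end

section \<open>Quotient modules and their universal property\<close>

locale module_quotient = module R M for R :: "('r, 'x) ring_scheme" (structure)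
    and M :: "('r, 'a, 'y) module_scheme" +
  fixes N
  assumes submodule: "submodule N R M"
begin

sublocale abelian_subgroup N M
  using submodule by (intro abelian_subgroupI3)
    (auto simp: additive_subgroup_def submodule_def intro: M.abelian_group_axioms)

lemma coset_eqI:
  assumes "x \<in> carrier M" and "y \<in> carrier M" and "x \<ominus>\<^bsub>M\<^esub> y \<in> N"
  shows "N +>\<^bsub>M\<^esub> x = N +>\<^bsub>M\<^esub> y"
  using assms a_coset_join2[OF _ a_subgroup assms(3)] a_subset
  by (intro a_coset_add_inv1) (auto simp: a_minus_def)

lemma coset_memD:
  assumes "x \<in> carrier M" and "y \<in> N +>\<^bsub>M\<^esub> x"
  shows "y \<in> carrier M" and "\<exists>n \<in> N. y = n \<oplus>\<^bsub>M\<^esub> x"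
  using assms a_subset by (auto simp: a_r_coset_def')

lemma quotient_map_linear: "(\<lambda>x. N +>\<^bsub>M\<^esub> x) \<in> linear_maps R M (quotient_module M N)"
proof (rule linear_mapsI)
  \<comment> \<open>Scalar multiplication of a coset is a union over its representatives. Changing
    the representative by \<open>n\<close> changes the product by a multiple of \<open>n\<close>, so
    all cosets in the union coincide; the union is nonempty because \<open>x\<close> itself is a
    representative.\<close>
  fix r x assume r: "r \<in> carrier R" and x: "x \<in> carrier M"
  have "N +>\<^bsub>M\<^esub> (r \<odot>\<^bsub>M\<^esub> y) = N +>\<^bsub>M\<^esub> (r \<odot>\<^bsub>M\<^esub> x)" if y: "y \<in> N +>\<^bsub>M\<^esub> x" for y
  proof -
    obtain n where n: "n \<in> N" "y = n \<oplus>\<^bsub>M\<^esub> x"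
      using coset_memD[OF x y] by blast
    then have nM: "n \<in> carrier M"
      using a_subset by auto
    have "r \<odot>\<^bsub>M\<^esub> y \<ominus>\<^bsub>M\<^esub> r \<odot>\<^bsub>M\<^esub> x = r \<odot>\<^bsub>M\<^esub> n"
      using n nM r x by (simp add: smult_r_distr a_minus_def M.a_assoc M.r_neg)
    then show ?thesis
      using n nM r x submodule.smult_closed[OF submodule r n(1)] by (intro coset_eqI) auto
  qed
  moreover have "x \<in> N +>\<^bsub>M\<^esub> x"
    using x by (rule a_rcos_self)
  ultimately have "(\<Union>y \<in> N +>\<^bsub>M\<^esub> x. N +>\<^bsub>M\<^esub> (r \<odot>\<^bsub>M\<^esub> y)) = N +>\<^bsub>M\<^esub> (r \<odot>\<^bsub>M\<^esub> x)"
    by blast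
  then show "N +>\<^bsub>M\<^esub> (r \<odot>\<^bsub>M\<^esub> x) = r \<odot>\<^bsub>quotient_module M N\<^esub> (N +>\<^bsub>M\<^esub> x)"
    by (simp add: quotient_module_def)
qed (auto simp: quotient_module_def a_rcos_sum intro!: a_rcosetsI a_subset)

lemma quotient_module_cases:
  assumes "X \<in> carrier (quotient_module M N)"
  obtains x where "x \<in> carrier M" and "X = N +>\<^bsub>M\<^esub> x"
  using assms by (auto simp: quotient_module_def A_RCOSETS_def')

lemma quotient_module_lift:
  assumes "module R A" and f: "f \<in> linear_maps R M A" and ker: "\<And>x. x \<in> N \<Longrightarrow> f x = \<zero>\<^bsub>A\<^esub>"
  shows "\<exists>\<theta> \<in> linear_maps R (quotient_module M N) A. \<forall>x \<in> carrier M. \<theta> (N +>\<^bsub>M\<^esub> x) = f x"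
proof -
  interpret A: module R A by fact
  note f = linear_mapsD[OF f] and q = linear_mapsD[OF quotient_map_linear]
  \<comment> \<open>\<open>f\<close> is constant on every coset because it kills \<open>N\<close>;
    \<open>the_elem\<close> picks out that one value, so no representative has to be chosen.\<close>
  define \<theta> where "\<theta> X = the_elem (f ` X)" for X
  have \<theta>: "\<theta> (N +>\<^bsub>M\<^esub> x) = f x" if x: "x \<in> carrier M" for x
  proof -
    have "f y = f x" if "y \<in> N +>\<^bsub>M\<^esub> x" for y
      using coset_memD[OF x that] x a_subset f ker by fastforce
    then have "f ` (N +>\<^bsub>M\<^esub> x) = {f x}"
      using a_rcos_self[OF x] by blast
    then show ?thesis
      by (simp add: \<theta>_def)
  qed
  have "\<theta> \<in> linear_maps R (quotient_module M N) A"
  proof (rule linear_mapsI)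
    fix X assume "X \<in> carrier (quotient_module M N)"
    then obtain x where x: "x \<in> carrier M" "X = N +>\<^bsub>M\<^esub> x"
      by (rule quotient_module_cases)
    then show "\<theta> X \<in> carrier A"
      using \<theta> f(1) by simp
    show "\<theta> (X \<oplus>\<^bsub>quotient_module M N\<^esub> Y) = \<theta> X \<oplus>\<^bsub>A\<^esub> \<theta> Y"
      if Y: "Y \<in> carrier (quotient_module M N)" for Y
    proof -
      obtain y where y: "y \<in> carrier M" "Y = N +>\<^bsub>M\<^esub> y"
        using Y by (rule quotient_module_cases)
      then show ?thesis
        using x q(2)[OF x(1) y(1)] f(2)[OF x(1) y(1)] \<theta> by (metis M.a_closed)
    qed
    show "\<theta> (r \<odot>\<^bsub>quotient_module M N\<^esub> X) = r \<odot>\<^bsub>A\<^esub> \<theta> X" if "r \<in> carrier R" for r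
      using x q(3)[OF that x(1)] f(3)[OF that x(1)] \<theta> that by (metis smult_closed)
  qed
  then show ?thesis
    using \<theta> by blast
qed

end


section \<open>The universal property of \<open>S(P, V)\<close>\<close>

text \<open>These are exactly the conditions under which a linear map on \<open>S_module\<close> can
  send the class of \<open>(\<mu>; as)\<close> to \<open>act A \<mu> as\<close>, see
  \<open>structure_map_iff_multilinear_action\<close>. Linearity is asked in one argument at a time,
  the others being frozen by a list update.\<close>

locale multilinear_action = module R A
  for R :: "('r, 'x) ring_scheme" (structure) and P :: "('r, 'p) operad_data"
    and A :: "('r, 'a, 'p) alg_data" +
  assumes act_op_linear: "set as \<subseteq> carrier A \<Longrightarrow>
      (\<lambda>\<mu>. act A \<mu> as) \<in> linear_maps R (ops P (length as)) A"
    and act_arg_linear: "\<lbrakk>i < length as; \<mu> \<in> carrier (ops P (length as)); set as \<subseteq> carrier A\<rbrakk> \<Longrightarrow>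
      (\<lambda>x. act A \<mu> (as[i := x])) \<in> linear_maps R A A"
    and act_sym: "\<lbrakk>\<sigma> permutes {..<length as}; \<mu> \<in> carrier (ops P (length as));
      set as \<subseteq> carrier A\<rbrakk> \<Longrightarrow>
      act A (sym P (length as) \<mu> \<sigma>) (permute_list \<sigma> as) = act A \<mu> as"

begin

lemma act_closed:
  "\<lbrakk>\<mu> \<in> carrier (ops P (length as)); set as \<subseteq> carrier A\<rbrakk> \<Longrightarrow> act A \<mu> as \<in> carrier A"
  using linear_maps_closed[OF act_op_linear] .

lemmas act_op_add = linear_maps_add[OF act_op_linear]
  and act_op_smult = linear_maps_smult[OF act_op_linear]

end

lemma in_S_symbols_iff [simp]:
  "(\<mu>, as) \<in> S_symbols P V \<longleftrightarrow> \<mu> \<in> carrier (ops P (length as)) \<and> set as \<subseteq> carrier V"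
  by (simp add: S_symbols_def)

lemma Ball_S_symbols:
  "(\<forall>(\<mu>, as) \<in> S_symbols P V. Q \<mu> as) \<longleftrightarrow>
    (\<forall>\<mu> as. \<mu> \<in> carrier (ops P (length as)) \<and> set as \<subseteq> carrier V \<longrightarrow> Q \<mu> as)"
  by (auto simp: S_symbols_def)

lemma set_list_update_subset: "set as \<subseteq> S \<Longrightarrow> x \<in> S \<Longrightarrow> set (as[i := x]) \<subseteq> S"
  using set_update_subset_insert[of as i x] by auto

context operad
begin

lemma sym_closed:
  "\<lbrakk>\<mu> \<in> carrier (ops P n); \<sigma> permutes {..<n}\<rbrakk> \<Longrightarrow> sym P n \<mu> \<sigma> \<in> carrier (ops P n)"
  using linear_maps_closed[OF sym_linear] by blast

lemma ops_closed:
  "\<lbrakk>\<mu> \<in> carrier (ops P n); \<mu>' \<in> carrier (ops P n)\<rbrakk> \<Longrightarrow> \<mu> \<oplus>\<^bsub>ops P n\<^esub> \<mu>' \<in> carrier (ops P n)"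
  "\<lbrakk>r \<in> carrier R; \<mu> \<in> carrier (ops P n)\<rbrakk> \<Longrightarrow> r \<odot>\<^bsub>ops P n\<^esub> \<mu> \<in> carrier (ops P n)"
proof -
  interpret module R "ops P n" by (rule ops_module)
  show "\<lbrakk>\<mu> \<in> carrier (ops P n); \<mu>' \<in> carrier (ops P n)\<rbrakk> \<Longrightarrow> \<mu> \<oplus>\<^bsub>ops P n\<^esub> \<mu>' \<in> carrier (ops P n)"
    "\<lbrakk>r \<in> carrier R; \<mu> \<in> carrier (ops P n)\<rbrakk> \<Longrightarrow> r \<odot>\<^bsub>ops P n\<^esub> \<mu> \<in> carrier (ops P n)"
    by auto
qed

lemma module_S_free: "module R (S_free R P V)"
  by (simp add: S_free_def module_free_module)

lemma basis_elt_S_free: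
  "\<lbrakk>\<mu> \<in> carrier (ops P (length as)); set as \<subseteq> carrier V\<rbrakk> \<Longrightarrow>
    basis_elt R (\<mu>, as) \<in> carrier (S_free R P V)"
  by (simp add: S_free_def basis_elt_closed)

lemma S_relations_subset:
  assumes "module R V"
  shows "S_relations R P V \<subseteq> carrier (S_free R P V)"
proof -
  interpret V: module R V by fact
  interpret F: module R "S_free R P V" by (rule module_S_free)
  have "x \<in> carrier (S_free R P V)" if "x \<in> S_relations R P V" for x
    using that
    by cases (auto intro!: F.M.minus_closed F.M.a_closed F.smult_closed basis_elt_S_free ops_closed
        sym_closed dest!: set_update_subset_insert[THEN subsetD])
  then show ?thesis
    by blast
qed

text \<open>Every generator is a difference, so \<open>f\<close> only has to agree on its two sides.
  The kinds of generators match the assumptions of \<open>multilinear_action\<close>: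
  \<open>op_add\<close> and \<open>op_smult\<close> belong to linearity in the operation,
  \<open>arg_add\<close> and \<open>arg_smult\<close> to linearity in an argument,
  \<open>symmetry\<close> to \<open>act_sym\<close>.\<close>

lemma S_relations_kernel:
  assumes "multilinear_action R P V" and f: "f \<in> linear_maps R (S_free R P V) V"
    and basis: "\<And>\<mu> as. \<lbrakk>\<mu> \<in> carrier (ops P (length as)); set as \<subseteq> carrier V\<rbrakk> \<Longrightarrow>
      f (basis_elt R (\<mu>, as)) = act V \<mu> as"
    and "x \<in> S_relations R P V"
  shows "f x = \<zero>\<^bsub>V\<^esub>"
proof -
  interpret V: multilinear_action R P V by fact
  interpret F: module R "S_free R P V" by (rule module_S_free)
  have minus: "f (y \<ominus>\<^bsub>S_free R P V\<^esub> z) = \<zero>\<^bsub>V\<^esub>"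
    if "y \<in> carrier (S_free R P V)" "z \<in> carrier (S_free R P V)" "f y = f z" for y z
    using that linear_maps_closed[OF f]
    by (simp add: a_minus_def linear_maps_add[OF f]
        linear_maps_minus[OF F.module_axioms V.module_axioms f] V.M.r_neg)
  note closed = ops_closed sym_closed set_list_update_subset basis_elt_S_free
    F.M.a_closed F.smult_closed
  show ?thesis
    using assms(4)
  proof cases
    case (op_add \<mu> vs \<mu>')
    then show ?thesis
      by (auto intro!: minus closed
          simp: linear_maps_add[OF f] basis basis_elt_S_free ops_closed V.act_op_add)
  next
    case (op_smult r \<mu> vs)
    then show ?thesis
      by (auto intro!: minus closed
          simp: linear_maps_smult[OF f] basis basis_elt_S_free ops_closed V.act_op_smult)
  next
    case (arg_add \<mu> vs i v v')
    then show ?thesis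
      using linear_maps_add[OF V.act_arg_linear, of i vs \<mu> v v']
      by (auto intro!: minus closed
          simp: linear_maps_add[OF f] basis basis_elt_S_free set_list_update_subset
          dest!: set_update_subset_insert[THEN subsetD])
  next
    case (arg_smult r \<mu> vs i v)
    then show ?thesis
      using linear_maps_smult[OF V.act_arg_linear, of i vs \<mu> r v]
      by (auto intro!: minus closed
          simp: linear_maps_smult[OF f] basis basis_elt_S_free set_list_update_subset
          dest!: set_update_subset_insert[THEN subsetD])
  next
    case (symmetry \<mu> vs \<sigma>)
    then show ?thesis
      by (auto intro!: minus closed simp: basis sym_closed V.act_sym)
  qed
qed

text \<open>Both directions come from the presentation of \<open>S_module\<close>. A structure map
  composed with the quotient map is a linear map on the free module that identifies the two sides of
  each relation. Conversely, the linear extension of \<open>act\<close> from the basis kills the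
  relations, hence the submodule they generate, and descends to the quotient.\<close>

lemma structure_map_iff_multilinear_action:
  fixes A :: "('r, 'a, 'p) alg_data"
  assumes "module R A"
  shows "(\<exists>\<theta> \<in> linear_maps R (S_module R P A) A.
      \<forall>(\<mu>, as) \<in> S_symbols P A. \<theta> (S_class R P A \<mu> as) = act A \<mu> as) \<longleftrightarrow>
    multilinear_action R P A"
proof
  interpret A: module R A by fact
  interpret F: module R "S_free R P A" by (rule module_S_free)
  interpret Q: module_quotient R "S_free R P A" "S_submodule R P A"
    unfolding S_submodule_def
    by (intro module_quotient.intro module_quotient_axioms.intro F.module_axioms
        F.submodule_generated_submodule S_relations_subset assms)
  {
    assume "\<exists>\<theta> \<in> linear_maps R (S_module R P A) A.
      \<forall>(\<mu>, as) \<in> S_symbols P A. \<theta> (S_class R P A \<mu> as) = act A \<mu> as"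
    then obtain \<theta> where \<theta>: "\<theta> \<in> linear_maps R (S_module R P A) A"
      and act: "\<And>\<mu> as. \<lbrakk>\<mu> \<in> carrier (ops P (length as)); set as \<subseteq> carrier A\<rbrakk> \<Longrightarrow>
        \<theta> (S_class R P A \<mu> as) = act A \<mu> as"
      by (auto simp: Ball_S_symbols)
    define f where "f x = \<theta> (S_submodule R P A +>\<^bsub>S_free R P A\<^esub> x)" for x
    have f: "f \<in> linear_maps R (S_free R P A) A"
      unfolding f_def using linear_maps_comp[OF Q.quotient_map_linear \<theta>[unfolded S_module_def]] .
    have basis: "f (basis_elt R (\<mu>, as)) = act A \<mu> as"
      if "\<mu> \<in> carrier (ops P (length as))" "set as \<subseteq> carrier A" for \<mu> as
      using act[OF that] by (simp add: f_def S_class_def)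
    have eq: "f x = f y" if "x \<ominus>\<^bsub>S_free R P A\<^esub> y \<in> S_relations R P A"
      "x \<in> carrier (S_free R P A)" "y \<in> carrier (S_free R P A)" for x y
      unfolding f_def
      using that F.generators_subset[OF S_relations_subset[OF assms]]
      by (subst Q.coset_eqI[of x y]) (auto simp: S_submodule_def)
    note closed = ops_closed sym_closed set_list_update_subset basis_elt_S_free
      F.M.a_closed F.smult_closed
    note simps = linear_maps_add[OF f] linear_maps_smult[OF f] basis basis_elt_S_free
      set_list_update_subset ops_closed
    show "multilinear_action R P A"
    proof
      fix as :: "'a list" assume as: "set as \<subseteq> carrier A"
      show "(\<lambda>\<mu>. act A \<mu> as) \<in> linear_maps R (ops P (length as)) A"
      proof (rule linear_mapsI)
        fix \<mu> assume \<mu>: "\<mu> \<in> carrier (ops P (length as))"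
        show "act A \<mu> as \<in> carrier A"
          using linear_maps_closed[OF f basis_elt_S_free[OF \<mu> as]] basis[OF \<mu> as] by simp
        show "act A (\<mu> \<oplus>\<^bsub>ops P (length as)\<^esub> \<mu>') as = act A \<mu> as \<oplus>\<^bsub>A\<^esub> act A \<mu>' as"
          if "\<mu>' \<in> carrier (ops P (length as))" for \<mu>'
          using eq[OF S_relations.op_add[of \<mu> as P A \<mu>' R]] \<mu> as that by (simp add: simps closed)
        show "act A (r \<odot>\<^bsub>ops P (length as)\<^esub> \<mu>) as = r \<odot>\<^bsub>A\<^esub> act A \<mu> as"
          if "r \<in> carrier R" for r
          using eq[OF S_relations.op_smult[of r R \<mu> as P A]] \<mu> as that by (simp add: simps closed)
      qed
    next
      fix \<mu> and as :: "'a list"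
      assume \<mu>: "\<mu> \<in> carrier (ops P (length as))" and as: "set as \<subseteq> carrier A"
      show "act A (sym P (length as) \<mu> \<sigma>) (permute_list \<sigma> as) = act A \<mu> as"
        if "\<sigma> permutes {..<length as}" for \<sigma>
        using eq[OF S_relations.symmetry[of \<mu> as P A \<sigma> R]] \<mu> as that by (simp add: simps closed)
      show "(\<lambda>x. act A \<mu> (as[i := x])) \<in> linear_maps R A A" if "i < length as" for i
      proof (rule linear_mapsI)
        fix x assume x: "x \<in> carrier A"
        show "act A \<mu> (as[i := x]) \<in> carrier A"
          using linear_maps_closed[OF f basis_elt_S_free[of \<mu> "as[i := x]"]] \<mu> as x
          by (simp add: simps)
        show "act A \<mu> (as[i := x \<oplus>\<^bsub>A\<^esub> y]) = act A \<mu> (as[i := x]) \<oplus>\<^bsub>A\<^esub> act A \<mu> (as[i := y])"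
          if y: "y \<in> carrier A" for y
          using eq[OF S_relations.arg_add[of \<mu> as P A i x y R]] \<mu> as x y \<open>i < length as\<close>
          by (simp add: simps closed)
        show "act A \<mu> (as[i := r \<odot>\<^bsub>A\<^esub> x]) = r \<odot>\<^bsub>A\<^esub> act A \<mu> (as[i := x])" if r: "r \<in> carrier R" for r
          using eq[OF S_relations.arg_smult[of r R \<mu> as P A i x]] \<mu> as x r \<open>i < length as\<close>
          by (simp add: simps closed)
      qed
    qed
  next
    assume "multilinear_action R P A"
    then interpret M: multilinear_action R P A .
    define \<phi> where "\<phi> = (\<lambda>(\<mu>, as). act A \<mu> as)"
    have \<phi>: "\<phi> \<in> S_symbols P A \<rightarrow> carrier A"
      by (auto simp: \<phi>_def M.act_closed)
    have lin: "linear_ext R A \<phi> \<in> linear_maps R (S_free R P A) A"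
      unfolding S_free_def by (rule A.linear_ext_linear[OF \<phi>])
    have basis: "linear_ext R A \<phi> (basis_elt R (\<mu>, as)) = act A \<mu> as"
      if "\<mu> \<in> carrier (ops P (length as))" "set as \<subseteq> carrier A" for \<mu> as
      using A.linear_ext_basis_elt[OF \<phi>, of "(\<mu>, as)"] that by (simp add: \<phi>_def)
    have "S_relations R P A \<subseteq> {x \<in> carrier (S_free R P A). linear_ext R A \<phi> x = \<zero>\<^bsub>A\<^esub>}"
      using S_relations_kernel[OF M.multilinear_action_axioms lin basis] S_relations_subset[OF assms]
      by blast
    then have "S_submodule R P A \<subseteq> {x \<in> carrier (S_free R P A). linear_ext R A \<phi> x = \<zero>\<^bsub>A\<^esub>}"
      unfolding S_submodule_def
      by (intro F.generated_submodule_least F.submodule_kernel[OF assms lin])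
    then obtain \<theta> where "\<theta> \<in> linear_maps R (S_module R P A) A"
      and "\<And>x. x \<in> carrier (S_free R P A) \<Longrightarrow>
        \<theta> (S_submodule R P A +>\<^bsub>S_free R P A\<^esub> x) = linear_ext R A \<phi> x"
      using Q.quotient_module_lift[OF assms lin] unfolding S_module_def by blast
    then show "\<exists>\<theta> \<in> linear_maps R (S_module R P A) A.
      \<forall>(\<mu>, as) \<in> S_symbols P A. \<theta> (S_class R P A \<mu> as) = act A \<mu> as"
      by (auto intro!: bexI[of _ \<theta>] simp: Ball_S_symbols S_class_def basis basis_elt_S_free)
  }
qed

end

text \<open>The working description of algebras: from here on every verification goes through
  \<open>multilinear_action\<close>, and the quotient \<open>S_module\<close> does not occur
  again.\<close>

lemma operad_algebra_iff:
  assumes "operad R P"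
  shows "operad_algebra R P A \<longleftrightarrow> multilinear_action R P A \<and>
    (\<forall>a \<in> carrier A. act A (unit P) [a] = a) \<and>
    (\<forall>k \<mu> \<nu>s ass. \<mu> \<in> carrier (ops P k) \<longrightarrow> length \<nu>s = k \<longrightarrow> length ass = k \<longrightarrow>
      (\<forall>i < k. \<nu>s ! i \<in> carrier (ops P (length (ass ! i))) \<and> set (ass ! i) \<subseteq> carrier A) \<longrightarrow>
      act A \<mu> (map2 (act A) \<nu>s ass) =
        act A (full_comp P \<mu> (zip (map length ass) \<nu>s)) (concat ass))"
  using operad.structure_map_iff_multilinear_action[OF assms]
  by (auto simp: operad_algebra_def operad_algebra_axioms_def multilinear_action_def)


section \<open>Algebras and their morphisms\<close>

context operad
begin

lemma pcomp_closed:
  assumes "i < m" and "\<mu> \<in> carrier (ops P m)" and "\<nu> \<in> carrier (ops P n)"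
  shows "pcomp P m n i \<mu> \<nu> \<in> carrier (ops P (m + n - 1))"
  using linear_maps_closed[OF pcomp_linear_left[OF assms(1,3)] assms(2)] .

text \<open>The fold inserts from the right, so an insertion at input \<open>j\<close> never meets
  inputs renumbered by the earlier ones. Each insertion of arity \<open>n\<close> trades one input
  for \<open>n\<close>, which explains the resulting arity. The offset \<open>j\<close> is general
  because the induction removes the head of \<open>xs\<close> and shifts the numbering by one; the
  bound \<open>j + length xs \<le> m\<close> keeps the natural subtraction exact.\<close>

lemma foldr_pcomp_closed:
  assumes "\<forall>(n, \<nu>) \<in> set xs. \<nu> \<in> carrier (ops P n)" and "\<mu> \<in> carrier (ops P m)"
    and "j + length xs \<le> m"
  shows "\<exists>\<kappa> \<in> carrier (ops P (m + sum_list (map fst xs) - length xs)).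
    foldr (\<lambda>(i, n, \<nu>) (m, \<kappa>). (m + n - 1, pcomp P m n i \<kappa> \<nu>)) (zip [j..<j + length xs] xs) (m, \<mu>) =
      (m + sum_list (map fst xs) - length xs, \<kappa>)"
  using assms
proof (induction xs arbitrary: j)
  case Nil
  then show ?case by simp
next
  case (Cons x xs)
  obtain n \<nu> where x: "x = (n, \<nu>)" and \<nu>: "\<nu> \<in> carrier (ops P n)"
    using Cons.prems(1) by (cases x) auto
  let ?m = "m + sum_list (map fst xs) - length xs"
  obtain \<kappa> where \<kappa>: "\<kappa> \<in> carrier (ops P ?m)"
    "foldr (\<lambda>(i, n, \<nu>) (m, \<kappa>). (m + n - 1, pcomp P m n i \<kappa> \<nu>))
      (zip [Suc j..<Suc j + length xs] xs) (m, \<mu>) = (?m, \<kappa>)"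
    using Cons.IH[of "Suc j"] Cons.prems by auto
  \<comment> \<open>At least \<open>j + 1\<close> inputs survive the insertions further right,
    because \<open>j + 1 + length xs \<le> m\<close>.\<close>
  have m: "?m + n - 1 = m + sum_list (map fst (x # xs)) - length (x # xs)" "j < ?m"
    using Cons.prems(3) x by auto
  have "zip [j..<j + length (x # xs)] (x # xs) = (j, n, \<nu>) # zip [Suc j..<Suc j + length xs] xs"
    using x by (simp add: upt_conv_Cons del: upt_Suc)
  moreover have "pcomp P ?m n j \<kappa> \<nu> \<in> carrier (ops P (?m + n - 1))"
    using pcomp_closed m(2) \<kappa>(1) \<nu> by blast
  ultimately show ?case
    using \<kappa>(2) m(1) by simp
qed

lemma full_comp_closed:
  assumes "\<mu> \<in> carrier (ops P (length ns))" and "length \<nu>s = length ns"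
    and "\<And>i. i < length ns \<Longrightarrow> \<nu>s ! i \<in> carrier (ops P (ns ! i))"
  shows "full_comp P \<mu> (zip ns \<nu>s) \<in> carrier (ops P (sum_list ns))"
proof -
  have "\<forall>(n, \<nu>) \<in> set (zip ns \<nu>s). \<nu> \<in> carrier (ops P n)"
    using assms(2,3) by (auto simp: set_zip)
  from foldr_pcomp_closed[OF this, of \<mu> "length ns" 0] assms(1,2) show ?thesis
    by (auto simp: full_comp_def)
qed

end

text \<open>Adds the operad axioms, which are not among the assumptions of
  \<open>operad_algebra\<close>.\<close>

locale op_algebra = operad R P + operad_algebra R P A
  for R :: "('r, 'x) ring_scheme" (structure) and P :: "('r, 'p) operad_data"
    and A :: "('r, 'a, 'p) alg_data"
begin

sublocale multilinear_action R P A
  using operad_algebra_iff[OF operad_axioms] operad_algebra_axioms by blast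

lemma act_concat:
  assumes "\<mu> \<in> carrier (ops P (length ass))" and "length \<nu>s = length ass"
    and "\<And>i. i < length ass \<Longrightarrow> \<nu>s ! i \<in> carrier (ops P (length (ass ! i)))"
    and "\<And>as. as \<in> set ass \<Longrightarrow> set as \<subseteq> carrier A"
  shows "act A \<mu> (map2 (act A) \<nu>s ass) =
    act A (full_comp P \<mu> (zip (map length ass) \<nu>s)) (concat ass)"
  using assms by (intro act_comp[of _ "length ass"]) auto

end

lemma alg_homsI:
  assumes "f \<in> linear_maps R A B"
    and "\<And>\<mu> as. \<lbrakk>\<mu> \<in> carrier (ops P (length as)); set as \<subseteq> carrier A\<rbrakk> \<Longrightarrow>
      f (act A \<mu> as) = act B \<mu> (map f as)"
  shows "f \<in> alg_homs R P A B"
  using assms by (auto simp: alg_homs_def Ball_S_symbols)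

lemma alg_homsD:
  assumes "f \<in> alg_homs R P A B"
  shows alg_homs_linear: "f \<in> linear_maps R A B"
    and alg_homs_closed: "x \<in> carrier A \<Longrightarrow> f x \<in> carrier B"
    and alg_homs_act: "\<lbrakk>\<mu> \<in> carrier (ops P (length as)); set as \<subseteq> carrier A\<rbrakk> \<Longrightarrow>
      f (act A \<mu> as) = act B \<mu> (map f as)"
  using assms by (auto simp: alg_homs_def Ball_S_symbols linear_maps_closed)

lemma alg_homs_comp:
  assumes f: "f \<in> alg_homs R P A B" and g: "g \<in> alg_homs R P B D"
  shows "(\<lambda>x. g (f x)) \<in> alg_homs R P A D"
proof (rule alg_homsI)
  show "(\<lambda>x. g (f x)) \<in> linear_maps R A D"
    using linear_maps_comp[OF alg_homs_linear[OF f] alg_homs_linear[OF g]] .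
  fix \<mu> as assume "\<mu> \<in> carrier (ops P (length as))" "set as \<subseteq> carrier A"
  moreover from this have "set (map f as) \<subseteq> carrier B"
    using alg_homs_closed[OF f] by auto
  ultimately show "g (f (act A \<mu> as)) = act D \<mu> (map (\<lambda>x. g (f x)) as)"
    using alg_homs_act[OF f] alg_homs_act[OF g, of \<mu> "map f as"] by (simp add: comp_def)
qed

lemma alg_homs_id: "(\<lambda>x. x) \<in> alg_homs R P A A"
  by (auto intro!: alg_homsI linear_mapsI)

lemma (in op_algebra) alg_homs_cong:
  assumes f: "f \<in> alg_homs R P A B" and g: "\<And>x. x \<in> carrier A \<Longrightarrow> g x = f x"
  shows "g \<in> alg_homs R P A B"
proof (rule alg_homsI)
  show "g \<in> linear_maps R A B"
    by (rule linear_maps_cong[OF module_axioms alg_homs_linear[OF f] g])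
  show "g (act A \<mu> as) = act B \<mu> (map g as)"
    if "\<mu> \<in> carrier (ops P (length as))" "set as \<subseteq> carrier A" for \<mu> as
  proof -
    have "map g as = map f as"
      using that g by auto
    then show ?thesis
      using g[OF act_closed[OF that]] alg_homs_act[OF f that] by metis
  qed
qed

text \<open>The mediating arrow of a limit is found element by element; this gives its compatibility
  with all operations for free, from that of its composites with the projections.\<close>

lemma alg_homs_by_components:
  assumes "op_algebra R P X" and "op_algebra R P Y"
    and closed: "\<And>x. x \<in> carrier X \<Longrightarrow> h x \<in> carrier Y"
    and \<pi>: "\<And>i. i \<in> I \<Longrightarrow> \<pi> i \<in> alg_homs R P Y (A i)"
    and inj: "\<And>x y. \<lbrakk>x \<in> carrier Y; y \<in> carrier Y; \<And>i. i \<in> I \<Longrightarrow> \<pi> i x = \<pi> i y\<rbrakk> \<Longrightarrow> x = y"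
    and h: "\<And>i. i \<in> I \<Longrightarrow> (\<lambda>x. \<pi> i (h x)) \<in> alg_homs R P X (A i)"
  shows "h \<in> alg_homs R P X Y"
proof -
  interpret X: op_algebra R P X by fact
  interpret Y: op_algebra R P Y by fact
  show ?thesis
  proof (rule alg_homsI[OF linear_maps_by_components[where \<pi> = \<pi> and I = I]])
    show "\<pi> i \<in> linear_maps R Y (A i)" "(\<lambda>x. \<pi> i (h x)) \<in> linear_maps R X (A i)" if "i \<in> I" for i
      using alg_homs_linear[OF \<pi>[OF that]] alg_homs_linear[OF h[OF that]] .
    show "h (act X \<mu> as) = act Y \<mu> (map h as)"
      if as: "\<mu> \<in> carrier (ops P (length as))" "set as \<subseteq> carrier X" for \<mu> as
    proof (rule inj)
      have has: "set (map h as) \<subseteq> carrier Y"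
        using as closed by auto
      show "h (act X \<mu> as) \<in> carrier Y" "act Y \<mu> (map h as) \<in> carrier Y"
        using as has X.act_closed Y.act_closed[of \<mu> "map h as"] closed by auto
      show "\<pi> i (h (act X \<mu> as)) = \<pi> i (act Y \<mu> (map h as))" if "i \<in> I" for i
        using alg_homs_act[OF h[OF that] as] alg_homs_act[OF \<pi>[OF that], of \<mu> "map h as"] as has
        by (simp add: comp_def)
    qed
  qed (use closed inj X.module_axioms Y.module_axioms in blast)+
qed

text \<open>All axioms except closure are equations or linearity statements, so they can be tested
  after the morphisms \<open>\<pi> i\<close>. The projections of a finite product satisfy the
  hypotheses; the higher coordinates of \<open>semidirect\<close> in general do not, being
  derivations rather than morphisms.\<close>

lemma algebra_by_components:
  assumes "operad R P" and "module R N"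
    and A: "\<And>i. i \<in> I \<Longrightarrow> op_algebra R P (A i)"
    and \<pi>: "\<And>i. i \<in> I \<Longrightarrow> \<pi> i \<in> alg_homs R P N (A i)"
    and inj: "\<And>x y. \<lbrakk>x \<in> carrier N; y \<in> carrier N; \<And>i. i \<in> I \<Longrightarrow> \<pi> i x = \<pi> i y\<rbrakk> \<Longrightarrow> x = y"
    and closed: "\<And>\<mu> as. \<lbrakk>\<mu> \<in> carrier (ops P (length as)); set as \<subseteq> carrier N\<rbrakk> \<Longrightarrow>
      act N \<mu> as \<in> carrier N"
  shows "op_algebra R P N"
proof -
  interpret operad R P by fact
  interpret N: module R N by fact
  note \<pi>' = linear_mapsD[OF alg_homs_linear[OF \<pi>]] and \<pi>_act = alg_homs_act[OF \<pi>]
  have map_\<pi>: "set (map (\<pi> i) as) \<subseteq> carrier (A i)" if "i \<in> I" "set as \<subseteq> carrier N" for i as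
    using that \<pi>'(1) by auto
  have "multilinear_action R P N"
  proof
    fix as :: "'d list" assume as: "set as \<subseteq> carrier N"
    show "(\<lambda>\<mu>. act N \<mu> as) \<in> linear_maps R (ops P (length as)) N"
    proof (rule linear_maps_by_components[where \<pi> = \<pi> and I = I and M = A])
      fix i assume i: "i \<in> I"
      interpret A: op_algebra R P "A i" by (rule A[OF i])
      show "(\<lambda>\<mu>. \<pi> i (act N \<mu> as)) \<in> linear_maps R (ops P (length as)) (A i)"
        using linear_maps_cong[OF ops_module A.act_op_linear[OF map_\<pi>[OF i as]]] \<pi>_act[OF i _ as] by simp
    qed (use as closed inj alg_homs_linear[OF \<pi>] ops_module N.module_axioms in blast)+
    fix \<mu> assume \<mu>: "\<mu> \<in> carrier (ops P (length as))"
    show "act N (sym P (length as) \<mu> \<sigma>) (permute_list \<sigma> as) = act N \<mu> as"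
      if \<sigma>: "\<sigma> permutes {..<length as}" for \<sigma>
    proof (rule inj)
      fix i assume i: "i \<in> I"
      interpret A: op_algebra R P "A i" by (rule A[OF i])
      show "\<pi> i (act N (sym P (length as) \<mu> \<sigma>) (permute_list \<sigma> as)) = \<pi> i (act N \<mu> as)"
        using A.act_sym[of \<sigma> "map (\<pi> i) as" \<mu>] \<mu> \<sigma> as map_\<pi>[OF i as] i
        by (simp add: \<pi>_act sym_closed permute_list_map)
    qed (use \<mu> \<sigma> as in \<open>auto intro!: closed sym_closed\<close>)
    show "(\<lambda>x. act N \<mu> (as[k := x])) \<in> linear_maps R N N" if k: "k < length as" for k
    proof (rule linear_maps_by_components[where \<pi> = \<pi> and I = I and M = A])
      note upd = set_list_update_subset[OF as]
      show "act N \<mu> (as[k := x]) \<in> carrier N" if "x \<in> carrier N" for x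
        using \<mu> upd[OF that] by (intro closed) auto
      fix i assume i: "i \<in> I"
      interpret A: op_algebra R P "A i" by (rule A[OF i])
      have "(\<lambda>x. act (A i) \<mu> ((map (\<pi> i) as)[k := \<pi> i x])) \<in> linear_maps R N (A i)"
        using k \<mu> map_\<pi>[OF i as]
        by (intro linear_maps_comp[OF alg_homs_linear[OF \<pi>[OF i]] A.act_arg_linear]) auto
      then show "(\<lambda>x. \<pi> i (act N \<mu> (as[k := x]))) \<in> linear_maps R N (A i)"
        by (rule linear_maps_cong[OF N.module_axioms]) (use i \<mu> upd in \<open>simp_all add: \<pi>_act map_update\<close>)
    qed (use inj alg_homs_linear[OF \<pi>] N.module_axioms in blast)+
  qed
  moreover have "act N (unit P) [x] = x" if x: "x \<in> carrier N" for x
  proof (rule inj)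
    fix i assume i: "i \<in> I"
    interpret A: op_algebra R P "A i" by (rule A[OF i])
    show "\<pi> i (act N (unit P) [x]) = \<pi> i x"
      using x i unit_closed by (simp add: \<pi>_act A.act_unit \<pi>'(1))
  qed (use x unit_closed in \<open>auto intro!: closed\<close>)
  moreover have "act N \<mu> (map2 (act N) \<nu>s ass) =
      act N (full_comp P \<mu> (zip (map length ass) \<nu>s)) (concat ass)"
    if \<mu>: "\<mu> \<in> carrier (ops P k)" and len: "length \<nu>s = k" "length ass = k"
      and \<nu>s: "\<forall>i < k. \<nu>s ! i \<in> carrier (ops P (length (ass ! i))) \<and> set (ass ! i) \<subseteq> carrier N"
    for k \<mu> \<nu>s ass
  proof (rule inj)
    have full: "full_comp P \<mu> (zip (map length ass) \<nu>s) \<in> carrier (ops P (length (concat ass)))"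
      using \<mu> len \<nu>s full_comp_closed[of \<mu> "map length ass" \<nu>s] by (simp add: length_concat)
    have "set as \<subseteq> carrier N" if "as \<in> set ass" for as
      using that \<nu>s len by (metis in_set_conv_nth)
    then have cat: "set (concat ass) \<subseteq> carrier N"
      by auto
    have inner: "set (map2 (act N) \<nu>s ass) \<subseteq> carrier N"
      using \<nu>s len by (auto simp: set_zip intro!: closed)
    show "act N \<mu> (map2 (act N) \<nu>s ass) \<in> carrier N"
      "act N (full_comp P \<mu> (zip (map length ass) \<nu>s)) (concat ass) \<in> carrier N"
      using full cat inner \<mu> len by (auto intro!: closed)
    fix i assume i: "i \<in> I"
    interpret A: op_algebra R P "A i" by (rule A[OF i])
    have "\<pi> i (act N \<mu> (map2 (act N) \<nu>s ass)) = act (A i) \<mu> (map (\<pi> i) (map2 (act N) \<nu>s ass))"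
      using \<mu> len inner i by (intro \<pi>_act) auto
    also have "map (\<pi> i) (map2 (act N) \<nu>s ass) = map2 (act (A i)) \<nu>s (map (map (\<pi> i)) ass)"
      using len \<nu>s i by (intro nth_equalityI) (auto simp: \<pi>_act)
    also have "act (A i) \<mu> \<dots> = act (A i) (full_comp P \<mu> (zip (map length (map (map (\<pi> i)) ass)) \<nu>s))
        (concat (map (map (\<pi> i)) ass))"
      using \<mu> len \<nu>s i \<pi>'(1)[OF i] by (intro A.act_comp[of _ k]) (auto simp: subset_iff)
    also have "map length (map (map (\<pi> i)) ass) = map length ass"
      by simp
    also have "concat (map (map (\<pi> i)) ass) = map (\<pi> i) (concat ass)"
      by (simp add: map_concat)
    finally show "\<pi> i (act N \<mu> (map2 (act N) \<nu>s ass)) =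
        \<pi> i (act N (full_comp P \<mu> (zip (map length ass) \<nu>s)) (concat ass))"
      using full cat i by (simp add: \<pi>_act)
  qed
  ultimately show ?thesis
    unfolding op_algebra_def operad_algebra_iff[OF assms(1)] using assms(1) by blast
qed


section \<open>Semi-direct products\<close>

text \<open>The direction is a function of positions instead of a list, so that sums, negatives,
  zero and images of directions can be written pointwise; only its values below
  \<open>length as\<close> enter the sum.\<close>

definition leibniz :: "('r, 'a, 'p) alg_data \<Rightarrow> 'p \<Rightarrow> 'a list \<Rightarrow> (nat \<Rightarrow> 'a) \<Rightarrow> 'a"
  where "leibniz A \<mu> as b = (\<Oplus>\<^bsub>A\<^esub>i \<in> {..<length as}. act A \<mu> (as[i := b i]))"

text \<open>Coordinate 0 is the base point and coordinate \<open>j \<ge> 1\<close> the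
  \<open>j\<close>-th tangent component. It replaces the pattern matching of the structure maps, so
  that they can be assembled from linear pieces.\<close>

definition coord :: "nat \<Rightarrow> 'a universe \<Rightarrow> 'a universe"
  where "coord j x = untup x ! j"

lemma coord_Tup [simp]: "coord j (Tup xs) = xs ! j"
  by (simp add: coord_def)

lemma in_semidirect_iff:
  "x \<in> carrier (semidirect n A) \<longleftrightarrow> (\<exists>xs. x = Tup xs \<and> length xs = n + 1 \<and> set xs \<subseteq> carrier A)"
  by (auto simp: semidirect_def)

lemma coord_closed: "\<lbrakk>x \<in> carrier (semidirect n A); j \<le> n\<rbrakk> \<Longrightarrow> coord j x \<in> carrier A"
  by (auto simp: in_semidirect_iff subset_iff)

lemma semidirect_eqI:
  assumes "x \<in> carrier (semidirect n A)" and "y \<in> carrier (semidirect n A)"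
    and "\<And>j. j \<le> n \<Longrightarrow> coord j x = coord j y"
  shows "x = y"
  using assms by (auto simp: in_semidirect_iff intro!: nth_equalityI)

lemma coord_zero: "j \<le> n \<Longrightarrow> coord j \<zero>\<^bsub>semidirect n A\<^esub> = \<zero>\<^bsub>A\<^esub>"
  by (simp add: semidirect_def nth_Cons')

lemma coord_add:
  "\<lbrakk>x \<in> carrier (semidirect n A); y \<in> carrier (semidirect n A); j \<le> n\<rbrakk> \<Longrightarrow>
    coord j (x \<oplus>\<^bsub>semidirect n A\<^esub> y) = coord j x \<oplus>\<^bsub>A\<^esub> coord j y"
  by (auto simp: in_semidirect_iff) (simp add: semidirect_def)

lemma coord_smult:
  "\<lbrakk>x \<in> carrier (semidirect n A); j \<le> n\<rbrakk> \<Longrightarrow>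
    coord j (r \<odot>\<^bsub>semidirect n A\<^esub> x) = r \<odot>\<^bsub>A\<^esub> coord j x"
  by (auto simp: in_semidirect_iff) (simp add: semidirect_def)

lemma act_semidirect:
  "act (semidirect n A) \<mu> xs = Tup (act A \<mu> (map (coord 0) xs) #
    map (\<lambda>j. leibniz A \<mu> (map (coord 0) xs) (\<lambda>i. coord j (xs ! i))) [1..<n + 1])"
  by (simp add: semidirect_def Let_def leibniz_def coord_def[abs_def])

lemma coord_act_0: "coord 0 (act (semidirect n A) \<mu> xs) = act A \<mu> (map (coord 0) xs)"
  by (simp add: act_semidirect)

lemma coord_act:
  assumes "1 \<le> j" and "j \<le> n"
  shows "coord j (act (semidirect n A) \<mu> xs) =
    leibniz A \<mu> (map (coord 0) xs) (\<lambda>i. coord j (xs ! i))"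
  using assms by (cases j) (auto simp: act_semidirect simp del: upt_Suc)

lemma linear_maps_sum:
  assumes "module R M" and "module R N" and "finite I"
    and "\<And>i. i \<in> I \<Longrightarrow> f i \<in> linear_maps R M N"
  shows "(\<lambda>x. \<Oplus>\<^bsub>N\<^esub>i \<in> I. f i x) \<in> linear_maps R M N"
proof -
  interpret M: module R M by fact
  interpret N: module R N by fact
  note f = linear_mapsD[OF assms(4)]
  show ?thesis
  proof (rule linear_mapsI)
    fix x assume x: "x \<in> carrier M"
    show "(\<Oplus>\<^bsub>N\<^esub>i \<in> I. f i x) \<in> carrier N"
      using x f(1) by (intro N.M.finsum_closed) auto
    show "(\<Oplus>\<^bsub>N\<^esub>i \<in> I. f i (x \<oplus>\<^bsub>M\<^esub> y)) = (\<Oplus>\<^bsub>N\<^esub>i \<in> I. f i x) \<oplus>\<^bsub>N\<^esub> (\<Oplus>\<^bsub>N\<^esub>i \<in> I. f i y)"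
      if y: "y \<in> carrier M" for y
    proof -
      have "(\<Oplus>\<^bsub>N\<^esub>i \<in> I. f i (x \<oplus>\<^bsub>M\<^esub> y)) = (\<Oplus>\<^bsub>N\<^esub>i \<in> I. f i x \<oplus>\<^bsub>N\<^esub> f i y)"
        using x y f by (intro N.M.finsum_cong') auto
      also have "\<dots> = (\<Oplus>\<^bsub>N\<^esub>i \<in> I. f i x) \<oplus>\<^bsub>N\<^esub> (\<Oplus>\<^bsub>N\<^esub>i \<in> I. f i y)"
        using x y f(1) by (intro N.M.finsum_addf) auto
      finally show ?thesis .
    qed
    show "(\<Oplus>\<^bsub>N\<^esub>i \<in> I. f i (r \<odot>\<^bsub>M\<^esub> x)) = r \<odot>\<^bsub>N\<^esub> (\<Oplus>\<^bsub>N\<^esub>i \<in> I. f i x)" if r: "r \<in> carrier R" for r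
    proof -
      have "(\<Oplus>\<^bsub>N\<^esub>i \<in> I. f i (r \<odot>\<^bsub>M\<^esub> x)) = (\<Oplus>\<^bsub>N\<^esub>i \<in> I. r \<odot>\<^bsub>N\<^esub> f i x)"
        using x r f by (intro N.M.finsum_cong') auto
      also have "\<dots> = r \<odot>\<^bsub>N\<^esub> (\<Oplus>\<^bsub>N\<^esub>i \<in> I. f i x)"
        using x r f(1) assms(3) by (intro N.finsum_smult_ldistr[symmetric]) auto
      finally show ?thesis .
    qed
  qed
qed

lemma map_length_update: "length y = length (xs ! i) \<Longrightarrow> map length (xs[i := y]) = map length xs"
  by (cases "i < length xs") (auto simp: nth_list_update intro!: nth_equalityI)

section \<open>Splitting sums along concatenated lists\<close>

context abelian_monoid
begin

lemma finsum_lessThan_add: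
  fixes f :: "nat \<Rightarrow> 'a"
  assumes "\<And>i. i < m + n \<Longrightarrow> f i \<in> carrier G"
  shows "(\<Oplus>i \<in> {..<m + n}. f i) = (\<Oplus>i \<in> {..<m}. f i) \<oplus> (\<Oplus>i \<in> {..<n}. f (m + i))"
proof -
  have "{..<m + n} = {..<m} \<union> (+) m ` {..<n}"
  proof (intro equalityI subsetI)
    fix i assume "i \<in> {..<m + n}"
    then show "i \<in> {..<m} \<union> (+) m ` {..<n}"
      by (cases "i < m") (auto intro!: image_eqI[of _ _ "i - m"])
  qed auto
  moreover have "{..<m} \<inter> (+) m ` {..<n} = {}"
    by auto
  moreover have "(\<Oplus>i \<in> (+) m ` {..<n}. f i) = (\<Oplus>i \<in> {..<n}. f (m + i))"
    using assms by (intro finsum_reindex) auto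
  ultimately show ?thesis
    using assms finsum_Un_disjoint[of "{..<m}" "(+) m ` {..<n}" f] by auto
qed

text \<open>A position in \<open>concat ass\<close> is a block \<open>i\<close> together with a
  position \<open>l\<close> inside it, and updating there is updating inside the block before
  concatenating. The induction on the blocks keeps \<open>F\<close> general: the tail is summed with
  \<open>F\<close> precomposed with prefixing the first block. The closure assumption ranges over
  all lists of the right length and entries so that it survives this change of
  \<open>F\<close>.\<close>

lemma finsum_update_concat:
  assumes "map length ass = map length bss"
    and "\<And>zs. \<lbrakk>length zs = length (concat ass); set zs \<subseteq> set (concat ass) \<union> set (concat bss)\<rbrakk> \<Longrightarrow>
      F zs \<in> carrier G"
  shows "(\<Oplus>m \<in> {..<length (concat ass)}. F ((concat ass)[m := concat bss ! m])) =
    (\<Oplus>i \<in> {..<length ass}. \<Oplus>l \<in> {..<length (ass ! i)}. F (concat (ass[i := (ass ! i)[l := bss ! i ! l]])))"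
  using map_eq_imp_length_eq[OF assms(1)] assms
proof (induction ass bss arbitrary: F rule: list_induct2)
  case Nil
  then show ?case by simp
next
  case (Cons as ass bs bss)
  let ?cs = "concat ass" and ?ds = "concat bss"
  have len: "length as = length bs" "map length ass = map length bss"
    using Cons.prems(1) by auto
  then have lencat: "length ?cs = length ?ds"
    by (simp add: length_concat)
  have mem: "F (as[l := bs ! l] @ ?cs) \<in> carrier G" if "l < length as" for l
    using that len by (intro Cons.prems(2)) (auto dest!: set_update_subset_insert[THEN subsetD])
  have mem': "F (as @ zs) \<in> carrier G"
    if "length zs = length ?cs" "set zs \<subseteq> set ?cs \<union> set ?ds" for zs
    using that by (intro Cons.prems(2)) auto
  have upd: "F (as @ ?cs[m := ?ds ! m]) \<in> carrier G" if "m < length ?cs" for m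
  proof (rule mem')
    have "?ds ! m \<in> set ?ds"
      using that lencat by (intro nth_mem) simp
    then show "set (?cs[m := ?ds ! m]) \<subseteq> set ?cs \<union> set ?ds"
      using set_update_subset_insert[of ?cs m "?ds ! m"] by blast
  qed simp
  have upd2: "F (as @ concat (ass[i := (ass ! i)[l := bss ! i ! l]])) \<in> carrier G"
    if "i < length ass" "l < length (ass ! i)" for i l
  proof (rule mem')
    have i: "i < length bss" "length (bss ! i) = length (ass ! i)"
      using that len(2) Cons.hyps by (metis, metis nth_map)
    show "length (concat (ass[i := (ass ! i)[l := bss ! i ! l]])) = length (concat ass)"
      by (simp add: length_concat map_length_update)
    have "set ((ass ! i)[l := bss ! i ! l]) \<subseteq> insert (bss ! i ! l) (set (ass ! i))"
      by (rule set_update_subset_insert)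
    also have "\<dots> \<subseteq> set ?cs \<union> set ?ds"
      using i that by (auto simp: in_set_conv_nth) (metis nth_mem)+
    finally show "set (concat (ass[i := (ass ! i)[l := bss ! i ! l]])) \<subseteq> set ?cs \<union> set ?ds"
      using set_update_subset_insert[of ass i "(ass ! i)[l := bss ! i ! l]"] by fastforce
  qed
  have "(\<Oplus>m \<in> {..<length (concat (as # ass))}. F ((concat (as # ass))[m := concat (bs # bss) ! m]))
    = (\<Oplus>m \<in> {..<length as + length ?cs}. F ((as @ ?cs)[m := (bs @ ?ds) ! m]))"
    by simp
  also have "\<dots> = (\<Oplus>m \<in> {..<length as}. F ((as @ ?cs)[m := (bs @ ?ds) ! m])) \<oplus>
      (\<Oplus>m \<in> {..<length ?cs}. F ((as @ ?cs)[length as + m := (bs @ ?ds) ! (length as + m)]))"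
    using mem upd len(1)
    by (intro finsum_lessThan_add)
      (auto simp: list_update_append nth_append dest!: less_diff_conv2[THEN iffD2, rotated])
  also have "(\<Oplus>m \<in> {..<length as}. F ((as @ ?cs)[m := (bs @ ?ds) ! m])) =
      (\<Oplus>l \<in> {..<length as}. F (as[l := bs ! l] @ ?cs))"
    using mem len(1) by (intro finsum_cong') (auto simp: list_update_append nth_append)
  also have "(\<Oplus>m \<in> {..<length ?cs}. F ((as @ ?cs)[length as + m := (bs @ ?ds) ! (length as + m)])) =
      (\<Oplus>m \<in> {..<length ?cs}. F (as @ ?cs[m := ?ds ! m]))"
    using upd len(1) by (intro finsum_cong') (auto simp: list_update_append nth_append)
  also have "\<dots> = (\<Oplus>i \<in> {..<length ass}. \<Oplus>l \<in> {..<length (ass ! i)}.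
      F (as @ concat (ass[i := (ass ! i)[l := bss ! i ! l]])))"
    using Cons.IH[OF len(2), of "\<lambda>zs. F (as @ zs)"] mem' by blast
  \<comment> \<open>The first block becomes the term \<open>i = 0\<close> and the remaining blocks
    are shifted by one.\<close>
  also have "(\<Oplus>l \<in> {..<length as}. F (as[l := bs ! l] @ ?cs)) \<oplus>
      (\<Oplus>i \<in> {..<length ass}. \<Oplus>l \<in> {..<length (ass ! i)}.
        F (as @ concat (ass[i := (ass ! i)[l := bss ! i ! l]]))) =
    (\<Oplus>i \<in> {..<1 + length ass}. \<Oplus>l \<in> {..<length ((as # ass) ! i)}.
        F (concat ((as # ass)[i := ((as # ass) ! i)[l := (bs # bss) ! i ! l]])))"
    using mem upd2 by (subst finsum_lessThan_add) (auto simp: lessThan_Suc less_Suc_eq_0_disj intro!: finsum_closed)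
  finally show ?case
    by simp
qed

end

section \<open>Calculus of the derivative: linearity in the operation, symmetry, chain rule\<close>

context op_algebra
begin

lemma leibniz_closed:
  assumes "\<mu> \<in> carrier (ops P (length as))" and "set as \<subseteq> carrier A"
    and "\<And>i. i < length as \<Longrightarrow> b i \<in> carrier A"
  shows "leibniz A \<mu> as b \<in> carrier A"
  unfolding leibniz_def using assms
  by (intro M.finsum_closed) (auto intro!: act_closed dest!: set_update_subset_insert[THEN subsetD])

text \<open>Agreement below \<open>length as\<close> is all that can be had when directions are
  given by list lookup, since a lookup beyond the end is unspecified.\<close>

lemma leibniz_cong:
  assumes "\<mu> \<in> carrier (ops P (length as))" and "set as \<subseteq> carrier A"
    and "\<And>i. i < length as \<Longrightarrow> b' i \<in> carrier A" and "\<And>i. i < length as \<Longrightarrow> b i = b' i"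
  shows "leibniz A \<mu> as b = leibniz A \<mu> as b'"
proof -
  have "act A \<mu> (as[i := b' i]) \<in> carrier A" if "i < length as" for i
    using that assms by (intro act_closed set_list_update_subset) auto
  then show ?thesis
    unfolding leibniz_def using assms(4) by (intro M.finsum_cong') auto
qed

lemma leibniz_op_linear:
  assumes "set as \<subseteq> carrier A" and "\<And>i. i < length as \<Longrightarrow> b i \<in> carrier A"
  shows "(\<lambda>\<mu>. leibniz A \<mu> as b) \<in> linear_maps R (ops P (length as)) A"
  unfolding leibniz_def
proof (rule linear_maps_sum[OF ops_module module_axioms])
  show "(\<lambda>\<mu>. act A \<mu> (as[i := b i])) \<in> linear_maps R (ops P (length as)) A" if "i \<in> {..<length as}" for i
    using act_op_linear[of "as[i := b i]"] set_list_update_subset[OF assms(1)] assms(2) that by simp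
qed simp

text \<open>Updating the permuted list at \<open>i\<close> is permuting the list updated at
  \<open>\<sigma> i\<close>, because \<open>\<sigma>\<close> is injective. So the summands are those
  for \<open>\<mu>\<close> in another order, and the sum is reindexed along
  \<open>\<sigma>\<close>.\<close>

lemma leibniz_sym:
  assumes \<sigma>: "\<sigma> permutes {..<length as}" and \<mu>: "\<mu> \<in> carrier (ops P (length as))"
    and as: "set as \<subseteq> carrier A" and b: "\<And>i. i < length as \<Longrightarrow> b i \<in> carrier A"
  shows "leibniz A (sym P (length as) \<mu> \<sigma>) (permute_list \<sigma> as) (\<lambda>i. b (\<sigma> i)) = leibniz A \<mu> as b"
proof -
  have upd: "set (as[i := b i]) \<subseteq> carrier A" if "i < length as" for i
    using as b that by (intro set_list_update_subset) auto
  then have closed: "act A \<mu> (as[i := b i]) \<in> carrier A" if "i < length as" for i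
    using that \<mu> by (intro act_closed) auto
  have \<sigma>_less: "\<sigma> i < length as" if "i < length as" for i
    using permutes_in_image[OF \<sigma>, of i] that by simp
  have "act A (sym P (length as) \<mu> \<sigma>) ((permute_list \<sigma> as)[i := b (\<sigma> i)]) = act A \<mu> (as[\<sigma> i := b (\<sigma> i)])"
    if i: "i < length as" for i
  proof -
    have "(permute_list \<sigma> as)[i := b (\<sigma> i)] = permute_list \<sigma> (as[\<sigma> i := b (\<sigma> i)])"
      using i \<sigma> \<sigma>_less permutes_inj[OF \<sigma>]
      by (intro nth_equalityI) (auto simp: permute_list_nth nth_list_update inj_eq)
    then show ?thesis
      using act_sym[of \<sigma> "as[\<sigma> i := b (\<sigma> i)]" \<mu>] \<sigma> \<mu> upd[OF \<sigma>_less[OF i]] by simp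
  qed
  then have "leibniz A (sym P (length as) \<mu> \<sigma>) (permute_list \<sigma> as) (\<lambda>i. b (\<sigma> i)) =
      (\<Oplus>\<^bsub>A\<^esub>i \<in> {..<length as}. act A \<mu> (as[\<sigma> i := b (\<sigma> i)]))"
    unfolding leibniz_def using upd \<sigma>_less \<mu> by (intro M.finsum_cong') (auto simp: closed)
  also have "\<dots> = (\<Oplus>\<^bsub>A\<^esub>i \<in> \<sigma> ` {..<length as}. act A \<mu> (as[i := b i]))"
    using upd \<sigma>_less \<mu> permutes_inj_on[OF \<sigma>]
    by (intro M.finsum_reindex[symmetric]) (auto simp: closed)
  finally show ?thesis
    by (simp add: permutes_image[OF \<sigma>] leibniz_def)
qed

text \<open>The chain rule. Linearity of \<open>\<mu>\<close> in argument \<open>i\<close> pulls the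
  inner Leibniz sum out; the composition axiom, applied to blocks with one entry changed, turns each
  term into one of the composite operation; \<open>finsum_update_concat\<close> then merges the
  double sum.\<close>

lemma leibniz_concat:
  assumes \<mu>: "\<mu> \<in> carrier (ops P (length ass))" and len: "length \<nu>s = length ass"
    and lens: "map length ass = map length bss"
    and \<nu>s: "\<And>i. i < length ass \<Longrightarrow> \<nu>s ! i \<in> carrier (ops P (length (ass ! i)))"
    and ass: "\<And>as. as \<in> set ass \<Longrightarrow> set as \<subseteq> carrier A"
    and bss: "\<And>bs. bs \<in> set bss \<Longrightarrow> set bs \<subseteq> carrier A"
  shows "leibniz A \<mu> (map2 (act A) \<nu>s ass) (\<lambda>i. leibniz A (\<nu>s ! i) (ass ! i) (\<lambda>l. bss ! i ! l)) =
    leibniz A (full_comp P \<mu> (zip (map length ass) \<nu>s)) (concat ass) (\<lambda>m. concat bss ! m)"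
proof -
  let ?\<kappa> = "full_comp P \<mu> (zip (map length ass) \<nu>s)" and ?ys = "map2 (act A) \<nu>s ass"
  have lenb: "length bss = length ass"
    using map_eq_imp_length_eq[OF lens] by simp
  have lenb_i: "length (bss ! i) = length (ass ! i)" if "i < length ass" for i
    using that lens lenb by (metis nth_map)
  have b: "bss ! i ! l \<in> carrier A" if "i < length ass" "l < length (ass ! i)" for i l
    using that bss[of "bss ! i"] lenb lenb_i by (auto simp: subset_iff)
  have a: "set (ass ! i) \<subseteq> carrier A" if "i < length ass" for i
    using that ass by simp
  have upd: "set ((ass ! i)[l := bss ! i ! l]) \<subseteq> carrier A"
    if "i < length ass" "l < length (ass ! i)" for i l
    using that a b by (intro set_list_update_subset) auto
  have act_upd: "act A (\<nu>s ! i) ((ass ! i)[l := bss ! i ! l]) \<in> carrier A"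
    if "i < length ass" "l < length (ass ! i)" for i l
    using that \<nu>s upd by (intro act_closed) auto
  have ys: "set ?ys \<subseteq> carrier A"
    using \<nu>s a len by (auto simp: set_zip intro!: act_closed)
  have \<kappa>: "?\<kappa> \<in> carrier (ops P (length (concat ass)))"
    using full_comp_closed[of \<mu> "map length ass" \<nu>s] \<mu> len \<nu>s by (simp add: length_concat)
  have cat_upd: "length (concat (ass[i := (ass ! i)[l := bss ! i ! l]])) = length (concat ass)"
    "set (concat (ass[i := (ass ! i)[l := bss ! i ! l]])) \<subseteq> carrier A"
    if "i < length ass" "l < length (ass ! i)" for i l
  proof -
    show "length (concat (ass[i := (ass ! i)[l := bss ! i ! l]])) = length (concat ass)"
      by (simp add: length_concat map_length_update)
    show "set (concat (ass[i := (ass ! i)[l := bss ! i ! l]])) \<subseteq> carrier A"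
      using that ass upd[OF that] set_update_subset_insert[of ass i "(ass ! i)[l := bss ! i ! l]"]
      by fastforce
  qed
  have act_cat: "act A ?\<kappa> (concat (ass[i := (ass ! i)[l := bss ! i ! l]])) \<in> carrier A"
    if "i < length ass" "l < length (ass ! i)" for i l
    using \<kappa> cat_upd[OF that] by (intro act_closed) auto
  have inner: "act A \<mu> (?ys[i := leibniz A (\<nu>s ! i) (ass ! i) (\<lambda>l. bss ! i ! l)]) =
      (\<Oplus>\<^bsub>A\<^esub>l \<in> {..<length (ass ! i)}. act A ?\<kappa> (concat (ass[i := (ass ! i)[l := bss ! i ! l]])))"
    if i: "i < length ass" for i
  proof -
    have "act A \<mu> (?ys[i := leibniz A (\<nu>s ! i) (ass ! i) (\<lambda>l. bss ! i ! l)]) =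
        (\<Oplus>\<^bsub>A\<^esub>l \<in> {..<length (ass ! i)}.
          act A \<mu> (?ys[i := act A (\<nu>s ! i) ((ass ! i)[l := bss ! i ! l])]))"
      unfolding leibniz_def using i len \<mu> ys act_upd
      by (intro linear_maps_finsum[OF module_axioms module_axioms act_arg_linear]) auto
    also have "\<dots> = (\<Oplus>\<^bsub>A\<^esub>l \<in> {..<length (ass ! i)}.
        act A ?\<kappa> (concat (ass[i := (ass ! i)[l := bss ! i ! l]])))"
    proof (rule M.finsum_cong')
      fix l assume l: "l \<in> {..<length (ass ! i)}"
      let ?ass = "ass[i := (ass ! i)[l := bss ! i ! l]]"
      have "?ys[i := act A (\<nu>s ! i) ((ass ! i)[l := bss ! i ! l])] = map2 (act A) \<nu>s ?ass"
        using i len by (intro nth_equalityI) (auto simp: nth_list_update)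
      \<comment> \<open>The composite operation depends on the blocks only through their lengths, so
        every summand involves the same \<open>?\<kappa>\<close>.\<close>
      moreover have "map length ?ass = map length ass"
        by (rule map_length_update) simp
      moreover have "act A \<mu> (map2 (act A) \<nu>s ?ass) =
          act A (full_comp P \<mu> (zip (map length ?ass) \<nu>s)) (concat ?ass)"
      proof (rule act_concat)
        show "set as \<subseteq> carrier A" if "as \<in> set ?ass" for as
          using that ass upd[OF i] l set_update_subset_insert[of ass i "(ass ! i)[l := bss ! i ! l]"]
          by blast
      qed (use \<mu> len \<nu>s i in \<open>auto simp: nth_list_update\<close>)
      ultimately show "act A \<mu> (?ys[i := act A (\<nu>s ! i) ((ass ! i)[l := bss ! i ! l])]) =
          act A ?\<kappa> (concat ?ass)"
        by simp
    qed (use i act_cat in auto)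
    finally show ?thesis .
  qed
  have "leibniz A \<mu> ?ys (\<lambda>i. leibniz A (\<nu>s ! i) (ass ! i) (\<lambda>l. bss ! i ! l)) =
      (\<Oplus>\<^bsub>A\<^esub>i \<in> {..<length ass}. \<Oplus>\<^bsub>A\<^esub>l \<in> {..<length (ass ! i)}.
        act A ?\<kappa> (concat (ass[i := (ass ! i)[l := bss ! i ! l]])))"
    unfolding leibniz_def[of A \<mu>] using len inner act_cat
    by (intro M.finsum_cong') (auto intro!: M.finsum_closed)
  also have "\<dots> = (\<Oplus>\<^bsub>A\<^esub>m \<in> {..<length (concat ass)}. act A ?\<kappa> ((concat ass)[m := concat bss ! m]))"
  proof (rule M.finsum_update_concat[OF lens, symmetric])
    fix zs assume zs: "length zs = length (concat ass)" "set zs \<subseteq> set (concat ass) \<union> set (concat bss)"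
    have "set (concat ass) \<union> set (concat bss) \<subseteq> carrier A"
      using ass bss by auto
    with zs(2) have "set zs \<subseteq> carrier A"
      by (rule subset_trans)
    then show "act A ?\<kappa> zs \<in> carrier A"
      using zs(1) \<kappa> by (intro act_closed) auto
  qed
  finally show ?thesis
    by (simp add: leibniz_def)
qed

end

section \<open>Semi-direct products satisfy the algebra axioms\<close>

locale universe_algebra = op_algebra R P A
  for R :: "('r, 'x) ring_scheme" (structure) and P :: "('r, 'p) operad_data"
    and A :: "('r, 'a universe, 'p) alg_data"
begin

lemma semidirect_carrierI:
  "\<lbrakk>length xs = n + 1; \<And>j. j \<le> n \<Longrightarrow> xs ! j \<in> carrier A\<rbrakk> \<Longrightarrow> Tup xs \<in> carrier (semidirect n A)"
  by (auto simp: in_semidirect_iff in_set_conv_nth less_Suc_eq_le)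

lemma coord_list_closed:
  assumes "set xs \<subseteq> carrier (semidirect n A)" and "j \<le> n"
  shows "set (map (coord j) xs) \<subseteq> carrier A" and "i < length xs \<Longrightarrow> coord j (xs ! i) \<in> carrier A"
  using assms coord_closed[of _ n A j] by (auto simp: subset_iff)

lemma module_semidirect: "module R (semidirect n A)"
proof (rule module_by_components[where I = "{..n}" and M = "\<lambda>_. A" and \<pi> = coord])
  show "x \<oplus>\<^bsub>semidirect n A\<^esub> y \<in> carrier (semidirect n A)"
    if "x \<in> carrier (semidirect n A)" "y \<in> carrier (semidirect n A)" for x y
    using that by (auto simp: in_semidirect_iff) (auto simp: semidirect_def set_zip subset_iff)
  show "r \<odot>\<^bsub>semidirect n A\<^esub> x \<in> carrier (semidirect n A)"
    if "r \<in> carrier R" "x \<in> carrier (semidirect n A)" for r x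
    using that by (auto simp: in_semidirect_iff) (auto simp: semidirect_def subset_iff)
  show "\<zero>\<^bsub>semidirect n A\<^esub> \<in> carrier (semidirect n A)"
    by (auto simp: semidirect_def)
  fix x assume x: "x \<in> carrier (semidirect n A)"
  let ?y = "Tup (map (a_inv A) (untup x))"
  have "?y \<in> carrier (semidirect n A)" "\<forall>i \<in> {..n}. coord i ?y = \<ominus>\<^bsub>A\<^esub> coord i x"
    using x by (auto simp: in_semidirect_iff)
  then show "\<exists>y \<in> carrier (semidirect n A). \<forall>i \<in> {..n}. coord i y = \<ominus>\<^bsub>A\<^esub> coord i x"
    by blast
qed (auto simp: is_cring module_axioms coord_closed coord_add coord_smult coord_zero
    intro: semidirect_eqI)

lemma linear_coord: "j \<le> n \<Longrightarrow> coord j \<in> linear_maps R (semidirect n A) A"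
  by (rule linear_mapsI) (auto simp: coord_closed coord_add coord_smult)

lemma linear_maps_semidirectI:
  assumes "module R M" and closed: "\<And>x. x \<in> carrier M \<Longrightarrow> f x \<in> carrier (semidirect n A)"
    and lin: "\<And>j. j \<le> n \<Longrightarrow> (\<lambda>x. coord j (f x)) \<in> linear_maps R M A"
  shows "f \<in> linear_maps R M (semidirect n A)"
  by (rule linear_maps_by_components[where \<pi> = coord and I = "{..n}" and M = "\<lambda>_. A"])
    (use assms module_semidirect linear_coord in \<open>auto intro: semidirect_eqI\<close>)

lemma act_semidirect_closed:
  assumes \<mu>: "\<mu> \<in> carrier (ops P (length xs))" and xs: "set xs \<subseteq> carrier (semidirect n A)"
  shows "act (semidirect n A) \<mu> xs \<in> carrier (semidirect n A)"
proof -
  have as: "set (map (coord 0) xs) \<subseteq> carrier A"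
    by (rule coord_list_closed(1)[OF xs]) simp
  show ?thesis
    unfolding act_semidirect
  proof (rule semidirect_carrierI)
    fix j assume "j \<le> n"
    then show "(act A \<mu> (map (coord 0) xs) # map (\<lambda>j. leibniz A \<mu> (map (coord 0) xs)
        (\<lambda>i. coord j (xs ! i))) [1..<n + 1]) ! j \<in> carrier A"
      using act_closed[of \<mu> "map (coord 0) xs"] leibniz_closed[of \<mu> "map (coord 0) xs"] \<mu> as
        coord_list_closed(2)[OF xs]
      by (cases j) (simp_all del: upt_Suc)
  qed simp
qed

text \<open>
  Updating the \<open>i\<close>-th argument of the \<open>k\<close>-th summand of the Leibniz sum by \<open>(a, b)\<close> is linear in
  \<open>b\<close> if \<open>k = i\<close>, and linear in \<open>a\<close> otherwise.
\<close>

lemma linear_leibniz_summand: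
  assumes "i < length xs" and "k < length xs" and "\<mu> \<in> carrier (ops P (length xs))"
    and xs: "set xs \<subseteq> carrier (semidirect n A)" and j: "j \<le> n"
  shows "(\<lambda>x. act A \<mu> ((map (coord 0) (xs[i := x]))[k := coord j (xs[i := x] ! k)]))
    \<in> linear_maps R (semidirect n A) A"
proof (cases "k = i")
  case True
  have "(\<lambda>x. act A \<mu> ((map (coord 0) xs)[i := coord j x])) \<in> linear_maps R (semidirect n A) A"
    using assms coord_list_closed[OF xs]
    by (intro linear_maps_comp[OF linear_coord[OF j] act_arg_linear]) auto
  then show ?thesis
    using True assms(1) by (simp add: map_update)
next
  case False
  \<comment> \<open>The tangent entry at \<open>k\<close> does not depend on \<open>x\<close> when
    \<open>k \<noteq> i\<close>, so it is put in first and \<open>x\<close> enters through the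
    remaining update at \<open>i\<close>.\<close>
  let ?as = "(map (coord 0) xs)[k := coord j (xs ! k)]"
  have "set ?as \<subseteq> carrier A"
    using coord_list_closed[OF xs] assms(2) j by (intro set_list_update_subset) auto
  then have "(\<lambda>x. act A \<mu> (?as[i := coord 0 x])) \<in> linear_maps R (semidirect n A) A"
    using assms by (intro linear_maps_comp[OF linear_coord act_arg_linear]) auto
  then show ?thesis
    using False assms(1) by (simp add: map_update list_update_swap)
qed

lemma act_semidirect_arg_linear:
  assumes i: "i < length xs" and \<mu>: "\<mu> \<in> carrier (ops P (length xs))"
    and xs: "set xs \<subseteq> carrier (semidirect n A)"
  shows "(\<lambda>x. act (semidirect n A) \<mu> (xs[i := x])) \<in> linear_maps R (semidirect n A) (semidirect n A)"
proof (rule linear_maps_semidirectI[OF module_semidirect])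
  fix x assume "x \<in> carrier (semidirect n A)"
  then show "act (semidirect n A) \<mu> (xs[i := x]) \<in> carrier (semidirect n A)"
    using assms by (intro act_semidirect_closed set_list_update_subset) auto
next
  fix j assume j: "j \<le> n"
  show "(\<lambda>x. coord j (act (semidirect n A) \<mu> (xs[i := x]))) \<in> linear_maps R (semidirect n A) A"
  proof (cases "j = 0")
    case True
    have "(\<lambda>x. act A \<mu> ((map (coord 0) xs)[i := coord 0 x])) \<in> linear_maps R (semidirect n A) A"
      using assms coord_list_closed[OF xs]
      by (intro linear_maps_comp[OF linear_coord act_arg_linear]) auto
    then show ?thesis
      using True by (simp add: coord_act_0 map_update)
  next
    case False
    then have "(\<lambda>x. coord j (act (semidirect n A) \<mu> (xs[i := x]))) =
        (\<lambda>x. \<Oplus>\<^bsub>A\<^esub>k \<in> {..<length xs}.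
          act A \<mu> ((map (coord 0) (xs[i := x]))[k := coord j (xs[i := x] ! k)]))"
      using j by (simp add: coord_act leibniz_def)
    also have "\<dots> \<in> linear_maps R (semidirect n A) A"
      using linear_leibniz_summand[OF i _ \<mu> xs j]
      by (intro linear_maps_sum module_semidirect module_axioms) auto
    finally show ?thesis .
  qed
qed

text \<open>Equations are compared coordinate by coordinate. Coordinate 0 reproduces the axiom for
  \<open>A\<close>. On the others, symmetry is \<open>leibniz_sym\<close>, associativity is the
  chain rule \<open>leibniz_concat\<close>, and the unit law holds because the Leibniz sum has a
  single term.\<close>

lemma operad_algebra_semidirect: "operad_algebra R P (semidirect n A)"
  unfolding operad_algebra_iff[OF operad_axioms]
proof (intro conjI ballI allI impI)
  interpret S: module R "semidirect n A" by (rule module_semidirect)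
  show "multilinear_action R P (semidirect n A)"
  proof
    fix xs assume xs: "set xs \<subseteq> carrier (semidirect n A)"
    note as = coord_list_closed[OF xs]
    note closed = act_semidirect_closed
    show "(\<lambda>\<mu>. act (semidirect n A) \<mu> xs) \<in> linear_maps R (ops P (length xs)) (semidirect n A)"
    proof (rule linear_maps_semidirectI[OF ops_module])
      show "(\<lambda>\<mu>. coord j (act (semidirect n A) \<mu> xs)) \<in> linear_maps R (ops P (length xs)) A"
        if "j \<le> n" for j
        using that as act_op_linear[of "map (coord 0) xs"]
          leibniz_op_linear[of "map (coord 0) xs" "\<lambda>i. coord j (xs ! i)"]
        by (cases "j = 0") (simp_all add: coord_act_0 coord_act)
    qed (use xs closed in blast)
    fix \<mu> assume \<mu>: "\<mu> \<in> carrier (ops P (length xs))"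
    show "act (semidirect n A) (sym P (length xs) \<mu> \<sigma>) (permute_list \<sigma> xs) =
        act (semidirect n A) \<mu> xs" if \<sigma>: "\<sigma> permutes {..<length xs}" for \<sigma>
    proof (rule semidirect_eqI)
      fix j assume j: "j \<le> n"
      show "coord j (act (semidirect n A) (sym P (length xs) \<mu> \<sigma>) (permute_list \<sigma> xs)) =
          coord j (act (semidirect n A) \<mu> xs)"
      proof (cases "j = 0")
        case True
        then show ?thesis
          using act_sym[of \<sigma> "map (coord 0) xs" \<mu>] \<mu> \<sigma> as by (simp add: coord_act_0 permute_list_map)
      next
        case False
        have "leibniz A (sym P (length xs) \<mu> \<sigma>) (permute_list \<sigma> (map (coord 0) xs))
            (\<lambda>i. coord j (permute_list \<sigma> xs ! i)) =
          leibniz A (sym P (length xs) \<mu> \<sigma>) (permute_list \<sigma> (map (coord 0) xs)) (\<lambda>i. coord j (xs ! \<sigma> i))"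
        proof (rule leibniz_cong)
          fix i assume i: "i < length (permute_list \<sigma> (map (coord 0) xs))"
          then have "\<sigma> i < length xs"
            using permutes_in_image[OF \<sigma>, of i] by simp
          then show "coord j (xs ! \<sigma> i) \<in> carrier A"
            using as(2) j by blast
          show "coord j (permute_list \<sigma> xs ! i) = coord j (xs ! \<sigma> i)"
            using i \<sigma> by (simp add: permute_list_nth)
        qed (use \<mu> \<sigma> as(1)[of 0] in \<open>auto intro: sym_closed\<close>)
        also have "\<dots> = leibniz A \<mu> (map (coord 0) xs) (\<lambda>i. coord j (xs ! i))"
          using leibniz_sym[of \<sigma> "map (coord 0) xs" \<mu> "\<lambda>i. coord j (xs ! i)"] \<sigma> \<mu> as j by simp
        finally show ?thesis
          using False j \<sigma> by (simp add: coord_act permute_list_map)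
      qed
    qed (use \<mu> \<sigma> xs in \<open>auto intro!: closed sym_closed\<close>)
    show "(\<lambda>x. act (semidirect n A) \<mu> (xs[i := x])) \<in>
        linear_maps R (semidirect n A) (semidirect n A)" if "i < length xs" for i
      using that \<mu> xs by (rule act_semidirect_arg_linear)
  qed
next
  fix x assume x: "x \<in> carrier (semidirect n A)"
  show "act (semidirect n A) (unit P) [x] = x"
  proof (rule semidirect_eqI)
    fix j assume "j \<le> n"
    then show "coord j (act (semidirect n A) (unit P) [x]) = coord j x"
      using coord_closed[OF x] act_unit
      by (cases "j = 0") (simp_all add: coord_act_0 coord_act leibniz_def lessThan_Suc Pi_def)
  qed (use x unit_closed in \<open>auto intro!: act_semidirect_closed\<close>)
next
  fix k \<mu> \<nu>s and xss :: "'a universe list list"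
  assume \<mu>: "\<mu> \<in> carrier (ops P k)" and len: "length \<nu>s = k" "length xss = k"
    and \<nu>s: "\<forall>i < k. \<nu>s ! i \<in> carrier (ops P (length (xss ! i))) \<and>
      set (xss ! i) \<subseteq> carrier (semidirect n A)"
  let ?\<kappa> = "full_comp P \<mu> (zip (map length xss) \<nu>s)" and ?ass = "map (map (coord 0)) xss"
  have xss: "set xs \<subseteq> carrier (semidirect n A)" if "xs \<in> set xss" for xs
    using that \<nu>s len by (metis in_set_conv_nth)
  have \<kappa>: "?\<kappa> \<in> carrier (ops P (length (concat xss)))"
    using full_comp_closed[of \<mu> "map length xss" \<nu>s] \<mu> len \<nu>s by (simp add: length_concat)
  have ass: "set as \<subseteq> carrier A" if "as \<in> set (map (map (coord j)) xss)" "j \<le> n" for as j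
    using that coord_closed[of _ n A j] xss by fastforce
  have coord0: "map (coord 0) (map2 (act (semidirect n A)) \<nu>s xss) = map2 (act A) \<nu>s ?ass"
    using len by (intro nth_equalityI) (auto simp: coord_act_0)
  show "act (semidirect n A) \<mu> (map2 (act (semidirect n A)) \<nu>s xss) =
      act (semidirect n A) ?\<kappa> (concat xss)"
  proof (rule semidirect_eqI)
    show "act (semidirect n A) \<mu> (map2 (act (semidirect n A)) \<nu>s xss) \<in> carrier (semidirect n A)"
      using \<mu> \<nu>s len by (intro act_semidirect_closed) (auto simp: set_zip intro!: act_semidirect_closed)
    show "act (semidirect n A) ?\<kappa> (concat xss) \<in> carrier (semidirect n A)"
      using \<kappa> xss by (intro act_semidirect_closed) auto
    fix j assume j: "j \<le> n"
    show "coord j (act (semidirect n A) \<mu> (map2 (act (semidirect n A)) \<nu>s xss)) =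
        coord j (act (semidirect n A) ?\<kappa> (concat xss))"
    proof (cases "j = 0")
      case True
      have "act A \<mu> (map2 (act A) \<nu>s ?ass) =
          act A (full_comp P \<mu> (zip (map length ?ass) \<nu>s)) (concat ?ass)"
        using \<mu> len \<nu>s ass[of _ 0] by (intro act_concat) auto
      then show ?thesis
        using True coord0 by (simp add: coord_act_0 map_concat comp_def)
    next
      case False
      let ?bss = "map (map (coord j)) xss"
      \<comment> \<open>The tangent coordinate of an inner value is itself a derivative; rewriting
        it brings the direction into the form required by \<open>leibniz_concat\<close>.\<close>
      have "leibniz A \<mu> (map2 (act A) \<nu>s ?ass)
          (\<lambda>i. coord j (map2 (act (semidirect n A)) \<nu>s xss ! i)) =
        leibniz A \<mu> (map2 (act A) \<nu>s ?ass) (\<lambda>i. leibniz A (\<nu>s ! i) (?ass ! i) (\<lambda>l. ?bss ! i ! l))"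
      proof (rule leibniz_cong)
        fix i assume "i < length (map2 (act A) \<nu>s ?ass)"
        then have i: "i < k"
          using len by simp
        have xi: "\<nu>s ! i \<in> carrier (ops P (length (xss ! i)))" "set (xss ! i) \<subseteq> carrier (semidirect n A)"
          using \<nu>s i by auto
        show "leibniz A (\<nu>s ! i) (?ass ! i) (\<lambda>l. ?bss ! i ! l) \<in> carrier A"
          using i len xi coord_list_closed[OF xi(2)] j by (intro leibniz_closed) simp_all
        have "leibniz A (\<nu>s ! i) (map (coord 0) (xss ! i)) (\<lambda>l. coord j (xss ! i ! l)) =
            leibniz A (\<nu>s ! i) (map (coord 0) (xss ! i)) (\<lambda>l. map (coord j) (xss ! i) ! l)"
          using xi coord_list_closed[OF xi(2)] j by (intro leibniz_cong) simp_all
        then show "coord j (map2 (act (semidirect n A)) \<nu>s xss ! i) =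
            leibniz A (\<nu>s ! i) (?ass ! i) (\<lambda>l. ?bss ! i ! l)"
          using i len False j by (simp add: coord_act)
      next
        show "set (map2 (act A) \<nu>s ?ass) \<subseteq> carrier A"
        proof
          fix a assume "a \<in> set (map2 (act A) \<nu>s ?ass)"
          then obtain i where i: "i < k" "a = act A (\<nu>s ! i) (map (coord 0) (xss ! i))"
            using len by (auto simp: set_zip)
          then show "a \<in> carrier A"
            using \<nu>s coord_list_closed(1)[of "xss ! i" n 0] by (auto simp del: set_map intro!: act_closed)
        qed
      qed (use \<mu> len in simp)
      also have "\<dots> = leibniz A (full_comp P \<mu> (zip (map length ?ass) \<nu>s)) (concat ?ass)
          (\<lambda>m. concat ?bss ! m)"
        using \<mu> len \<nu>s ass[of _ 0] ass[of _ j] j by (intro leibniz_concat) (auto simp: comp_def)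
      also have "\<dots> = leibniz A ?\<kappa> (map (coord 0) (concat xss)) (\<lambda>m. coord j (concat xss ! m))"
      proof -
        have cat: "set (concat xss) \<subseteq> carrier (semidirect n A)"
          using xss by auto
        have "leibniz A ?\<kappa> (map (coord 0) (concat xss)) (\<lambda>m. map (coord j) (concat xss) ! m) =
            leibniz A ?\<kappa> (map (coord 0) (concat xss)) (\<lambda>m. coord j (concat xss ! m))"
          using \<kappa> coord_list_closed[OF cat] j by (intro leibniz_cong) simp_all
        then show ?thesis
          by (simp add: map_concat comp_def)
      qed
      finally show ?thesis
        using False j coord0 by (simp add: coord_act)
    qed
  qed
qed

lemma algebra_semidirect: "universe_algebra R P (semidirect n A)"
  using operad_algebra_semidirect
  by (simp add: universe_algebra_def op_algebra_def operad_axioms)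

end


section \<open>The structure maps are morphisms of algebras\<close>

text \<open>Otherwise \<open>coord 1\<close> is rewritten to \<open>coord (Suc 0)\<close>, which none of the rules below match.\<close>

declare One_nat_def [simp del]

text \<open>Morphisms commute with derivatives, term by term. This makes the application of
  \<open>f\<close> in both coordinates a morphism again; for \<open>f = coord 0\<close> it computes
  the base points of derivatives taken in a tangent algebra.\<close>

lemma alg_homs_leibniz:
  assumes "op_algebra R P A" and "op_algebra R P B" and f: "f \<in> alg_homs R P A B"
    and \<mu>: "\<mu> \<in> carrier (ops P (length as))" and as: "set as \<subseteq> carrier A"
    and b: "\<And>i. i < length as \<Longrightarrow> b i \<in> carrier A"
  shows "f (leibniz A \<mu> as b) = leibniz B \<mu> (map f as) (\<lambda>i. f (b i))"
proof -
  interpret A: op_algebra R P A by fact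
  interpret B: op_algebra R P B by fact
  have upd: "set (as[i := b i]) \<subseteq> carrier A" if "i < length as" for i
    using as b that by (intro set_list_update_subset) auto
  then have "f (leibniz A \<mu> as b) = (\<Oplus>\<^bsub>B\<^esub>i \<in> {..<length as}. f (act A \<mu> (as[i := b i])))"
    unfolding leibniz_def using \<mu>
    by (intro linear_maps_finsum[OF A.module_axioms B.module_axioms alg_homs_linear[OF f]] Pi_I
        A.act_closed) auto
  also have "\<dots> = leibniz B \<mu> (map f as) (\<lambda>i. f (b i))"
    unfolding leibniz_def
  proof (rule B.M.finsum_cong')
    have *: "f (act A \<mu> (as[i := b i])) = act B \<mu> ((map f as)[i := f (b i)])" if "i < length as" for i
      using alg_homs_act[OF f, of \<mu> "as[i := b i]"] upd[OF that] \<mu> by (simp add: map_update)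
    then show "f (act A \<mu> (as[i := b i])) = act B \<mu> ((map f as)[i := f (b i)])"
      if "i \<in> {..<length (map f as)}" for i
      using that by simp
    show "(\<lambda>i. act B \<mu> ((map f as)[i := f (b i)])) \<in> {..<length (map f as)} \<rightarrow> carrier B"
      using * upd \<mu> alg_homs_closed[OF f A.act_closed] by (auto simp del: set_list_update_subset) (metis length_list_update)
  qed simp
  finally show ?thesis .
qed

section \<open>Additivity of the derivative in its direction\<close>

context op_algebra
begin

lemma act_update_closed:
  assumes "\<mu> \<in> carrier (ops P (length as))" and "set as \<subseteq> carrier A" and "x \<in> carrier A"
  shows "act A \<mu> (as[i := x]) \<in> carrier A"
  using assms by (intro act_closed set_list_update_subset) auto

lemma act_update_zero:
  assumes "i < length as" and "\<mu> \<in> carrier (ops P (length as))" and "set as \<subseteq> carrier A"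
  shows "act A \<mu> (as[i := \<zero>\<^bsub>A\<^esub>]) = \<zero>\<^bsub>A\<^esub>"
  using linear_maps_zero[OF module_axioms module_axioms act_arg_linear[OF assms]] .

text \<open>Each summand is linear in the inserted entry. This law and its versions for zero and
  negatives are the reasons why \<open>tan_s\<close>, \<open>tan_z\<close> and \<open>tan_n\<close>
  are morphisms.\<close>

lemma leibniz_add:
  assumes "\<mu> \<in> carrier (ops P (length as))" and "set as \<subseteq> carrier A"
    and "\<And>i. i < length as \<Longrightarrow> b i \<in> carrier A" and "\<And>i. i < length as \<Longrightarrow> b' i \<in> carrier A"
  shows "leibniz A \<mu> as (\<lambda>i. b i \<oplus>\<^bsub>A\<^esub> b' i) = leibniz A \<mu> as b \<oplus>\<^bsub>A\<^esub> leibniz A \<mu> as b'"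
proof -
  have "leibniz A \<mu> as (\<lambda>i. b i \<oplus>\<^bsub>A\<^esub> b' i) =
      (\<Oplus>\<^bsub>A\<^esub>i \<in> {..<length as}. act A \<mu> (as[i := b i]) \<oplus>\<^bsub>A\<^esub> act A \<mu> (as[i := b' i]))"
    unfolding leibniz_def using assms linear_maps_add[OF act_arg_linear]
    by (intro M.finsum_cong') (auto simp: act_update_closed)
  then show ?thesis
    unfolding leibniz_def using assms
    by (subst M.finsum_addf[symmetric]) (auto simp: act_update_closed)
qed

lemma leibniz_zero:
  assumes "\<mu> \<in> carrier (ops P (length as))" and "set as \<subseteq> carrier A"
  shows "leibniz A \<mu> as (\<lambda>_. \<zero>\<^bsub>A\<^esub>) = \<zero>\<^bsub>A\<^esub>"
  unfolding leibniz_def using assms by (intro M.add.finprod_one_eqI) (simp add: act_update_zero)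

lemma leibniz_minus:
  assumes "\<mu> \<in> carrier (ops P (length as))" and "set as \<subseteq> carrier A"
    and "\<And>i. i < length as \<Longrightarrow> b i \<in> carrier A"
  shows "leibniz A \<mu> as (\<lambda>i. \<ominus>\<^bsub>A\<^esub> b i) = \<ominus>\<^bsub>A\<^esub> leibniz A \<mu> as b"
proof -
  have "leibniz A \<mu> as (\<lambda>i. \<ominus>\<^bsub>A\<^esub> b i) \<oplus>\<^bsub>A\<^esub> leibniz A \<mu> as b =
      leibniz A \<mu> as (\<lambda>i. \<ominus>\<^bsub>A\<^esub> b i \<oplus>\<^bsub>A\<^esub> b i)"
    using assms by (intro leibniz_add[symmetric]) auto
  also have "\<dots> = leibniz A \<mu> as (\<lambda>_. \<zero>\<^bsub>A\<^esub>)"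
    using assms by (intro leibniz_cong) (auto simp: M.l_neg)
  finally have "leibniz A \<mu> as (\<lambda>i. \<ominus>\<^bsub>A\<^esub> b i) \<oplus>\<^bsub>A\<^esub> leibniz A \<mu> as b = \<zero>\<^bsub>A\<^esub>"
    using leibniz_zero assms by simp
  then show ?thesis
    using assms leibniz_closed by (intro M.minus_equality[symmetric]) auto
qed

lemma linear_minus: "a_inv A \<in> linear_maps R A A"
  by (rule linear_mapsI) (auto simp: M.minus_add smult_r_minus)

end

lemma linear_zero:
  assumes "module R N"
  shows "(\<lambda>_. \<zero>\<^bsub>N\<^esub>) \<in> linear_maps R M N"
proof -
  interpret N: module R N by fact
  show ?thesis
    by (rule linear_mapsI) auto
qed

lemma linear_maps_pointwise_add:
  assumes "module R N" and f: "f \<in> linear_maps R M N" and g: "g \<in> linear_maps R M N"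
  shows "(\<lambda>x. f x \<oplus>\<^bsub>N\<^esub> g x) \<in> linear_maps R M N"
proof -
  interpret N: module R N by fact
  show ?thesis
    by (rule linear_mapsI) (auto simp: linear_mapsD[OF f] linear_mapsD[OF g] N.M.a_ac N.smult_r_distr)
qed

lemma in_tan_T_iff:
  "x \<in> carrier (tan_T A) \<longleftrightarrow> (\<exists>a \<in> carrier A. \<exists>b \<in> carrier A. x = Tup [a, b])"
  by (auto simp: tan_T_def in_semidirect_iff length_Suc_conv numeral_2_eq_2)

lemma coord_tan_T_closed:
  "x \<in> carrier (tan_T A) \<Longrightarrow> coord 0 x \<in> carrier A"
  "x \<in> carrier (tan_T A) \<Longrightarrow> coord 1 x \<in> carrier A"
  by (auto simp: in_tan_T_iff)

lemma tan_T_eqI: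
  assumes "x \<in> carrier (tan_T A)" and "y \<in> carrier (tan_T A)"
    and "coord 0 x = coord 0 y" and "coord 1 x = coord 1 y"
  shows "x = y"
  using assms by (auto simp: in_tan_T_iff)

context universe_algebra
begin

lemma algebra_tan_T: "universe_algebra R P (tan_T A)"
  unfolding tan_T_def by (rule algebra_semidirect)

lemma module_tan_T: "module R (tan_T A)"
  unfolding tan_T_def by (rule module_semidirect)

lemma coord_0_hom: "coord 0 \<in> alg_homs R P (semidirect n A) A"
  using linear_coord by (intro alg_homsI) (auto simp: coord_act_0)

text \<open>The hypothesis \<open>der\<close> makes \<open>h\<close> a derivation along
  \<open>g\<close>, which is what the action on \<open>tan_T A\<close> asks of the second
  coordinate. Every structure map with values in a tangent algebra is checked through this
  criterion, which leaves one Leibniz identity per map.\<close>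

lemma tan_T_homI:
  assumes "module R X" and g: "g \<in> alg_homs R P X A" and h: "h \<in> linear_maps R X A"
    and der: "\<And>\<mu> xs. \<lbrakk>\<mu> \<in> carrier (ops P (length xs)); set xs \<subseteq> carrier X\<rbrakk> \<Longrightarrow>
      h (act X \<mu> xs) = leibniz A \<mu> (map g xs) (\<lambda>i. h (xs ! i))"
  shows "(\<lambda>x. Tup [g x, h x]) \<in> alg_homs R P X (tan_T A)"
proof (rule alg_homsI)
  have closed: "Tup [g x, h x] \<in> carrier (tan_T A)" if "x \<in> carrier X" for x
    using that alg_homs_closed[OF g] linear_maps_closed[OF h] by (auto simp: in_tan_T_iff)
  show "(\<lambda>x. Tup [g x, h x]) \<in> linear_maps R X (tan_T A)"
    unfolding tan_T_def
  proof (rule linear_maps_semidirectI[OF assms(1)])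
    show "(\<lambda>x. coord j (Tup [g x, h x])) \<in> linear_maps R X A" if j: "j \<le> 1" for j
      using that alg_homs_linear[OF g] h by (cases j) auto
  qed (use closed in \<open>simp add: tan_T_def\<close>)
  fix \<mu> xs assume \<mu>: "\<mu> \<in> carrier (ops P (length xs))" and xs: "set xs \<subseteq> carrier X"
  have gh: "set (map g xs) \<subseteq> carrier A" "\<And>i. i < length xs \<Longrightarrow> h (xs ! i) \<in> carrier A"
    using xs alg_homs_closed[OF g] linear_maps_closed[OF h] by (auto simp: subset_iff)
  have "act (tan_T A) \<mu> (map (\<lambda>x. Tup [g x, h x]) xs) =
      Tup [act A \<mu> (map g xs), leibniz A \<mu> (map g xs) (\<lambda>i. coord 1 (map (\<lambda>x. Tup [g x, h x]) xs ! i))]"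
    by (simp add: tan_T_def act_semidirect comp_def upt_rec[of 1 2])
  also have "leibniz A \<mu> (map g xs) (\<lambda>i. coord 1 (map (\<lambda>x. Tup [g x, h x]) xs ! i)) =
      leibniz A \<mu> (map g xs) (\<lambda>i. h (xs ! i))"
    using \<mu> gh by (intro leibniz_cong) auto
  finally show "Tup [g (act X \<mu> xs), h (act X \<mu> xs)] =
      act (tan_T A) \<mu> (map (\<lambda>x. Tup [g x, h x]) xs)"
    using alg_homs_act[OF g \<mu> xs] der[OF \<mu> xs] by simp
qed

text \<open>The action on \<open>semidirect n A\<close> is defined so that \<open>coord j\<close> is
  a derivation along \<open>coord 0\<close>, and this is the whole condition.\<close>

lemma tan_q_hom:
  assumes "1 \<le> j" and "j \<le> n"
  shows "(\<lambda>x. Tup [coord 0 x, coord j x]) \<in> alg_homs R P (semidirect n A) (tan_T A)"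
  using assms by (intro tan_T_homI module_semidirect coord_0_hom linear_coord) (auto simp: coord_act)

lemma tan_s_hom:
  "(\<lambda>x. Tup [coord 0 x, coord 1 x \<oplus>\<^bsub>A\<^esub> coord 2 x]) \<in> alg_homs R P (semidirect 2 A) (tan_T A)"
proof (rule tan_T_homI[OF module_semidirect coord_0_hom])
  show "(\<lambda>x. coord 1 x \<oplus>\<^bsub>A\<^esub> coord 2 x) \<in> linear_maps R (semidirect 2 A) A"
    by (intro linear_maps_pointwise_add linear_coord module_axioms) auto
  fix \<mu> xs assume \<mu>: "\<mu> \<in> carrier (ops P (length xs))" and xs: "set xs \<subseteq> carrier (semidirect 2 A)"
  note as = coord_list_closed[OF xs]
  have "leibniz A \<mu> (map (coord 0) xs) (\<lambda>i. coord 1 (xs ! i) \<oplus>\<^bsub>A\<^esub> coord 2 (xs ! i)) =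
      leibniz A \<mu> (map (coord 0) xs) (\<lambda>i. coord 1 (xs ! i)) \<oplus>\<^bsub>A\<^esub>
      leibniz A \<mu> (map (coord 0) xs) (\<lambda>i. coord 2 (xs ! i))"
    using \<mu> as by (intro leibniz_add) auto
  then show "coord 1 (act (semidirect 2 A) \<mu> xs) \<oplus>\<^bsub>A\<^esub> coord 2 (act (semidirect 2 A) \<mu> xs) =
      leibniz A \<mu> (map (coord 0) xs) (\<lambda>i. coord 1 (xs ! i) \<oplus>\<^bsub>A\<^esub> coord 2 (xs ! i))"
    by (simp add: coord_act[of 1 2] coord_act[of 2 2])
qed

lemma tan_z_hom: "(\<lambda>x. Tup [x, \<zero>\<^bsub>A\<^esub>]) \<in> alg_homs R P A (tan_T A)"
  by (intro tan_T_homI module_axioms alg_homs_id linear_zero) (simp add: leibniz_zero)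

lemma coord_1_hom_linear: "coord 1 \<in> linear_maps R (tan_T A) A"
  unfolding tan_T_def by (rule linear_coord) simp

lemma coord_0_hom_tan_T: "coord 0 \<in> alg_homs R P (tan_T A) A"
  unfolding tan_T_def by (rule coord_0_hom)

lemma coord_1_act: "coord 1 (act (tan_T A) \<mu> xs) = leibniz A \<mu> (map (coord 0) xs) (\<lambda>i. coord 1 (xs ! i))"
  unfolding tan_T_def by (rule coord_act) auto

lemma coord_0_act: "coord 0 (act (tan_T A) \<mu> xs) = act A \<mu> (map (coord 0) xs)"
  unfolding tan_T_def by (rule coord_act_0)

lemma tan_n_hom: "(\<lambda>x. Tup [coord 0 x, \<ominus>\<^bsub>A\<^esub> coord 1 x]) \<in> alg_homs R P (tan_T A) (tan_T A)"
proof (rule tan_T_homI[OF module_tan_T coord_0_hom_tan_T])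
  show "(\<lambda>x. \<ominus>\<^bsub>A\<^esub> coord 1 x) \<in> linear_maps R (tan_T A) A"
    using linear_maps_comp[OF coord_1_hom_linear linear_minus] .
  fix \<mu> xs assume \<mu>: "\<mu> \<in> carrier (ops P (length xs))" and xs: "set xs \<subseteq> carrier (tan_T A)"
  then have "leibniz A \<mu> (map (coord 0) xs) (\<lambda>i. \<ominus>\<^bsub>A\<^esub> coord 1 (xs ! i)) =
      \<ominus>\<^bsub>A\<^esub> leibniz A \<mu> (map (coord 0) xs) (\<lambda>i. coord 1 (xs ! i))"
    using coord_list_closed[of xs 1, folded tan_T_def] by (intro leibniz_minus) simp_all
  then show "\<ominus>\<^bsub>A\<^esub> coord 1 (act (tan_T A) \<mu> xs) =
      leibniz A \<mu> (map (coord 0) xs) (\<lambda>i. \<ominus>\<^bsub>A\<^esub> coord 1 (xs ! i))"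
    by (simp add: coord_1_act)
qed

lemma tan_Tm_hom:
  assumes "universe_algebra R P X" and f: "f \<in> alg_homs R P X A"
  shows "(\<lambda>x. Tup [f (coord 0 x), f (coord 1 x)]) \<in> alg_homs R P (tan_T X) (tan_T A)"
proof -
  interpret X: universe_algebra R P X by fact
  show ?thesis
  proof (rule tan_T_homI[OF X.module_tan_T])
    show "(\<lambda>x. f (coord 0 x)) \<in> alg_homs R P (tan_T X) A"
      using alg_homs_comp[OF X.coord_0_hom_tan_T f] .
    show "(\<lambda>x. f (coord 1 x)) \<in> linear_maps R (tan_T X) A"
      using linear_maps_comp[OF X.coord_1_hom_linear alg_homs_linear[OF f]] .
    fix \<mu> xs assume \<mu>: "\<mu> \<in> carrier (ops P (length xs))" and xs: "set xs \<subseteq> carrier (tan_T X)"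
    then have "f (leibniz X \<mu> (map (coord 0) xs) (\<lambda>i. coord 1 (xs ! i))) =
        leibniz A \<mu> (map f (map (coord 0) xs)) (\<lambda>i. f (coord 1 (xs ! i)))"
      using X.coord_list_closed[of xs 1] 
      by (intro alg_homs_leibniz[OF X.op_algebra_axioms op_algebra_axioms f]) (simp_all add: tan_T_def)
    then show "f (coord 1 (act (tan_T X) \<mu> xs)) =
        leibniz A \<mu> (map (\<lambda>x. f (coord 0 x)) xs) (\<lambda>i. f (coord 1 (xs ! i)))"
      by (simp add: X.coord_1_act comp_def)
  qed
qed

lemma coord_0_leibniz:
  assumes \<mu>: "\<mu> \<in> carrier (ops P (length xs))" and xs: "set xs \<subseteq> carrier (tan_T A)"
    and y: "\<And>i. i < length xs \<Longrightarrow> y i \<in> carrier (tan_T A)"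
  shows "coord 0 (leibniz (tan_T A) \<mu> xs y) = leibniz A \<mu> (map (coord 0) xs) (\<lambda>i. coord 0 (y i))"
proof -
  interpret T: universe_algebra R P "tan_T A" by (rule algebra_tan_T)
  show ?thesis
    using assms
    by (intro alg_homs_leibniz[OF T.op_algebra_axioms op_algebra_axioms
        coord_0_hom_tan_T])
qed

text \<open>The second derivative, at points \<open>((a, b), (c, d))\<close> of the double tangent
  algebra. The outer sum puts \<open>y i\<close> at place \<open>i\<close>, with base point
  \<open>c i\<close>. The inner sum then replaces place \<open>k\<close> by the tangent part found
  there: \<open>d i\<close> if \<open>k = i\<close>, overwriting \<open>c i\<close>, and
  \<open>b k\<close> otherwise. The four families are parameters so that the flip can exchange
  \<open>b\<close> and \<open>c\<close>.\<close>

lemma coord_1_leibniz: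
  assumes \<mu>: "\<mu> \<in> carrier (ops P (length xs))" and xs: "set xs \<subseteq> carrier (tan_T A)"
    and y: "\<And>i. i < length xs \<Longrightarrow> y i \<in> carrier (tan_T A)"
    and a: "as = map (coord 0) xs" and b: "\<And>i. i < length xs \<Longrightarrow> b i = coord 1 (xs ! i)"
    and c: "\<And>i. i < length xs \<Longrightarrow> c i = coord 0 (y i)"
    and d: "\<And>i. i < length xs \<Longrightarrow> d i = coord 1 (y i)"
  shows "coord 1 (leibniz (tan_T A) \<mu> xs y) = (\<Oplus>\<^bsub>A\<^esub>i \<in> {..<length xs}. \<Oplus>\<^bsub>A\<^esub>k \<in> {..<length xs}.
    act A \<mu> (as[i := c i, k := if k = i then d i else b k]))"
proof -
  interpret T: universe_algebra R P "tan_T A" by (rule algebra_tan_T)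
  have upd: "set (xs[i := y i]) \<subseteq> carrier (tan_T A)" if "i < length xs" for i
    using xs y that by (intro set_list_update_subset) auto
  note xs' = coord_list_closed[of _ 1, folded tan_T_def]
  have closed: "act A \<mu> (as[i := c i, k := if k = i then d i else b k]) \<in> carrier A"
    if "i < length xs" "k < length xs" for i k
    using that \<mu> coord_tan_T_closed[OF y] xs'[OF xs]
    by (intro act_update_closed set_list_update_subset) (auto simp: a b c d)
  have "coord 1 (leibniz (tan_T A) \<mu> xs y) =
      (\<Oplus>\<^bsub>A\<^esub>i \<in> {..<length xs}. coord 1 (act (tan_T A) \<mu> (xs[i := y i])))"
    unfolding leibniz_def[of "tan_T A"] using \<mu> upd
    by (intro linear_maps_finsum[OF module_tan_T module_axioms coord_1_hom_linear] Pi_I T.act_closed) auto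
  also have "\<dots> = (\<Oplus>\<^bsub>A\<^esub>i \<in> {..<length xs}. \<Oplus>\<^bsub>A\<^esub>k \<in> {..<length xs}.
    act A \<mu> (as[i := c i, k := if k = i then d i else b k]))"
  proof (rule M.finsum_cong')
    show "coord 1 (act (tan_T A) \<mu> (xs[i := y i])) = (\<Oplus>\<^bsub>A\<^esub>k \<in> {..<length xs}.
      act A \<mu> (as[i := c i, k := if k = i then d i else b k]))"
      if "i \<in> {..<length xs}" for i
      unfolding coord_1_act leibniz_def using that closed
      by (intro M.finsum_cong') (auto simp: map_update nth_list_update a b c d)
  qed (use closed in \<open>auto intro!: M.finsum_closed\<close>)
  finally show ?thesis .
qed

text \<open>In the double sum of \<open>coord_1_leibniz\<close> the families \<open>b\<close> and
  \<open>c\<close> are zero here. A term with \<open>k \<noteq> i\<close> has a zero argument and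
  vanishes by multilinearity; on the diagonal the zero at \<open>i\<close> is overwritten, which
  leaves the first derivative.\<close>

lemma tan_l_hom:
  "(\<lambda>x. Tup [Tup [coord 0 x, \<zero>\<^bsub>A\<^esub>], Tup [\<zero>\<^bsub>A\<^esub>, coord 1 x]]) \<in> alg_homs R P (tan_T A) (tan_T (tan_T A))"
proof -
  interpret T: universe_algebra R P "tan_T A" by (rule algebra_tan_T)
  show ?thesis
  proof (rule T.tan_T_homI[OF module_tan_T])
    show "(\<lambda>x. Tup [coord 0 x, \<zero>\<^bsub>A\<^esub>]) \<in> alg_homs R P (tan_T A) (tan_T A)"
      using alg_homs_comp[OF coord_0_hom_tan_T tan_z_hom] .
    show h: "(\<lambda>x. Tup [\<zero>\<^bsub>A\<^esub>, coord 1 x]) \<in> linear_maps R (tan_T A) (tan_T A)"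
      unfolding tan_T_def
    proof (rule linear_maps_semidirectI[OF module_semidirect])
      show "(\<lambda>x. coord j (Tup [\<zero>\<^bsub>A\<^esub>, coord 1 x])) \<in> linear_maps R (semidirect 1 A) A" if j: "j \<le> 1" for j
        using that linear_coord[of 1 1] by (cases j) (auto intro: linear_zero module_axioms)
    qed (auto simp: in_semidirect_iff)
    fix \<mu> xs assume \<mu>: "\<mu> \<in> carrier (ops P (length xs))" and xs: "set xs \<subseteq> carrier (tan_T A)"
    let ?as = "map (coord 0) xs"
    let ?g = "\<lambda>x. Tup [coord 0 x, \<zero>\<^bsub>A\<^esub>]" and ?h = "\<lambda>x. Tup [\<zero>\<^bsub>A\<^esub>, coord 1 x]"
    have as: "set ?as \<subseteq> carrier A" "\<And>i. i < length xs \<Longrightarrow> coord 1 (xs ! i) \<in> carrier A"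
      using coord_list_closed[of xs 1] xs by (simp_all add: tan_T_def)
    have g: "set (map ?g xs) \<subseteq> carrier (tan_T A)" and hx: "\<And>i. i < length xs \<Longrightarrow> ?h (xs ! i) \<in> carrier (tan_T A)"
      using as by (auto simp: in_tan_T_iff)
    have inner: "(\<Oplus>\<^bsub>A\<^esub>k \<in> {..<length xs}.
        act A \<mu> (?as[i := \<zero>\<^bsub>A\<^esub>, k := if k = i then coord 1 (xs ! i) else \<zero>\<^bsub>A\<^esub>])) =
      act A \<mu> (?as[i := coord 1 (xs ! i)])" if i: "i < length xs" for i
    proof -
      have as0: "set (?as[i := \<zero>\<^bsub>A\<^esub>]) \<subseteq> carrier A"
        using as(1) by (intro set_list_update_subset) auto
      have "(\<Oplus>\<^bsub>A\<^esub>k \<in> {..<length xs}.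
          act A \<mu> (?as[i := \<zero>\<^bsub>A\<^esub>, k := if k = i then coord 1 (xs ! i) else \<zero>\<^bsub>A\<^esub>])) =
        act A \<mu> (?as[i := \<zero>\<^bsub>A\<^esub>, i := if i = i then coord 1 (xs ! i) else \<zero>\<^bsub>A\<^esub>])"
        using i \<mu> as as0 by (intro M.finsum_eq_single) (auto simp: act_update_zero act_update_closed)
      then show ?thesis
        by simp
    qed
    show "Tup [\<zero>\<^bsub>A\<^esub>, coord 1 (act (tan_T A) \<mu> xs)] =
        leibniz (tan_T A) \<mu> (map ?g xs) (\<lambda>i. ?h (xs ! i))"
    proof (rule tan_T_eqI)
      show "Tup [\<zero>\<^bsub>A\<^esub>, coord 1 (act (tan_T A) \<mu> xs)] \<in> carrier (tan_T A)"
        using linear_maps_closed[OF h T.act_closed[OF \<mu> xs]] .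
      show "leibniz (tan_T A) \<mu> (map ?g xs) (\<lambda>i. ?h (xs ! i)) \<in> carrier (tan_T A)"
        using \<mu> g hx by (intro T.leibniz_closed) simp_all
      show "coord 0 (Tup [\<zero>\<^bsub>A\<^esub>, coord 1 (act (tan_T A) \<mu> xs)]) =
          coord 0 (leibniz (tan_T A) \<mu> (map ?g xs) (\<lambda>i. ?h (xs ! i)))"
        using \<mu> g hx as leibniz_zero[of \<mu> ?as] by (subst coord_0_leibniz) (simp_all add: comp_def)
      have "coord 1 (leibniz (tan_T A) \<mu> (map ?g xs) (\<lambda>i. ?h (xs ! i))) =
        (\<Oplus>\<^bsub>A\<^esub>i \<in> {..<length xs}. \<Oplus>\<^bsub>A\<^esub>k \<in> {..<length xs}.
          act A \<mu> (?as[i := \<zero>\<^bsub>A\<^esub>, k := if k = i then coord 1 (xs ! i) else \<zero>\<^bsub>A\<^esub>]))"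
        using coord_1_leibniz[of \<mu> "map ?g xs" "\<lambda>i. ?h (xs ! i)" ?as "\<lambda>_. \<zero>\<^bsub>A\<^esub>" "\<lambda>_. \<zero>\<^bsub>A\<^esub>"
            "\<lambda>i. coord 1 (xs ! i)"] \<mu> g hx by (simp add: comp_def)
      also have "\<dots> = leibniz A \<mu> ?as (\<lambda>i. coord 1 (xs ! i))"
        unfolding leibniz_def using inner \<mu> as by (intro M.finsum_cong') (auto simp: act_update_closed)
      finally show "coord 1 (Tup [\<zero>\<^bsub>A\<^esub>, coord 1 (act (tan_T A) \<mu> xs)]) =
          coord 1 (leibniz (tan_T A) \<mu> (map ?g xs) (\<lambda>i. ?h (xs ! i)))"
        using coord_1_act by simp
    qed
  qed
qed

text \<open>
  The second derivative of \<open>\<mu>\<close> is symmetric: exchanging the two directions of differentiation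
  transposes the double Leibniz sum, up to swapping updates at distinct positions.
\<close>

lemma tan_c_hom:
  "(\<lambda>x. Tup [Tup [coord 0 (coord 0 x), coord 0 (coord 1 x)], Tup [coord 1 (coord 0 x), coord 1 (coord 1 x)]])
    \<in> alg_homs R P (tan_T (tan_T A)) (tan_T (tan_T A))"
proof -
  interpret T: universe_algebra R P "tan_T A" by (rule algebra_tan_T)
  interpret TT: universe_algebra R P "tan_T (tan_T A)" by (rule T.algebra_tan_T)
  let ?g = "\<lambda>x. Tup [coord 0 (coord 0 x), coord 0 (coord 1 x)]"
  let ?h = "\<lambda>x. Tup [coord 1 (coord 0 x), coord 1 (coord 1 x)]"
  show ?thesis
  proof (rule T.tan_T_homI[OF T.module_tan_T])
    \<comment> \<open>This component is the functor applied to the projection \<open>coord 0\<close>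
      of the tangent algebra of \<open>A\<close>.\<close>
    show g: "?g \<in> alg_homs R P (tan_T (tan_T A)) (tan_T A)"
      using tan_Tm_hom[OF algebra_tan_T coord_0_hom_tan_T] .
    show h: "?h \<in> linear_maps R (tan_T (tan_T A)) (tan_T A)"
      \<comment> \<open>Only the innermost \<open>tan_T\<close> is unfolded: the target then has the
        form required by \<open>linear_maps_semidirectI\<close>, while the source stays a tangent
        algebra.\<close>
      unfolding tan_T_def[of A]
    proof (rule linear_maps_semidirectI)
      show "module R (tan_T (semidirect 1 A))"
        using T.module_tan_T by (simp add: tan_T_def)
      show "(\<lambda>x. coord j (Tup [coord 1 (coord 0 x), coord 1 (coord 1 x)])) \<in>
          linear_maps R (tan_T (semidirect 1 A)) A" if j: "j \<le> 1" for j
      proof -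
        consider "j = 0" | "j = 1"
          using j by linarith
        then show ?thesis
          using linear_maps_comp[OF alg_homs_linear[OF T.coord_0_hom_tan_T] coord_1_hom_linear]
            linear_maps_comp[OF T.coord_1_hom_linear coord_1_hom_linear]
          by cases (simp_all add: tan_T_def)
      qed
      show "Tup [coord 1 (coord 0 x), coord 1 (coord 1 x)] \<in> carrier (semidirect 1 A)"
        if "x \<in> carrier (tan_T (semidirect 1 A))" for x
        using that by (auto simp: in_tan_T_iff tan_T_def[symmetric])
    qed
    fix \<mu> xs assume \<mu>: "\<mu> \<in> carrier (ops P (length xs))" and xs: "set xs \<subseteq> carrier (tan_T (tan_T A))"
    have x: "xs ! i \<in> carrier (tan_T (tan_T A))" if "i < length xs" for i
      using xs that by auto
    have closed: "coord 0 (xs ! i) \<in> carrier (tan_T A)" "coord 1 (xs ! i) \<in> carrier (tan_T A)"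
      "?g (xs ! i) \<in> carrier (tan_T A)" "?h (xs ! i) \<in> carrier (tan_T A)" if "i < length xs" for i
      using x[OF that] coord_tan_T_closed alg_homs_closed[OF g] linear_maps_closed[OF h] by blast+
    have lists: "set (map (coord 0) xs) \<subseteq> carrier (tan_T A)" "set (map ?g xs) \<subseteq> carrier (tan_T A)"
      using closed by (auto simp: in_set_conv_nth simp del: set_map)
    let ?as = "map (\<lambda>x. coord 0 (coord 0 x)) xs"
    let ?b = "\<lambda>i. coord 1 (coord 0 (xs ! i))" and ?c = "\<lambda>i. coord 0 (coord 1 (xs ! i))"
      and ?d = "\<lambda>i. coord 1 (coord 1 (xs ! i))"
    have entries: "set ?as \<subseteq> carrier A" "\<And>i. i < length xs \<Longrightarrow> ?b i \<in> carrier A"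
      "\<And>i. i < length xs \<Longrightarrow> ?c i \<in> carrier A" "\<And>i. i < length xs \<Longrightarrow> ?d i \<in> carrier A"
      using closed(1,2)[THEN coord_tan_T_closed(1)] closed(1,2)[THEN coord_tan_T_closed(2)]
      by (auto simp: in_set_conv_nth simp del: set_map)
    have term_closed: "act A \<mu> (?as[i := u, k := v]) \<in> carrier A"
      if "u \<in> carrier A" "v \<in> carrier A" for i k u v
      using that \<mu> entries(1) by (intro act_update_closed set_list_update_subset) auto
    show "?h (act (tan_T (tan_T A)) \<mu> xs) = leibniz (tan_T A) \<mu> (map ?g xs) (\<lambda>i. ?h (xs ! i))"
    proof (rule tan_T_eqI)
      show "?h (act (tan_T (tan_T A)) \<mu> xs) \<in> carrier (tan_T A)"
        using linear_maps_closed[OF h TT.act_closed[OF \<mu> xs]] .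
      show "leibniz (tan_T A) \<mu> (map ?g xs) (\<lambda>i. ?h (xs ! i)) \<in> carrier (tan_T A)"
        using \<mu> lists closed by (intro T.leibniz_closed) simp_all
      show "coord 0 (?h (act (tan_T (tan_T A)) \<mu> xs)) =
          coord 0 (leibniz (tan_T A) \<mu> (map ?g xs) (\<lambda>i. ?h (xs ! i)))"
      proof -
        have "leibniz A \<mu> ?as (\<lambda>i. coord 1 (map (coord 0) xs ! i)) = leibniz A \<mu> ?as ?b"
          using \<mu> entries by (intro leibniz_cong) simp_all
        then show ?thesis
          using \<mu> lists closed
          by (subst coord_0_leibniz) (simp_all add: T.coord_0_act coord_1_act comp_def)
      qed
      have "coord 1 (?h (act (tan_T (tan_T A)) \<mu> xs)) =
          coord 1 (leibniz (tan_T A) \<mu> (map (coord 0) xs) (\<lambda>i. coord 1 (xs ! i)))"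
        by (simp add: T.coord_1_act)
      also have "\<dots> = (\<Oplus>\<^bsub>A\<^esub>i \<in> {..<length xs}. \<Oplus>\<^bsub>A\<^esub>k \<in> {..<length xs}.
          act A \<mu> (?as[i := ?c i, k := if k = i then ?d i else ?b k]))"
        using coord_1_leibniz[of \<mu> "map (coord 0) xs" "\<lambda>i. coord 1 (xs ! i)" ?as ?b ?c ?d]
          \<mu> lists closed by (simp add: comp_def)
      also have "\<dots> = (\<Oplus>\<^bsub>A\<^esub>k \<in> {..<length xs}. \<Oplus>\<^bsub>A\<^esub>i \<in> {..<length xs}.
          act A \<mu> (?as[i := ?c i, k := if k = i then ?d i else ?b k]))"
        using entries term_closed by (intro M.finsum_swap) auto
      \<comment> \<open>On the diagonal \<open>i = k\<close> the second update overwrites the first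
        on both sides, leaving \<open>?d k\<close>. The result is the sum with \<open>?b\<close> and
        \<open>?c\<close> exchanged.\<close>
      also have "\<dots> = (\<Oplus>\<^bsub>A\<^esub>k \<in> {..<length xs}. \<Oplus>\<^bsub>A\<^esub>i \<in> {..<length xs}.
          act A \<mu> (?as[k := ?b k, i := if i = k then ?d k else ?c i]))"
        using entries term_closed
        by (intro M.finsum_cong' refl) (auto simp: list_update_swap intro!: M.finsum_closed M.finsum_cong')
      also have "\<dots> = coord 1 (leibniz (tan_T A) \<mu> (map ?g xs) (\<lambda>i. ?h (xs ! i)))"
        using coord_1_leibniz[of \<mu> "map ?g xs" "\<lambda>i. ?h (xs ! i)" ?as ?c ?b ?d]
          \<mu> lists closed by (simp add: comp_def)
      finally show "coord 1 (?h (act (tan_T (tan_T A)) \<mu> xs)) =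
          coord 1 (leibniz (tan_T A) \<mu> (map ?g xs) (\<lambda>i. ?h (xs ! i)))" .
    qed
  qed
qed

end


section \<open>The category of algebras\<close>

lemma mk_arrow_simps [simp]:
  "src (mk_arrow A B f) = A"
  "tgt (mk_arrow A B f) = B"
  "x \<in> carrier A \<Longrightarrow> fn (mk_arrow A B f) x = f x"
  by (simp_all add: mk_arrow_def)

lemma mk_arrow_cong: "(\<And>x. x \<in> carrier A \<Longrightarrow> f x = g x) \<Longrightarrow> mk_arrow A B f = mk_arrow A B g"
  by (auto simp: mk_arrow_def intro: restrict_ext)

lemma ALG_simps [simp]:
  "Dom (ALG R P) = src"
  "Cod (ALG R P) = tgt"
  "src (Id (ALG R P) A) = A"
  "tgt (Id (ALG R P) A) = A"
  "x \<in> carrier A \<Longrightarrow> fn (Id (ALG R P) A) x = x"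
  "src (\<psi> \<cdot>\<^bsub>ALG R P\<^esub> \<phi>) = src \<phi>"
  "tgt (\<psi> \<cdot>\<^bsub>ALG R P\<^esub> \<phi>) = tgt \<psi>"
  "x \<in> carrier (src \<phi>) \<Longrightarrow> fn (\<psi> \<cdot>\<^bsub>ALG R P\<^esub> \<phi>) x = fn \<psi> (fn \<phi> x)"
  by (simp_all add: ALG_def)

lemma universe_algebra_imp:
  "universe_algebra R P A \<Longrightarrow> op_algebra R P A"
  by (simp add: universe_algebra_def)

context operad
begin

abbreviation comp_ALG (infixr \<open>\<cdot>\<^sub>P\<close> 75)
  where "\<psi> \<cdot>\<^sub>P \<phi> \<equiv> \<psi> \<cdot>\<^bsub>ALG R P\<^esub> \<phi>"

lemma Obj_ALG [simp]: "A \<in> Obj (ALG R P) \<longleftrightarrow> universe_algebra R P A"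
  by (simp add: ALG_def universe_algebra_def op_algebra_def operad_axioms)

lemma Hom_ALG_iff:
  "\<phi> \<in> Hom (ALG R P) A B \<longleftrightarrow> src \<phi> = A \<and> tgt \<phi> = B \<and> universe_algebra R P A \<and>
    universe_algebra R P B \<and> fn \<phi> \<in> alg_homs R P A B \<and> fn \<phi> \<in> extensional (carrier A)"
  by (auto simp: Hom_def ALG_def universe_algebra_def op_algebra_def operad_axioms)

lemma Hom_ALG_D:
  assumes "\<phi> \<in> Hom (ALG R P) A B"
  shows Hom_src: "src \<phi> = A" and Hom_tgt: "tgt \<phi> = B"
    and Hom_algebras: "universe_algebra R P A" "universe_algebra R P B"
    and Hom_fn: "fn \<phi> \<in> alg_homs R P A B"
    and Hom_fn_closed: "x \<in> carrier A \<Longrightarrow> fn \<phi> x \<in> carrier B"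
  using assms by (auto simp: Hom_ALG_iff alg_homs_closed)

lemma Arr_ALG_iff: "\<phi> \<in> Arr (ALG R P) \<longleftrightarrow> \<phi> \<in> Hom (ALG R P) (src \<phi>) (tgt \<phi>)"
  by (simp add: Hom_def)

lemma mk_arrow_Hom:
  assumes "universe_algebra R P A" and "universe_algebra R P B" and "f \<in> alg_homs R P A B"
  shows "mk_arrow A B f \<in> Hom (ALG R P) A B"
proof -
  interpret A: universe_algebra R P A by fact
  show ?thesis
    using assms A.alg_homs_cong[OF assms(3), of "restrict f (carrier A)"]
    by (simp add: Hom_ALG_iff) (simp add: mk_arrow_def)
qed

text \<open>Extensionality of arrows makes agreement on the source carrier suffice; this is what
  turns identities between composites into computations with elements.\<close>

lemma arrow_eqI:
  assumes "\<phi> \<in> Hom (ALG R P) A B" and "\<psi> \<in> Hom (ALG R P) A B"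
    and "\<And>x. x \<in> carrier A \<Longrightarrow> fn \<phi> x = fn \<psi> x"
  shows "\<phi> = \<psi>"
proof -
  have "fn \<phi> = fn \<psi>"
    using assms by (intro extensionalityI[of _ "carrier A"]) (auto simp: Hom_ALG_iff)
  then show ?thesis
    using assms(1,2) by (intro alg_arrow.equality) (auto simp: Hom_ALG_iff)
qed

lemma arrow_eqD: "\<lbrakk>\<psi> \<cdot>\<^sub>P \<phi> = \<psi>' \<cdot>\<^sub>P \<phi>'; x \<in> carrier (src \<phi>); src \<phi>' = src \<phi>\<rbrakk> \<Longrightarrow>
    fn \<psi> (fn \<phi> x) = fn \<psi>' (fn \<phi>' x)"
  using ALG_simps(8)[of x \<phi> R P \<psi>] ALG_simps(8)[of x \<phi>' R P \<psi>'] by simp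

lemma Comp_ALG: "\<psi> \<cdot>\<^sub>P \<phi> = mk_arrow (src \<phi>) (tgt \<psi>) (\<lambda>a. fn \<psi> (fn \<phi> a))"
  by (simp add: ALG_def)

lemma Comp_ALG_Hom:
  assumes f: "f \<in> Hom (ALG R P) A B" and g: "g \<in> Hom (ALG R P) B D"
  shows "g \<cdot>\<^sub>P f \<in> Hom (ALG R P) A D"
  using mk_arrow_Hom[OF Hom_algebras(1)[OF f] Hom_algebras(2)[OF g]
      alg_homs_comp[OF Hom_fn[OF f] Hom_fn[OF g]]]
  by (simp add: Comp_ALG Hom_src[OF f] Hom_tgt[OF g])

lemma Id_ALG_Hom: "universe_algebra R P A \<Longrightarrow> Id (ALG R P) A \<in> Hom (ALG R P) A A"
  by (simp add: ALG_def mk_arrow_Hom[unfolded ALG_def] alg_homs_id)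

lemma category_ALG: "category (ALG R P)"
proof
  show "Dom (ALG R P) f \<in> Obj (ALG R P)" "Cod (ALG R P) f \<in> Obj (ALG R P)"
    if "f \<in> Arr (ALG R P)" for f
    using that by (auto simp: Arr_ALG_iff Hom_ALG_iff)
  show "Id (ALG R P) A \<in> Hom (ALG R P) A A" if "A \<in> Obj (ALG R P)" for A
    using that Id_ALG_Hom by simp
  show "g \<cdot>\<^sub>P f \<in> Hom (ALG R P) A D"
    if "f \<in> Hom (ALG R P) A B" "g \<in> Hom (ALG R P) B D" for f g A B D
    using that by (rule Comp_ALG_Hom)
  show "f \<cdot>\<^sub>P Id (ALG R P) A = f" if f: "f \<in> Hom (ALG R P) A B" for f A B
    using Comp_ALG_Hom[OF Id_ALG_Hom[OF Hom_algebras(1)[OF f]] f] f by (rule arrow_eqI) simp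
  show "Id (ALG R P) B \<cdot>\<^sub>P f = f" if f: "f \<in> Hom (ALG R P) A B" for f A B
    using Comp_ALG_Hom[OF f Id_ALG_Hom[OF Hom_algebras(2)[OF f]]] f
    by (rule arrow_eqI) (simp add: Hom_fn_closed[OF f] Hom_src[OF f])
  show "(h \<cdot>\<^sub>P g) \<cdot>\<^sub>P f = h \<cdot>\<^sub>P g \<cdot>\<^sub>P f"
    if f: "f \<in> Hom (ALG R P) A B" and g: "g \<in> Hom (ALG R P) B D" and h: "h \<in> Hom (ALG R P) D E"
    for f g h A B D E
    using Comp_ALG_Hom[OF f Comp_ALG_Hom[OF g h]] Comp_ALG_Hom[OF Comp_ALG_Hom[OF f g] h]
    by (rule arrow_eqI) (simp add: Hom_fn_closed[OF f] Hom_src[OF f] Hom_src[OF g])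
qed

text \<open>Covers products, pullbacks and equalizers at once; for an equalizer, \<open>I\<close> is a singleton.\<close>

lemma joint_lift:
  assumes X: "universe_algebra R P X" and Q: "universe_algebra R P Q"
    and q: "\<And>i. i \<in> I \<Longrightarrow> q i \<in> Hom (ALG R P) Q (E i)"
    and f: "\<And>i. i \<in> I \<Longrightarrow> f i \<in> Hom (ALG R P) X (E i)"
    and inj: "\<And>x y. \<lbrakk>x \<in> carrier Q; y \<in> carrier Q; \<And>i. i \<in> I \<Longrightarrow> fn (q i) x = fn (q i) y\<rbrakk> \<Longrightarrow> x = y"
    and ex: "\<And>x. x \<in> carrier X \<Longrightarrow> \<exists>w \<in> carrier Q. \<forall>i \<in> I. fn (q i) w = fn (f i) x"
  shows "\<exists>!h. h \<in> Hom (ALG R P) X Q \<and> (\<forall>i \<in> I. q i \<cdot>\<^sub>P h = f i)"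
proof -
  \<comment> \<open>By \<open>inj\<close> the preimage is unique, so the choice is harmless. That
    \<open>h\<close> is a morphism is read off its composites with the \<open>q i\<close>, which are
    the given arrows.\<close>
  define h where "h x = (SOME w. w \<in> carrier Q \<and> (\<forall>i \<in> I. fn (q i) w = fn (f i) x))" for x
  have h: "h x \<in> carrier Q" "\<And>i. i \<in> I \<Longrightarrow> fn (q i) (h x) = fn (f i) x" if "x \<in> carrier X" for x
    using someI_ex[of "\<lambda>w. w \<in> carrier Q \<and> (\<forall>i \<in> I. fn (q i) w = fn (f i) x)"] ex[OF that]
    unfolding h_def by blast+
  interpret X: universe_algebra R P X by fact
  have "h \<in> alg_homs R P X Q"
  proof (rule alg_homs_by_components[where I = I and \<pi> = "\<lambda>i. fn (q i)" and A = E])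
    show "(\<lambda>x. fn (q i) (h x)) \<in> alg_homs R P X (E i)" if "i \<in> I" for i
      by (rule X.alg_homs_cong[OF Hom_fn[OF f[OF that]]]) (rule h(2)[OF _ that])
    show "x = y" if "x \<in> carrier Q" "y \<in> carrier Q" "\<And>i. i \<in> I \<Longrightarrow> fn (q i) x = fn (q i) y" for x y
      using that by (rule inj)
  qed (use X Q h(1) Hom_fn[OF q] in \<open>simp_all add: universe_algebra_imp\<close>)
  then have hom: "mk_arrow X Q h \<in> Hom (ALG R P) X Q"
    using X Q by (intro mk_arrow_Hom)
  show ?thesis
  proof (rule ex1I[of _ "mk_arrow X Q h"])
    have "q i \<cdot>\<^sub>P mk_arrow X Q h = f i" if "i \<in> I" for i
      using Comp_ALG_Hom[OF hom q[OF that]] f[OF that] by (rule arrow_eqI) (simp add: h that)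
    then show "mk_arrow X Q h \<in> Hom (ALG R P) X Q \<and> (\<forall>i \<in> I. q i \<cdot>\<^sub>P mk_arrow X Q h = f i)"
      using hom by blast
    fix k assume k: "k \<in> Hom (ALG R P) X Q \<and> (\<forall>i \<in> I. q i \<cdot>\<^sub>P k = f i)"
    then have k: "k \<in> Hom (ALG R P) X Q" "\<And>i. i \<in> I \<Longrightarrow> q i \<cdot>\<^sub>P k = f i"
      by auto
    show "k = mk_arrow X Q h"
    proof (rule arrow_eqI[OF k(1) hom])
      fix x assume x: "x \<in> carrier X"
      have "fn k x = h x"
      proof (rule inj)
        show "fn (q i) (fn k x) = fn (q i) (h x)" if i: "i \<in> I" for i
          using arg_cong[OF k(2)[OF i], of "\<lambda>g. fn g x"] x h(2)[OF x i] by (simp add: Hom_src[OF k(1)])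
      qed (use x h(1) Hom_fn_closed[OF k(1)] in blast)+
      then show "fn k x = fn (mk_arrow X Q h) x"
        using x by simp
    qed
  qed
qed


text \<open>
  \<open>K\<close> says which families of elements are compatible: none of the constraints for a product, equality
  in the base for a pullback.
\<close>

definition limit_cone ::
    "'i set \<Rightarrow> ('i \<Rightarrow> ('r, 'b universe, 'p) alg_arrow) \<Rightarrow> ('r, 'b universe, 'p) alg_data \<Rightarrow>
      ('i \<Rightarrow> ('r, 'b universe, 'p) alg_data) \<Rightarrow> (('i \<Rightarrow> 'b universe) \<Rightarrow> bool) \<Rightarrow> bool"
  where "limit_cone I q Q E K \<longleftrightarrow>
    universe_algebra R P Q \<and> (\<forall>i \<in> I. q i \<in> Hom (ALG R P) Q (E i)) \<and>
    (\<forall>x \<in> carrier Q. \<forall>y \<in> carrier Q. (\<forall>i \<in> I. fn (q i) x = fn (q i) y) \<longrightarrow> x = y) \<and>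
    (\<forall>e. (\<forall>i \<in> I. e i \<in> carrier (E i)) \<and> K e \<longrightarrow> (\<exists>x \<in> carrier Q. \<forall>i \<in> I. fn (q i) x = e i))"

lemma limit_coneD:
  assumes "limit_cone I q Q E K"
  shows "universe_algebra R P Q"
    and "i \<in> I \<Longrightarrow> q i \<in> Hom (ALG R P) Q (E i)"
    and "\<lbrakk>x \<in> carrier Q; y \<in> carrier Q; \<And>i. i \<in> I \<Longrightarrow> fn (q i) x = fn (q i) y\<rbrakk> \<Longrightarrow> x = y"
    and "\<lbrakk>\<And>i. i \<in> I \<Longrightarrow> e i \<in> carrier (E i); K e\<rbrakk> \<Longrightarrow>
      \<exists>x \<in> carrier Q. \<forall>i \<in> I. fn (q i) x = e i"
  using assms unfolding limit_cone_def by blast+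

lemma limit_cone_lift:
  assumes cone: "limit_cone I q Q E K" and X: "universe_algebra R P X"
    and f: "\<And>i. i \<in> I \<Longrightarrow> f i \<in> Hom (ALG R P) X (E i)"
    and K: "\<And>x. x \<in> carrier X \<Longrightarrow> K (\<lambda>i. fn (f i) x)"
  shows "\<exists>!h. h \<in> Hom (ALG R P) X Q \<and> (\<forall>i \<in> I. q i \<cdot>\<^sub>P h = f i)"
proof (rule joint_lift[OF X limit_coneD(1,2)[OF cone] f limit_coneD(3)[OF cone]])
  fix x assume x: "x \<in> carrier X"
  show "\<exists>w \<in> carrier Q. \<forall>i \<in> I. fn (q i) w = fn (f i) x"
    by (rule limit_coneD(4)[OF cone]) (rule Hom_fn_closed[OF f x] K[OF x], assumption?)+
qed


subsection \<open>Pullbacks\<close>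

text \<open>An elementwise condition that implies \<open>is_nfold_pullback\<close> and, unlike it,
  is visibly stable under the functor.\<close>

definition concrete_pullback ::
    "nat \<Rightarrow> ('r, 'b universe, 'p) alg_arrow \<Rightarrow> ('r, 'b universe, 'p) alg_data \<Rightarrow>
      (nat \<Rightarrow> ('r, 'b universe, 'p) alg_arrow) \<Rightarrow> bool"
  where "concrete_pullback n p Q q \<longleftrightarrow>
    p \<in> Arr (ALG R P) \<and> (\<forall>j \<in> {1..n}. \<forall>k \<in> {1..n}. p \<cdot>\<^sub>P q j = p \<cdot>\<^sub>P q k) \<and>
    limit_cone {1..n} q Q (\<lambda>_. src p) (\<lambda>e. \<forall>j \<in> {1..n}. \<forall>k \<in> {1..n}. fn p (e j) = fn p (e k))"

lemma concrete_pullback_imp_nfold_pullback: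
  fixes p :: "('r, 'b universe, 'p) alg_arrow"
  assumes "concrete_pullback n p Q q"
  shows "is_nfold_pullback (ALG R P) n p Q q"
  unfolding is_nfold_pullback_def ALG_simps
proof (intro conjI ballI allI impI)
  have cone: "limit_cone {1..n} q Q (\<lambda>_. src p)
      (\<lambda>e. \<forall>j \<in> {1..n}. \<forall>k \<in> {1..n}. fn p (e j) = fn p (e k))"
    using assms by (simp only: concrete_pullback_def)
  show "Q \<in> Obj (ALG R P)" "\<And>j. j \<in> {1..n} \<Longrightarrow> q j \<in> Hom (ALG R P) Q (src p)"
    using limit_coneD(1,2)[OF cone] by (simp_all only: Obj_ALG)
  fix X and f :: "nat \<Rightarrow> ('r, 'b universe, 'p) alg_arrow"
  assume X: "X \<in> Obj (ALG R P)"
    and f: "(\<forall>j \<in> {1..n}. f j \<in> Hom (ALG R P) X (src p)) \<and>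
      (\<forall>j \<in> {1..n}. \<forall>k \<in> {1..n}. p \<cdot>\<^sub>P f j = p \<cdot>\<^sub>P f k)"
  show "\<exists>!h. h \<in> Hom (ALG R P) X Q \<and> (\<forall>j \<in> {1..n}. q j \<cdot>\<^sub>P h = f j)"
  proof (rule limit_cone_lift[OF cone X[unfolded Obj_ALG]])
    show fj: "f j \<in> Hom (ALG R P) X (src p)" if "j \<in> {1..n}" for j
      using f that by blast
    show "\<forall>j \<in> {1..n}. \<forall>k \<in> {1..n}. fn p (fn (f j) x) = fn p (fn (f k) x)" if x: "x \<in> carrier X" for x
    proof (intro ballI)
      fix j k assume jk: "j \<in> {1..n}" "k \<in> {1..n}"
      with f have "p \<cdot>\<^sub>P f j = p \<cdot>\<^sub>P f k"
        by blast
      from arrow_eqD[OF this, of x] x show "fn p (fn (f j) x) = fn p (fn (f k) x)"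
        by (simp add: Hom_src[OF fj[OF jk(1)]] Hom_src[OF fj[OF jk(2)]])
    qed
  qed
qed (use assms in \<open>simp add: concrete_pullback_def\<close>, use assms in \<open>unfold concrete_pullback_def, blast\<close>)


subsection \<open>Products\<close>

text \<open>All factors have carriers in one type of nested tuples, so tuples with entries in
  different factors need no new type. The empty list gives the one-element algebra on
  \<open>Tup []\<close>, the terminal object.\<close>

definition product_algebra ::
    "('r, 'b universe, 'p) alg_data list \<Rightarrow> ('r, 'b universe, 'p) alg_data"
  where "product_algebra As =
    \<lparr>carrier = {Tup xs | xs. length xs = length As \<and> (\<forall>i < length As. xs ! i \<in> carrier (As ! i))},
     monoid.mult = undefined, one = undefined,
     zero = Tup (map zero As),
     add = (\<lambda>x y. Tup (map (\<lambda>i. coord i x \<oplus>\<^bsub>As ! i\<^esub> coord i y) [0..<length As])),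
     smult = (\<lambda>r x. Tup (map (\<lambda>i. r \<odot>\<^bsub>As ! i\<^esub> coord i x) [0..<length As])),
     act = (\<lambda>\<mu> xs. Tup (map (\<lambda>i. act (As ! i) \<mu> (map (coord i) xs)) [0..<length As]))\<rparr>"

lemma in_product_algebra_iff:
  "x \<in> carrier (product_algebra As) \<longleftrightarrow>
    (\<exists>xs. x = Tup xs \<and> length xs = length As \<and> (\<forall>i < length As. xs ! i \<in> carrier (As ! i)))"
  by (auto simp: product_algebra_def)

lemma coord_product_algebra:
  assumes "i < length As"
  shows "x \<in> carrier (product_algebra As) \<Longrightarrow> coord i x \<in> carrier (As ! i)"
    and "coord i \<zero>\<^bsub>product_algebra As\<^esub> = \<zero>\<^bsub>As ! i\<^esub>"
    and "coord i (x \<oplus>\<^bsub>product_algebra As\<^esub> y) = coord i x \<oplus>\<^bsub>As ! i\<^esub> coord i y"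
    and "coord i (r \<odot>\<^bsub>product_algebra As\<^esub> x) = r \<odot>\<^bsub>As ! i\<^esub> coord i x"
    and "coord i (act (product_algebra As) \<mu> xs) = act (As ! i) \<mu> (map (coord i) xs)"
  using assms by (auto simp: product_algebra_def)

lemma product_algebra_eqI:
  assumes "x \<in> carrier (product_algebra As)" and "y \<in> carrier (product_algebra As)"
    and "\<And>i. i < length As \<Longrightarrow> coord i x = coord i y"
  shows "x = y"
  using assms by (auto simp: in_product_algebra_iff intro!: nth_equalityI)

lemma algebra_product_algebra:
  fixes As :: "('r, 'b universe, 'p) alg_data list"
  assumes "\<And>A. A \<in> set As \<Longrightarrow> universe_algebra R P A"
  shows "universe_algebra R P (product_algebra As)"
proof -
  have A: "universe_algebra R P (As ! i)" if "i < length As" for i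
    using assms that by simp
  have mod: "module R (As ! i)" if "i < length As" for i
  proof -
    interpret universe_algebra R P "As ! i" by (rule A[OF that])
    show ?thesis by (rule module_axioms)
  qed
  note am = abelian_group.axioms(1)[OF module.axioms(2)[OF mod]]
  have "module R (product_algebra As)"
  proof (rule module_by_components[where I = "{..<length As}" and M = "\<lambda>i. As ! i" and \<pi> = coord])
    show "\<zero>\<^bsub>product_algebra As\<^esub> \<in> carrier (product_algebra As)"
      using abelian_monoid.zero_closed[OF am] by (auto simp: product_algebra_def)
    show "x \<oplus>\<^bsub>product_algebra As\<^esub> y \<in> carrier (product_algebra As)"
      if "x \<in> carrier (product_algebra As)" "y \<in> carrier (product_algebra As)" for x y
      using that abelian_monoid.a_closed[OF am] by (auto simp: product_algebra_def)
    show "r \<odot>\<^bsub>product_algebra As\<^esub> x \<in> carrier (product_algebra As)"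
      if "r \<in> carrier R" "x \<in> carrier (product_algebra As)" for r x
      using that module.smult_closed[OF mod] by (auto simp: product_algebra_def)
    fix x assume x: "x \<in> carrier (product_algebra As)"
    let ?y = "Tup (map (\<lambda>i. \<ominus>\<^bsub>As ! i\<^esub> coord i x) [0..<length As])"
    have "?y \<in> carrier (product_algebra As)"
      using coord_product_algebra(1)[OF _ x] abelian_group.a_inv_closed[OF module.axioms(2)[OF mod]]
      by (auto simp: in_product_algebra_iff)
    then show "\<exists>y \<in> carrier (product_algebra As). \<forall>i \<in> {..<length As}. coord i y = \<ominus>\<^bsub>As ! i\<^esub> coord i x"
      by (auto intro!: bexI[of _ ?y])
  qed (auto simp: is_cring mod coord_product_algebra intro: product_algebra_eqI)
  then have "op_algebra R P (product_algebra As)"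
  proof (rule algebra_by_components[where I = "{..<length As}" and A = "\<lambda>i. As ! i" and \<pi> = coord,
        OF operad_axioms])
    show "coord i \<in> alg_homs R P (product_algebra As) (As ! i)" if "i \<in> {..<length As}" for i
      using that by (intro alg_homsI linear_mapsI) (auto simp: coord_product_algebra)
    fix \<mu> and xs :: "'b universe list"
    assume \<mu>: "\<mu> \<in> carrier (ops P (length xs))" and xs: "set xs \<subseteq> carrier (product_algebra As)"
    have "act (As ! i) \<mu> (map (coord i) xs) \<in> carrier (As ! i)" if i: "i < length As" for i
    proof -
      interpret universe_algebra R P "As ! i" by (rule A[OF i])
      show ?thesis
        using \<mu> xs coord_product_algebra(1)[OF i] by (intro act_closed) auto
    qed
    then show "act (product_algebra As) \<mu> xs \<in> carrier (product_algebra As)"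
      by (auto simp: product_algebra_def)
  qed (auto simp: A universe_algebra_imp intro: product_algebra_eqI)
  then show ?thesis
    by (simp add: universe_algebra_def)
qed

definition concrete_product ::
    "('r, 'b universe, 'p) alg_data list \<Rightarrow> ('r, 'b universe, 'p) alg_data \<Rightarrow>
      (nat \<Rightarrow> ('r, 'b universe, 'p) alg_arrow) \<Rightarrow> bool"
  where "concrete_product As Q \<pi> \<longleftrightarrow> limit_cone {..<length As} \<pi> Q ((!) As) (\<lambda>_. True)"

lemma concrete_product_iff:
  "concrete_product As Q \<pi> \<longleftrightarrow>
    universe_algebra R P Q \<and> (\<forall>i < length As. \<pi> i \<in> Hom (ALG R P) Q (As ! i)) \<and>
    (\<forall>x \<in> carrier Q. \<forall>y \<in> carrier Q. (\<forall>i < length As. fn (\<pi> i) x = fn (\<pi> i) y) \<longrightarrow> x = y) \<and>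
    (\<forall>a. (\<forall>i < length As. a i \<in> carrier (As ! i)) \<longrightarrow>
       (\<exists>x \<in> carrier Q. \<forall>i < length As. fn (\<pi> i) x = a i))"
  unfolding concrete_product_def limit_cone_def Ball_def lessThan_iff by simp

lemma concrete_product_imp_product:
  fixes As :: "('r, 'b universe, 'p) alg_data list"
  assumes "concrete_product As Q \<pi>"
  shows "is_product (ALG R P) As Q \<pi>"
  unfolding is_product_def
proof (intro conjI ballI allI impI)
  note cone = assms[unfolded concrete_product_def]
  show "Q \<in> Obj (ALG R P)" "\<And>i. i < length As \<Longrightarrow> \<pi> i \<in> Hom (ALG R P) Q (As ! i)"
    using limit_coneD(1,2)[OF cone] by simp_all
  show "\<exists>!h. h \<in> Hom (ALG R P) X Q \<and> (\<forall>i < length As. \<pi> i \<cdot>\<^sub>P h = f i)"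
    if "X \<in> Obj (ALG R P)" "\<forall>i < length As. f i \<in> Hom (ALG R P) X (As ! i)" for X f
    using limit_cone_lift[OF cone, of X f] that by (simp add: Ball_def)
qed

lemma concrete_product_product_algebra:
  assumes "\<And>A. A \<in> set As \<Longrightarrow> universe_algebra R P A"
  shows "concrete_product As (product_algebra As) (\<lambda>i. mk_arrow (product_algebra As) (As ! i) (coord i))"
proof -
  note alg = algebra_product_algebra[OF assms]
  have "coord i \<in> alg_homs R P (product_algebra As) (As ! i)" if "i < length As" for i
    using that by (intro alg_homsI linear_mapsI) (auto simp: coord_product_algebra)
  then have "mk_arrow (product_algebra As) (As ! i) (coord i) \<in> Hom (ALG R P) (product_algebra As) (As ! i)"
    if "i < length As" for i
    using that assms alg by (intro mk_arrow_Hom) auto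
  moreover have "\<exists>x \<in> carrier (product_algebra As).
      \<forall>i < length As. fn (mk_arrow (product_algebra As) (As ! i) (coord i)) x = a i"
    if "\<forall>i < length As. a i \<in> carrier (As ! i)" for a
  proof -
    have "Tup (map a [0..<length As]) \<in> carrier (product_algebra As)"
      using that by (simp add: in_product_algebra_iff)
    then show ?thesis
      by (intro bexI[of _ "Tup (map a [0..<length As])"]) auto
  qed
  ultimately show ?thesis
    unfolding concrete_product_iff using alg by (auto intro: product_algebra_eqI)
qed

text \<open>Preservation of products is demanded for every product cone, about whose elements
  nothing is known a priori. Comparison with \<open>product_algebra\<close> gives arrows
  \<open>h\<close> and \<open>g\<close>; injectivity is transported along \<open>h\<close>, and
  lifting along \<open>g\<close>.\<close>

lemma product_imp_concrete_product:
  assumes As: "\<And>A. A \<in> set As \<Longrightarrow> universe_algebra R P A" and Q: "is_product (ALG R P) As Q \<pi>"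
  shows "concrete_product As Q \<pi>"
proof -
  interpret C: category "ALG R P" by (rule category_ALG)
  let ?S = "product_algebra As" and ?\<sigma> = "\<lambda>i. mk_arrow (product_algebra As) (As ! i) (coord i)"
  note S = concrete_product_product_algebra[OF As]
  note S' = concrete_product_imp_product[OF S]
  have QD: "universe_algebra R P Q" "\<And>i. i < length As \<Longrightarrow> \<pi> i \<in> Hom (ALG R P) Q (As ! i)"
    "\<And>X f. \<lbrakk>universe_algebra R P X; \<And>i. i < length As \<Longrightarrow> f i \<in> Hom (ALG R P) X (As ! i)\<rbrakk> \<Longrightarrow>
      \<exists>!h. h \<in> Hom (ALG R P) X Q \<and> (\<forall>i < length As. \<pi> i \<cdot>\<^sub>P h = f i)"
    using Q unfolding is_product_def by simp_all
  have SD: "universe_algebra R P ?S" "\<And>i. i < length As \<Longrightarrow> ?\<sigma> i \<in> Hom (ALG R P) ?S (As ! i)"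
    using S unfolding concrete_product_iff by simp_all
  obtain h where h: "h \<in> Hom (ALG R P) Q ?S" "\<And>i. i < length As \<Longrightarrow> ?\<sigma> i \<cdot>\<^sub>P h = \<pi> i"
    using S' QD(1,2) unfolding is_product_def by (metis Obj_ALG)
  obtain g where g: "g \<in> Hom (ALG R P) ?S Q" "\<And>i. i < length As \<Longrightarrow> \<pi> i \<cdot>\<^sub>P g = ?\<sigma> i"
    using QD(3)[OF SD(1), of ?\<sigma>] SD(2) by blast
  have "\<pi> i \<cdot>\<^sub>P g \<cdot>\<^sub>P h = \<pi> i" if "i < length As" for i
    using C.Comp_assoc[OF h(1) g(1) QD(2)[OF that]] g(2)[OF that] h(2)[OF that] by simp
  moreover have "\<pi> i \<cdot>\<^sub>P Id (ALG R P) Q = \<pi> i" if "i < length As" for i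
    using C.Comp_Id_right[OF QD(2)[OF that]] .
  moreover have "Id (ALG R P) Q \<in> Hom (ALG R P) Q Q"
    using Id_ALG_Hom[OF QD(1)] .
  \<comment> \<open>Both sides are endomorphisms of \<open>Q\<close> compatible with all
    projections, and the mediating arrow is unique.\<close>
  ultimately have gh: "g \<cdot>\<^sub>P h = Id (ALG R P) Q"
    using QD(3)[OF QD(1), of \<pi>] QD(2) Comp_ALG_Hom[OF h(1) g(1)] by blast
  have gh': "fn g (fn h x) = x" if "x \<in> carrier Q" for x
    using arg_cong[OF gh, of "\<lambda>k. fn k x"] that by (simp add: Hom_src[OF h(1)])
  have \<pi>h: "coord i (fn h x) = fn (\<pi> i) x" if "i < length As" "x \<in> carrier Q" for i x
    using arg_cong[OF h(2)[OF that(1)], of "\<lambda>k. fn k x"] that(2)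
    by (simp add: Hom_src[OF h(1)] Hom_fn_closed[OF h(1)])
  have \<pi>g: "fn (\<pi> i) (fn g y) = coord i y" if "i < length As" "y \<in> carrier ?S" for i y
    using arg_cong[OF g(2)[OF that(1)], of "\<lambda>k. fn k y"] that(2) by (simp add: Hom_src[OF g(1)])
  show ?thesis
    unfolding concrete_product_iff
  proof (intro conjI allI impI ballI)
    show "universe_algebra R P Q" "\<And>i. i < length As \<Longrightarrow> \<pi> i \<in> Hom (ALG R P) Q (As ! i)"
      using QD by blast+
    show "x = y" if "x \<in> carrier Q" "y \<in> carrier Q" "\<forall>i < length As. fn (\<pi> i) x = fn (\<pi> i) y" for x y
    proof -
      have "fn h x = fn h y"
      proof (rule product_algebra_eqI)
        show "coord i (fn h x) = coord i (fn h y)" if i: "i < length As" for i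
          using \<pi>h[OF i \<open>x \<in> _\<close>] \<pi>h[OF i \<open>y \<in> _\<close>] \<open>\<forall>i < length As. _\<close> i by simp
      qed (use that Hom_fn_closed[OF h(1)] in blast)+
      then show ?thesis
        using gh' that(1,2) by metis
    qed
    show "\<exists>x \<in> carrier Q. \<forall>i < length As. fn (\<pi> i) x = a i"
      if "\<forall>i < length As. a i \<in> carrier (As ! i)" for a
    proof -
      have "Tup (map a [0..<length As]) \<in> carrier ?S"
        using that by (simp add: in_product_algebra_iff)
      then show ?thesis
        using \<pi>g by (intro bexI[of _ "fn g (Tup (map a [0..<length As]))"]) (auto intro: Hom_fn_closed[OF g(1)])
    qed
  qed
qed

lemma has_finite_products_ALG:
  "has_finite_products (ALG R P :: (('r, 'b universe, 'p) alg_data, ('r, 'b universe, 'p) alg_arrow) category)"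
  unfolding has_finite_products_def
  using concrete_product_imp_product[OF concrete_product_product_algebra] by (auto simp: subset_iff)

end

text \<open>The mediating arrows between two products of the same objects are mutually inverse by
  uniqueness; the arrow described by \<open>THE\<close> is one of them.\<close>

lemma (in category) product_comparison_iso:
  assumes P: "is_product C As P \<pi>" and Q: "is_product C As Q \<rho>"
  shows "is_iso C (THE h. h \<in> Hom C P Q \<and> (\<forall>i < length As. \<rho> i \<cdot> h = \<pi> i))"
proof -
  have P': "P \<in> Obj C" "\<And>i. i < length As \<Longrightarrow> \<pi> i \<in> Hom C P (As ! i)"
    "\<And>X f. \<lbrakk>X \<in> Obj C; \<And>i. i < length As \<Longrightarrow> f i \<in> Hom C X (As ! i)\<rbrakk> \<Longrightarrow>
      \<exists>!h. h \<in> Hom C X P \<and> (\<forall>i < length As. \<pi> i \<cdot> h = f i)"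
    using P unfolding is_product_def by simp_all
  have Q': "Q \<in> Obj C" "\<And>i. i < length As \<Longrightarrow> \<rho> i \<in> Hom C Q (As ! i)"
    "\<And>X f. \<lbrakk>X \<in> Obj C; \<And>i. i < length As \<Longrightarrow> f i \<in> Hom C X (As ! i)\<rbrakk> \<Longrightarrow>
      \<exists>!h. h \<in> Hom C X Q \<and> (\<forall>i < length As. \<rho> i \<cdot> h = f i)"
    using Q unfolding is_product_def by simp_all
  obtain h where h: "h \<in> Hom C P Q" "\<And>i. i < length As \<Longrightarrow> \<rho> i \<cdot> h = \<pi> i"
    using Q'(3)[OF P'(1), of \<pi>] P'(2) by blast
  obtain g where g: "g \<in> Hom C Q P" "\<And>i. i < length As \<Longrightarrow> \<pi> i \<cdot> g = \<rho> i"
    using P'(3)[OF Q'(1), of \<rho>] Q'(2) by blast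
  have "\<pi> i \<cdot> g \<cdot> h = \<pi> i" "\<pi> i \<cdot> Id C P = \<pi> i" if "i < length As" for i
    using Comp_assoc[OF h(1) g(1) P'(2)[OF that]] Comp_Id_right[OF P'(2)[OF that]] g(2) h(2) that by simp_all
  then have gh: "g \<cdot> h = Id C P"
    using P'(3)[OF P'(1), of \<pi>] P'(2) Comp_Hom[OF h(1) g(1)] Id_Hom[OF P'(1)] by blast
  have "\<rho> i \<cdot> h \<cdot> g = \<rho> i" "\<rho> i \<cdot> Id C Q = \<rho> i" if "i < length As" for i
    using Comp_assoc[OF g(1) h(1) Q'(2)[OF that]] Comp_Id_right[OF Q'(2)[OF that]] g(2) h(2) that by simp_all
  then have hg: "h \<cdot> g = Id C Q"
    using Q'(3)[OF Q'(1), of \<rho>] Q'(2) Comp_Hom[OF g(1) h(1)] Id_Hom[OF Q'(1)] by blast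
  have "(THE h. h \<in> Hom C P Q \<and> (\<forall>i < length As. \<rho> i \<cdot> h = \<pi> i)) = h"
    using Q'(3)[OF P'(1), of \<pi>] P'(2) h by (intro the1_equality) auto
  then show ?thesis
    using h(1) g(1) gh hg by (auto simp: is_iso_def Hom_def)
qed


section \<open>The tangent structure\<close>

lemma Tup_in_carrier [simp]:
  "Tup [a, b] \<in> carrier (tan_T A) \<longleftrightarrow> a \<in> carrier A \<and> b \<in> carrier A"
  "Tup [a, b, c] \<in> carrier (semidirect 2 A) \<longleftrightarrow> a \<in> carrier A \<and> b \<in> carrier A \<and> c \<in> carrier A"
  "Tup [a, b, c, d] \<in> carrier (semidirect 3 A) \<longleftrightarrow>
    a \<in> carrier A \<and> b \<in> carrier A \<and> c \<in> carrier A \<and> d \<in> carrier A"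
  by (auto simp: in_tan_T_iff in_semidirect_iff)

lemma in_semidirect_2_iff:
  "x \<in> carrier (semidirect 2 A) \<longleftrightarrow>
    (\<exists>a \<in> carrier A. \<exists>b \<in> carrier A. \<exists>c \<in> carrier A. x = Tup [a, b, c])"
  by (auto simp: in_semidirect_iff length_Suc_conv numeral_eq_Suc One_nat_def)

lemma in_semidirect_3_iff:
  "x \<in> carrier (semidirect 3 A) \<longleftrightarrow>
    (\<exists>a \<in> carrier A. \<exists>b \<in> carrier A. \<exists>c \<in> carrier A. \<exists>d \<in> carrier A. x = Tup [a, b, c, d])"
  by (auto simp: in_semidirect_iff length_Suc_conv numeral_eq_Suc One_nat_def)

lemma tan_T_ops [simp]:
  "\<zero>\<^bsub>tan_T A\<^esub> = Tup [\<zero>\<^bsub>A\<^esub>, \<zero>\<^bsub>A\<^esub>]"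
  "Tup [a, b] \<oplus>\<^bsub>tan_T A\<^esub> Tup [c, d] = Tup [a \<oplus>\<^bsub>A\<^esub> c, b \<oplus>\<^bsub>A\<^esub> d]"
  by (simp_all add: tan_T_def semidirect_def numeral_2_eq_2)

lemma tan_arrow_ends [simp]:
  "src (tan_Tm \<phi>) = tan_T (src \<phi>)" "tgt (tan_Tm \<phi>) = tan_T (tgt \<phi>)"
  "src (tan_p A) = tan_T A" "tgt (tan_p A) = A"
  "src (tan_q n j A) = semidirect n A" "tgt (tan_q n j A) = tan_T A"
  "src (tan_s A) = semidirect 2 A" "tgt (tan_s A) = tan_T A"
  "src (tan_z A) = A" "tgt (tan_z A) = tan_T A"
  "src (tan_l A) = tan_T A" "tgt (tan_l A) = tan_T (tan_T A)"
  "src (tan_c A) = tan_T (tan_T A)" "tgt (tan_c A) = tan_T (tan_T A)"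
  "src (tan_n A) = tan_T A" "tgt (tan_n A) = tan_T A"
  by (simp_all add: tan_Tm_def tan_p_def tan_q_def tan_s_def tan_z_def tan_l_def tan_c_def tan_n_def)

lemma tan_arrow_values [simp]:
  "\<lbrakk>a \<in> carrier (src \<phi>); b \<in> carrier (src \<phi>)\<rbrakk> \<Longrightarrow> fn (tan_Tm \<phi>) (Tup [a, b]) = Tup [fn \<phi> a, fn \<phi> b]"
  "\<lbrakk>a \<in> carrier A; b \<in> carrier A\<rbrakk> \<Longrightarrow> fn (tan_p A) (Tup [a, b]) = a"
  "\<lbrakk>a \<in> carrier A; b \<in> carrier A; c \<in> carrier A\<rbrakk> \<Longrightarrow> fn (tan_s A) (Tup [a, b, c]) = Tup [a, b \<oplus>\<^bsub>A\<^esub> c]"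
  "a \<in> carrier A \<Longrightarrow> fn (tan_z A) a = Tup [a, \<zero>\<^bsub>A\<^esub>]"
  "\<lbrakk>a \<in> carrier A; b \<in> carrier A\<rbrakk> \<Longrightarrow>
    fn (tan_l A) (Tup [a, b]) = Tup [Tup [a, \<zero>\<^bsub>A\<^esub>], Tup [\<zero>\<^bsub>A\<^esub>, b]]"
  "\<lbrakk>a \<in> carrier A; b \<in> carrier A; c \<in> carrier A; d \<in> carrier A\<rbrakk> \<Longrightarrow>
    fn (tan_c A) (Tup [Tup [a, b], Tup [c, d]]) = Tup [Tup [a, c], Tup [b, d]]"
  "\<lbrakk>a \<in> carrier A; b \<in> carrier A\<rbrakk> \<Longrightarrow> fn (tan_n A) (Tup [a, b]) = Tup [a, \<ominus>\<^bsub>A\<^esub> b]"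
  by (simp_all add: tan_Tm_def tan_p_def tan_s_def tan_z_def tan_l_def tan_c_def tan_n_def)

lemma tan_q_value:
  "Tup (a # bs) \<in> carrier (semidirect n A) \<Longrightarrow> fn (tan_q n j A) (Tup (a # bs)) = Tup [a, bs ! (j - 1)]"
  by (simp add: tan_q_def)

lemma tan_q_values [simp]:
  "\<lbrakk>a \<in> carrier A; b \<in> carrier A; c \<in> carrier A\<rbrakk> \<Longrightarrow> fn (tan_q 2 1 A) (Tup [a, b, c]) = Tup [a, b]"
  "\<lbrakk>a \<in> carrier A; b \<in> carrier A; c \<in> carrier A\<rbrakk> \<Longrightarrow> fn (tan_q 2 2 A) (Tup [a, b, c]) = Tup [a, c]"
  "\<lbrakk>a \<in> carrier A; b \<in> carrier A; c \<in> carrier A; d \<in> carrier A\<rbrakk> \<Longrightarrow>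
    fn (tan_q 3 1 A) (Tup [a, b, c, d]) = Tup [a, b]"
  "\<lbrakk>a \<in> carrier A; b \<in> carrier A; c \<in> carrier A; d \<in> carrier A\<rbrakk> \<Longrightarrow>
    fn (tan_q 3 2 A) (Tup [a, b, c, d]) = Tup [a, c]"
  "\<lbrakk>a \<in> carrier A; b \<in> carrier A; c \<in> carrier A; d \<in> carrier A\<rbrakk> \<Longrightarrow>
    fn (tan_q 3 3 A) (Tup [a, b, c, d]) = Tup [a, d]"
  by (simp_all add: tan_q_value One_nat_def)

text \<open>Pattern matching and coordinates agree on the source carriers, which is all that
  \<open>mk_arrow\<close> retains. The coordinate forms connect the definitions with the morphism
  lemmas; computations on explicit tuples use \<open>tan_arrow_values\<close>.\<close>

lemma tan_arrow_coords:
  "tan_Tm \<phi> = mk_arrow (tan_T (src \<phi>)) (tan_T (tgt \<phi>)) (\<lambda>x. Tup [fn \<phi> (coord 0 x), fn \<phi> (coord 1 x)])"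
  "tan_p A = mk_arrow (tan_T A) A (coord 0)"
  "tan_s A = mk_arrow (semidirect 2 A) (tan_T A) (\<lambda>x. Tup [coord 0 x, coord 1 x \<oplus>\<^bsub>A\<^esub> coord 2 x])"
  "tan_l A = mk_arrow (tan_T A) (tan_T (tan_T A))
    (\<lambda>x. Tup [Tup [coord 0 x, \<zero>\<^bsub>A\<^esub>], Tup [\<zero>\<^bsub>A\<^esub>, coord 1 x]])"
  "tan_c A = mk_arrow (tan_T (tan_T A)) (tan_T (tan_T A))
    (\<lambda>x. Tup [Tup [coord 0 (coord 0 x), coord 0 (coord 1 x)],
              Tup [coord 1 (coord 0 x), coord 1 (coord 1 x)]])"
  "tan_n A = mk_arrow (tan_T A) (tan_T A) (\<lambda>x. Tup [coord 0 x, \<ominus>\<^bsub>A\<^esub> coord 1 x])"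
  by (auto simp: tan_Tm_def tan_p_def tan_s_def tan_l_def tan_c_def tan_n_def in_tan_T_iff
      in_semidirect_2_iff intro!: mk_arrow_cong)

text \<open>The head of the tuple accounts for the shift between \<open>bs ! (j - 1)\<close> and
  \<open>coord j\<close>; the natural subtraction is harmless because
  \<open>1 \<le> j\<close>.\<close>

lemma tan_q_coords:
  assumes "1 \<le> j"
  shows "tan_q n j A = mk_arrow (semidirect n A) (tan_T A) (\<lambda>x. Tup [coord 0 x, coord j x])"
  using assms
  by (cases j) (auto simp: tan_q_def in_semidirect_iff length_Suc_conv One_nat_def intro!: mk_arrow_cong)

section \<open>The functor, its pullbacks, and preservation of limits\<close>

context operad
begin

lemma tan_objects:
  assumes "universe_algebra R P A"
  shows "universe_algebra R P (tan_T A)" and "universe_algebra R P (semidirect n A)"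
  using universe_algebra.algebra_tan_T[OF assms] universe_algebra.algebra_semidirect[OF assms]
  by simp_all

lemma tan_Tm_Hom: "\<phi> \<in> Hom (ALG R P) A B \<Longrightarrow> tan_Tm \<phi> \<in> Hom (ALG R P) (tan_T A) (tan_T B)"
  unfolding tan_arrow_coords(1)
  using universe_algebra.tan_Tm_hom[OF Hom_algebras(2) Hom_algebras(1) Hom_fn, of \<phi> A B]
  by (auto simp: Hom_src Hom_tgt dest: Hom_algebras intro!: mk_arrow_Hom tan_objects)

lemma tan_arrow_Hom:
  assumes A: "universe_algebra R P A"
  shows tan_p_Hom: "tan_p A \<in> Hom (ALG R P) (tan_T A) A"
    and tan_q_Hom: "\<lbrakk>1 \<le> j; j \<le> n\<rbrakk> \<Longrightarrow> tan_q n j A \<in> Hom (ALG R P) (semidirect n A) (tan_T A)"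
    and tan_s_Hom: "tan_s A \<in> Hom (ALG R P) (semidirect 2 A) (tan_T A)"
    and tan_z_Hom: "tan_z A \<in> Hom (ALG R P) A (tan_T A)"
    and tan_l_Hom: "tan_l A \<in> Hom (ALG R P) (tan_T A) (tan_T (tan_T A))"
    and tan_c_Hom: "tan_c A \<in> Hom (ALG R P) (tan_T (tan_T A)) (tan_T (tan_T A))"
    and tan_n_Hom: "tan_n A \<in> Hom (ALG R P) (tan_T A) (tan_T A)"
proof -
  interpret A: universe_algebra R P A by fact
  note intros = mk_arrow_Hom tan_objects A
  show "tan_p A \<in> Hom (ALG R P) (tan_T A) A"
    unfolding tan_arrow_coords by (intro intros A.coord_0_hom_tan_T)
  show "tan_q n j A \<in> Hom (ALG R P) (semidirect n A) (tan_T A)" if "1 \<le> j" "j \<le> n"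
    unfolding tan_q_coords[OF that(1)] by (intro intros A.tan_q_hom that)
  show "tan_s A \<in> Hom (ALG R P) (semidirect 2 A) (tan_T A)"
    unfolding tan_arrow_coords by (intro intros A.tan_s_hom)
  show "tan_z A \<in> Hom (ALG R P) A (tan_T A)"
    unfolding tan_z_def by (intro intros A.tan_z_hom)
  show "tan_l A \<in> Hom (ALG R P) (tan_T A) (tan_T (tan_T A))"
    unfolding tan_arrow_coords by (intro intros A.tan_l_hom)
  show "tan_c A \<in> Hom (ALG R P) (tan_T (tan_T A)) (tan_T (tan_T A))"
    unfolding tan_arrow_coords by (intro intros A.tan_c_hom)
  show "tan_n A \<in> Hom (ALG R P) (tan_T A) (tan_T A)"
    unfolding tan_arrow_coords by (intro intros A.tan_n_hom)
qed

lemma tan_q_Hom_numeral: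
  assumes "universe_algebra R P A"
  shows "tan_q 2 1 A \<in> Hom (ALG R P) (semidirect 2 A) (tan_T A)"
    "tan_q 2 2 A \<in> Hom (ALG R P) (semidirect 2 A) (tan_T A)"
    "tan_q 3 1 A \<in> Hom (ALG R P) (semidirect 3 A) (tan_T A)"
    "tan_q 3 2 A \<in> Hom (ALG R P) (semidirect 3 A) (tan_T A)"
    "tan_q 3 3 A \<in> Hom (ALG R P) (semidirect 3 A) (tan_T A)"
  by (simp_all add: tan_q_Hom[OF assms])

text \<open>Applied exhaustively, these rules type composites of the structure arrows, after which
  an equation between such composites is a matter of values.\<close>

lemmas tan_Hom_intros = tan_objects tan_p_Hom tan_q_Hom_numeral tan_s_Hom tan_z_Hom tan_l_Hom tan_c_Hom
  tan_n_Hom tan_Tm_Hom Comp_ALG_Hom Id_ALG_Hom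

lemma tan_Tm_Comp:
  assumes f: "f \<in> Hom (ALG R P) A B" and g: "g \<in> Hom (ALG R P) B D"
  shows "tan_Tm (g \<cdot>\<^sub>P f) = tan_Tm g \<cdot>\<^sub>P tan_Tm f"
proof (rule arrow_eqI)
  show "tan_Tm (g \<cdot>\<^sub>P f) \<in> Hom (ALG R P) (tan_T A) (tan_T D)"
    "tan_Tm g \<cdot>\<^sub>P tan_Tm f \<in> Hom (ALG R P) (tan_T A) (tan_T D)"
    by (rule tan_Hom_intros f g)+
  show "fn (tan_Tm (g \<cdot>\<^sub>P f)) x = fn (tan_Tm g \<cdot>\<^sub>P tan_Tm f) x"
    if "x \<in> carrier (tan_T A)" for x
    using that by (auto simp: in_tan_T_iff Hom_src[OF f] Hom_src[OF g] Hom_fn_closed[OF f])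
qed

lemma endofunctor_tan_T: "endofunctor (ALG R P) tan_T tan_Tm"
proof -
  have "tan_Tm (Id (ALG R P) A) = Id (ALG R P) (tan_T A)" if "universe_algebra R P A" for A
    by (rule arrow_eqI[of _ "tan_T A" "tan_T A"])
      (use that in \<open>auto simp: in_tan_T_iff intro!: tan_Hom_intros\<close>)
  then show ?thesis
    unfolding endofunctor_def using tan_objects tan_Tm_Hom tan_Tm_Comp by auto
qed

lemma nat_transI:
  fixes \<alpha> :: "('r, 'b universe, 'p) alg_data \<Rightarrow> ('r, 'b universe, 'p) alg_arrow"
  assumes "\<And>A. universe_algebra R P A \<Longrightarrow> \<alpha> A \<in> Hom (ALG R P) (F A) (G A)"
    and "\<And>A B \<phi>. \<phi> \<in> Hom (ALG R P) A B \<Longrightarrow> Fm \<phi> \<in> Hom (ALG R P) (F A) (F B)"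
    and "\<And>A B \<phi>. \<phi> \<in> Hom (ALG R P) A B \<Longrightarrow> Gm \<phi> \<in> Hom (ALG R P) (G A) (G B)"
    and "\<And>A B \<phi> x. \<lbrakk>\<phi> \<in> Hom (ALG R P) A B; x \<in> carrier (F A)\<rbrakk> \<Longrightarrow>
      fn (\<alpha> B) (fn (Fm \<phi>) x) = fn (Gm \<phi>) (fn (\<alpha> A) x)"
  shows "nat_trans (ALG R P) F Fm G Gm \<alpha>"
  unfolding nat_trans_def
proof (intro conjI allI ballI)
  show "\<alpha> A \<in> Hom (ALG R P) (F A) (G A)" if "A \<in> Obj (ALG R P)" for A
    using that by (intro assms(1)) simp
  fix A B :: "('r, 'b universe, 'p) alg_data" and \<phi>
  assume \<phi>: "\<phi> \<in> Hom (ALG R P) A B"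
  note \<alpha> = assms(1)[OF Hom_algebras(1)[OF \<phi>]] assms(1)[OF Hom_algebras(2)[OF \<phi>]]
  show "\<alpha> B \<cdot>\<^sub>P Fm \<phi> = Gm \<phi> \<cdot>\<^sub>P \<alpha> A"
    using Comp_ALG_Hom[OF assms(2)[OF \<phi>] \<alpha>(2)] Comp_ALG_Hom[OF \<alpha>(1) assms(3)[OF \<phi>]]
    by (rule arrow_eqI) (simp add: Hom_src[OF assms(2)[OF \<phi>]] Hom_src[OF \<alpha>(1)] assms(4)[OF \<phi>])
qed

text \<open>A compatible family consists of pairs \<open>(a, b_j)\<close> with a common base point,
  which amounts to one tuple \<open>(a, b_1, ..., b_n)\<close>. The base point is visible only
  through the projections, hence \<open>1 \<le> n\<close>.\<close>

lemma concrete_pullback_tan_p: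
  assumes A: "universe_algebra R P A" and "1 \<le> n"
  shows "concrete_pullback n (tan_p A) (semidirect n A) (\<lambda>j. tan_q n j A)"
  unfolding concrete_pullback_def limit_cone_def
proof (intro conjI ballI allI impI)
  show "tan_p A \<in> Arr (ALG R P)"
    using tan_p_Hom[OF A] by (simp add: Arr_ALG_iff)
  show "universe_algebra R P (semidirect n A)"
    using tan_objects[OF A] by simp
  show "tan_q n j A \<in> Hom (ALG R P) (semidirect n A) (src (tan_p A))" if "j \<in> {1..n}" for j
    using tan_q_Hom[OF A] that by simp
  have q: "fn (tan_q n j A) x = Tup [coord 0 x, coord j x]"
    if "j \<in> {1..n}" "x \<in> carrier (semidirect n A)" for j x
    using that by (subst tan_q_coords) simp_all
  show "tan_p A \<cdot>\<^sub>P tan_q n j A = tan_p A \<cdot>\<^sub>P tan_q n k A"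
    if "j \<in> {1..n}" "k \<in> {1..n}" for j k
  proof (rule arrow_eqI)
    show "tan_p A \<cdot>\<^sub>P tan_q n j A \<in> Hom (ALG R P) (semidirect n A) A"
      "tan_p A \<cdot>\<^sub>P tan_q n k A \<in> Hom (ALG R P) (semidirect n A) A"
      using that by (auto intro!: Comp_ALG_Hom tan_q_Hom tan_p_Hom A)
    show "fn (tan_p A \<cdot>\<^sub>P tan_q n j A) x = fn (tan_p A \<cdot>\<^sub>P tan_q n k A) x"
      if "x \<in> carrier (semidirect n A)" for x
      using that q \<open>j \<in> _\<close> \<open>k \<in> _\<close> coord_closed[of x n A] by simp
  qed
  show "x = y" if "x \<in> carrier (semidirect n A)" "y \<in> carrier (semidirect n A)"
    "\<forall>j \<in> {1..n}. fn (tan_q n j A) x = fn (tan_q n j A) y" for x y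
  proof (rule semidirect_eqI[OF that(1,2)])
    fix j assume j: "j \<le> n"
    show "coord j x = coord j y"
    proof (cases "j = 0")
      case True
      then show ?thesis
        using q[of 1 x] q[of 1 y] that \<open>1 \<le> n\<close> by simp
    next
      case False
      then have "j \<in> {1..n}"
        using j by simp
      then show ?thesis
        using q[of j x] q[of j y] that by simp
    qed
  qed
  fix e assume e: "(\<forall>j \<in> {1..n}. e j \<in> carrier (src (tan_p A))) \<and>
    (\<forall>j \<in> {1..n}. \<forall>k \<in> {1..n}. fn (tan_p A) (e j) = fn (tan_p A) (e k))"
  then have eD: "e j = Tup [coord 0 (e 1), coord 1 (e j)]" "coord 0 (e 1) \<in> carrier A"
    "coord 1 (e j) \<in> carrier A" if j: "j \<in> {1..n}" for j
  proof -
    have mem: "1 \<in> {1..n}"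
      using \<open>1 \<le> n\<close> by simp
    have "e j \<in> carrier (tan_T A)" "e 1 \<in> carrier (tan_T A)" "fn (tan_p A) (e j) = fn (tan_p A) (e 1)"
      using e j mem unfolding tan_arrow_ends by blast+
    moreover obtain a b where "e j = Tup [a, b]" "a \<in> carrier A" "b \<in> carrier A"
      using calculation(1) by (auto simp: in_tan_T_iff)
    moreover obtain c d where "e 1 = Tup [c, d]" "c \<in> carrier A" "d \<in> carrier A"
      using calculation(2) by (auto simp: in_tan_T_iff)
    ultimately show "e j = Tup [coord 0 (e 1), coord 1 (e j)]" "coord 0 (e 1) \<in> carrier A"
      "coord 1 (e j) \<in> carrier A"
      by simp_all
  qed
  \<comment> \<open>The common base point is read off the first member of the family, the tangent
    entries off the individual members.\<close>
  let ?x = "Tup (coord 0 (e 1) # map (\<lambda>j. coord 1 (e j)) [1..<n + 1])"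
  have x: "?x \<in> carrier (semidirect n A)"
    using eD(2,3) \<open>1 \<le> n\<close> by (auto simp: in_semidirect_iff simp del: upt_Suc)
  have "coord j ?x = coord 1 (e j)" if "j \<in> {1..n}" for j
    using that by (cases j) (auto simp: One_nat_def simp del: upt_Suc)
  then show "\<exists>x \<in> carrier (semidirect n A). \<forall>j \<in> {1..n}. fn (tan_q n j A) x = e j"
    using x q[OF _ x] eD(1) by (intro bexI[OF _ x]) simp
qed

text \<open>An element of \<open>tan_T Q\<close> is a pair of elements of \<open>Q\<close>, and
  \<open>tan_Tm\<close> acts on the two coordinates separately. So injectivity and lifting are those
  of the given cone, used once per coordinate; \<open>K'\<close> has to imply compatibility of both
  coordinate families.\<close>

lemma limit_cone_tan_Tm:
  assumes cone: "limit_cone I q Q E K" and E': "\<And>i. i \<in> I \<Longrightarrow> E' i = tan_T (E i)"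
    and K': "\<And>e. \<lbrakk>\<And>i. i \<in> I \<Longrightarrow> e i \<in> carrier (tan_T (E i)); K' e\<rbrakk> \<Longrightarrow>
      K (\<lambda>i. coord 0 (e i)) \<and> K (\<lambda>i. coord 1 (e i))"
  shows "limit_cone I (\<lambda>i. tan_Tm (q i)) (tan_T Q) E' K'"
  unfolding limit_cone_def
proof (intro conjI ballI allI impI)
  note D = limit_coneD[OF cone]
  show "universe_algebra R P (tan_T Q)"
    using tan_objects D(1) by blast
  show "tan_Tm (q i) \<in> Hom (ALG R P) (tan_T Q) (E' i)" if "i \<in> I" for i
    using tan_Tm_Hom[OF D(2)[OF that]] E'[OF that] by simp
  show "x = y" if x: "x \<in> carrier (tan_T Q)" and y: "y \<in> carrier (tan_T Q)"
    and eq: "\<forall>i \<in> I. fn (tan_Tm (q i)) x = fn (tan_Tm (q i)) y" for x y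
  proof -
    obtain a b c d where xy: "a \<in> carrier Q" "b \<in> carrier Q" "x = Tup [a, b]"
      "c \<in> carrier Q" "d \<in> carrier Q" "y = Tup [c, d]"
      using x y by (auto simp: in_tan_T_iff)
    then have "fn (q i) a = fn (q i) c" "fn (q i) b = fn (q i) d" if i: "i \<in> I" for i
      using eq[rule_format, OF i] Hom_src[OF D(2)[OF i]] by simp_all
    then show ?thesis
      using D(3)[of a c] D(3)[of b d] xy by simp
  qed
  fix e assume "(\<forall>i \<in> I. e i \<in> carrier (E' i)) \<and> K' e"
  then have e: "\<forall>i \<in> I. e i \<in> carrier (E' i)" and "K' e"
    by auto
  then have K: "K (\<lambda>i. coord 0 (e i))" "K (\<lambda>i. coord 1 (e i))"
    using K'[of e] E' by simp_all
  have ec: "coord 0 (e i) \<in> carrier (E i)" "coord 1 (e i) \<in> carrier (E i)"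
    "e i = Tup [coord 0 (e i), coord 1 (e i)]" if i: "i \<in> I" for i
  proof -
    have "e i \<in> carrier (tan_T (E i))"
      using e E' i by simp
    then show "coord 0 (e i) \<in> carrier (E i)" "coord 1 (e i) \<in> carrier (E i)"
      "e i = Tup [coord 0 (e i), coord 1 (e i)]"
      by (auto simp: in_tan_T_iff)
  qed
  obtain a where a: "a \<in> carrier Q" "\<forall>i \<in> I. fn (q i) a = coord 0 (e i)"
    using D(4)[of "\<lambda>i. coord 0 (e i)"] ec(1) K(1) by blast
  obtain b where b: "b \<in> carrier Q" "\<forall>i \<in> I. fn (q i) b = coord 1 (e i)"
    using D(4)[of "\<lambda>i. coord 1 (e i)"] ec(2) K(2) by blast
  have "fn (tan_Tm (q i)) (Tup [a, b]) = e i" if i: "i \<in> I" for i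
    using a b i Hom_src[OF D(2)[OF i]] ec(3)[OF i] by simp
  then show "\<exists>x \<in> carrier (tan_T Q). \<forall>i \<in> I. fn (tan_Tm (q i)) x = e i"
    using a(1) b(1) by (intro bexI[of _ "Tup [a, b]"]) auto
qed

lemma concrete_pullback_tan_Tm:
  assumes pb: "concrete_pullback n p Q q"
  shows "concrete_pullback n (tan_Tm p) (tan_T Q) (\<lambda>j. tan_Tm (q j))"
  unfolding concrete_pullback_def tan_arrow_ends
proof (intro conjI ballI)
  have p: "p \<in> Hom (ALG R P) (src p) (tgt p)"
    and eq: "\<And>j k. \<lbrakk>j \<in> {1..n}; k \<in> {1..n}\<rbrakk> \<Longrightarrow> p \<cdot>\<^sub>P q j = p \<cdot>\<^sub>P q k"
    and cone: "limit_cone {1..n} q Q (\<lambda>_. src p)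
      (\<lambda>e. \<forall>j \<in> {1..n}. \<forall>k \<in> {1..n}. fn p (e j) = fn p (e k))"
    using pb unfolding concrete_pullback_def Arr_ALG_iff by blast+
  note q = limit_coneD(2)[OF cone]
  show "tan_Tm p \<in> Arr (ALG R P)"
    using tan_Tm_Hom[OF p] by (simp add: Arr_ALG_iff)
  show "tan_Tm p \<cdot>\<^sub>P tan_Tm (q j) = tan_Tm p \<cdot>\<^sub>P tan_Tm (q k)" if "j \<in> {1..n}" "k \<in> {1..n}" for j k
    using eq[OF that] tan_Tm_Comp[OF q[OF that(1)] p] tan_Tm_Comp[OF q[OF that(2)] p] by simp
  show "limit_cone {1..n} (\<lambda>j. tan_Tm (q j)) (tan_T Q) (\<lambda>_. tan_T (src p))
      (\<lambda>e. \<forall>j \<in> {1..n}. \<forall>k \<in> {1..n}. fn (tan_Tm p) (e j) = fn (tan_Tm p) (e k))"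
  proof (rule limit_cone_tan_Tm[OF cone refl])
    fix e assume e: "\<And>j. j \<in> {1..n} \<Longrightarrow> e j \<in> carrier (tan_T (src p))"
      and eq: "\<forall>j \<in> {1..n}. \<forall>k \<in> {1..n}. fn (tan_Tm p) (e j) = fn (tan_Tm p) (e k)"
    have "fn (tan_Tm p) (e j) = Tup [fn p (coord 0 (e j)), fn p (coord 1 (e j))]" if "j \<in> {1..n}" for j
      using e[OF that] by (auto simp: in_tan_T_iff)
    with eq show "(\<forall>j \<in> {1..n}. \<forall>k \<in> {1..n}. fn p (coord 0 (e j)) = fn p (coord 0 (e k))) \<and>
        (\<forall>j \<in> {1..n}. \<forall>k \<in> {1..n}. fn p (coord 1 (e j)) = fn p (coord 1 (e k)))"
      by fastforce
  qed
qed

text \<open>The hypothesis and the conclusion of \<open>concrete_pullback_tan_Tm\<close> have the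
  same form, which is what lets the induction over powers go through.\<close>

lemma concrete_pullback_iterated:
  assumes "universe_algebra R P A" and "1 \<le> n"
  shows "concrete_pullback n ((tan_Tm ^^ k) (tan_p A)) ((tan_T ^^ k) (semidirect n A))
    (\<lambda>j. (tan_Tm ^^ k) (tan_q n j A))"
  by (induction k) (simp_all add: concrete_pullback_tan_p[OF assms] concrete_pullback_tan_Tm)

lemma concrete_product_tan_Tm:
  assumes "concrete_product As Q \<pi>"
  shows "concrete_product (map tan_T As) (tan_T Q) (\<lambda>i. tan_Tm (\<pi> i))"
  using limit_cone_tan_Tm[OF assms[unfolded concrete_product_def], of "(!) (map tan_T As)"]
  by (simp add: concrete_product_def)

lemma preserves_finite_products_tan_T: "preserves_finite_products (ALG R P) tan_T tan_Tm"
  unfolding preserves_finite_products_def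
proof (intro allI impI, elim conjE)
  fix As Q \<pi> S \<rho>
  assume As: "set As \<subseteq> Obj (ALG R P)" and Q: "is_product (ALG R P) As Q \<pi>"
    and S: "is_product (ALG R P) (map tan_T As) S \<rho>"
  interpret C: category "ALG R P" by (rule category_ALG)
  have "universe_algebra R P A" if "A \<in> set As" for A
    using that As Obj_ALG by blast
  \<comment> \<open>A round trip through elements: the given product is concrete, its image under
    the functor is concrete, hence a product. The comparison is then one between two products of the
    same list.\<close>
  then have "is_product (ALG R P) (map tan_T As) (tan_T Q) (\<lambda>i. tan_Tm (\<pi> i))"
    using product_imp_concrete_product[OF _ Q] concrete_product_tan_Tm concrete_product_imp_product by blast
  then show "is_iso (ALG R P) (THE h. h \<in> Hom (ALG R P) (tan_T Q) S \<and>
      (\<forall>i < length As. \<rho> i \<cdot>\<^sub>P h = tan_Tm (\<pi> i)))"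
    using C.product_comparison_iso[OF _ S] by simp
qed

end

section \<open>Pairings and their values on elements\<close>

lemma (in category) pairing_universal:
  assumes pb: "is_nfold_pullback C 2 p Q q"
    and f: "f \<in> Hom C X (Dom C p)" and g: "g \<in> Hom C X (Dom C p)" and eq: "p \<cdot> f = p \<cdot> g"
  shows "pairing C Q (q 1) (q 2) f g \<in> Hom C X Q"
    and "q 1 \<cdot> pairing C Q (q 1) (q 2) f g = f" and "q 2 \<cdot> pairing C Q (q 1) (q 2) f g = g"
proof -
  have two: "{1..2} = {1, 2 :: nat}"
    by auto
  have "X \<in> Obj C"
    using f Dom_Obj by (auto simp: Hom_def)
  \<comment> \<open>Turns the two arrows into a family over \<open>{1..2}\<close>, the index set of
    the 2-fold pullback.\<close>
  moreover define F :: "nat \<Rightarrow> 'm" where "F j = (if j = 1 then f else g)" for j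
  have "\<forall>j \<in> {1..2}. F j \<in> Hom C X (Dom C p)" "\<forall>j \<in> {1..2}. \<forall>k \<in> {1..2}. p \<cdot> F j = p \<cdot> F k"
    using f g eq by (simp_all add: F_def)
  ultimately have "\<exists>!h. h \<in> Hom C X Q \<and> (\<forall>j \<in> {1..2}. q j \<cdot> h = F j)"
    using pb unfolding is_nfold_pullback_def by blast
  then have ex: "\<exists>!h. h \<in> Hom C X Q \<and> q 1 \<cdot> h = f \<and> q 2 \<cdot> h = g"
    unfolding two by (simp add: F_def)
  have "pairing C Q (q 1) (q 2) f g = (THE h. h \<in> Hom C X Q \<and> q 1 \<cdot> h = f \<and> q 2 \<cdot> h = g)"
    using f by (simp add: pairing_def Hom_def)
  then show "pairing C Q (q 1) (q 2) f g \<in> Hom C X Q"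
    "q 1 \<cdot> pairing C Q (q 1) (q 2) f g = f" "q 2 \<cdot> pairing C Q (q 1) (q 2) f g = g"
    using theI'[OF ex] by auto
qed

context operad
begin

text \<open>A pairing is described by \<open>THE\<close>, without values. Joint injectivity of the
  legs identifies its value at \<open>x\<close> with any \<open>w\<close> that has the right
  projections, so in applications the tuple is guessed and checked.\<close>

lemma pairing_ALG:
  assumes pb: "concrete_pullback 2 p Q q"
    and f: "f \<in> Hom (ALG R P) X (src p)" and g: "g \<in> Hom (ALG R P) X (src p)"
    and eq: "\<And>x. x \<in> carrier X \<Longrightarrow> fn p (fn f x) = fn p (fn g x)"
  shows pairing_ALG_Hom: "pairing (ALG R P) Q (q 1) (q 2) f g \<in> Hom (ALG R P) X Q"
    and pairing_ALG_value: "\<lbrakk>x \<in> carrier X; w \<in> carrier Q; fn (q 1) w = fn f x; fn (q 2) w = fn g x\<rbrakk> \<Longrightarrow>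
      fn (pairing (ALG R P) Q (q 1) (q 2) f g) x = w"
proof -
  interpret C: category "ALG R P" by (rule category_ALG)
  have p: "p \<in> Hom (ALG R P) (src p) (tgt p)"
    using pb by (simp add: concrete_pullback_def Arr_ALG_iff)
  have "p \<cdot>\<^sub>P f = p \<cdot>\<^sub>P g"
    using Comp_ALG_Hom[OF f p] Comp_ALG_Hom[OF g p]
    by (rule arrow_eqI) (simp add: Hom_src[OF f] Hom_src[OF g] eq)
  note pair = C.pairing_universal[OF concrete_pullback_imp_nfold_pullback[OF pb] _ _ this,
      unfolded ALG_simps, OF f g]
  show "pairing (ALG R P) Q (q 1) (q 2) f g \<in> Hom (ALG R P) X Q"
    by (rule pair(1))
  assume x: "x \<in> carrier X" and w: "w \<in> carrier Q" "fn (q 1) w = fn f x" "fn (q 2) w = fn g x"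
  have two: "{1..2} = {1, 2 :: nat}"
    by auto
  have "fn (q 1) (fn (pairing (ALG R P) Q (q 1) (q 2) f g) x) = fn f x"
    "fn (q 2) (fn (pairing (ALG R P) Q (q 1) (q 2) f g) x) = fn g x"
    using arg_cong[OF pair(2), of "\<lambda>h. fn h x"] arg_cong[OF pair(3), of "\<lambda>h. fn h x"] x
    by (simp_all add: Hom_src[OF pair(1)])
  then show "fn (pairing (ALG R P) Q (q 1) (q 2) f g) x = w"
    using pb w Hom_fn_closed[OF pair(1) x] unfolding concrete_pullback_def limit_cone_def two by auto
qed

end

context universe_algebra
begin

abbreviation pair where "pair \<equiv> pairing (ALG R P) (semidirect 2 A) (tan_q 2 1 A) (tan_q 2 2 A)"

text \<open>Pairing into the image of the pullback under the functor, which is a pullback of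
  \<open>tan_Tm (tan_p A)\<close>.\<close>

abbreviation pairT where
  "pairT \<equiv> pairing (ALG R P) (tan_T (semidirect 2 A)) (tan_Tm (tan_q 2 1 A)) (tan_Tm (tan_q 2 2 A))"

lemma pair_semidirect:
  assumes "f \<in> Hom (ALG R P) X (tan_T A)" and "g \<in> Hom (ALG R P) X (tan_T A)"
    and "\<forall>x \<in> carrier X. fn (tan_p A) (fn f x) = fn (tan_p A) (fn g x)"
  shows pair_Hom: "pair f g \<in> Hom (ALG R P) X (semidirect 2 A)"
    and pair_value: "\<lbrakk>x \<in> carrier X; fn f x = Tup [a, b]; fn g x = Tup [a, c]\<rbrakk> \<Longrightarrow>
      fn (pair f g) x = Tup [a, b, c]"
proof -
  note pb = concrete_pullback_tan_p[OF universe_algebra_axioms, of 2, simplified]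
  show "pair f g \<in> Hom (ALG R P) X (semidirect 2 A)"
    using pairing_ALG_Hom[OF pb, of f X g] assms by simp
  assume x: "x \<in> carrier X" and fg: "fn f x = Tup [a, b]" "fn g x = Tup [a, c]"
  then have "a \<in> carrier A" "b \<in> carrier A" "c \<in> carrier A"
    using Hom_fn_closed[OF assms(1) x] Hom_fn_closed[OF assms(2) x] by auto
  then show "fn (pair f g) x = Tup [a, b, c]"
    using assms x fg by (intro pairing_ALG_value[OF pb, of f X g]) simp_all
qed

lemma pairT_semidirect:
  assumes "f \<in> Hom (ALG R P) X (tan_T (tan_T A))" and "g \<in> Hom (ALG R P) X (tan_T (tan_T A))"
    and "\<forall>x \<in> carrier X. fn (tan_Tm (tan_p A)) (fn f x) = fn (tan_Tm (tan_p A)) (fn g x)"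
  shows pairT_Hom: "pairT f g \<in> Hom (ALG R P) X (tan_T (semidirect 2 A))"
    and pairT_value: "\<lbrakk>x \<in> carrier X; fn f x = Tup [Tup [a, b], Tup [c, d]];
        fn g x = Tup [Tup [a, b'], Tup [c, d']]\<rbrakk> \<Longrightarrow>
      fn (pairT f g) x = Tup [Tup [a, b, b'], Tup [c, d, d']]"
proof -
  note pb = concrete_pullback_tan_Tm[OF concrete_pullback_tan_p[OF universe_algebra_axioms, of 2, simplified]]
  show "pairT f g \<in> Hom (ALG R P) X (tan_T (semidirect 2 A))"
    using pairing_ALG_Hom[OF pb, of f X g] assms by simp
  assume x: "x \<in> carrier X"
    and fg: "fn f x = Tup [Tup [a, b], Tup [c, d]]" "fn g x = Tup [Tup [a, b'], Tup [c, d']]"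
  then have "a \<in> carrier A" "b \<in> carrier A" "c \<in> carrier A" "d \<in> carrier A" "b' \<in> carrier A" "d' \<in> carrier A"
    using Hom_fn_closed[OF assms(1) x] Hom_fn_closed[OF assms(2) x] by auto
  then show "fn (pairT f g) x = Tup [Tup [a, b, b'], Tup [c, d, d']]"
    using assms x fg by (intro pairing_ALG_value[OF pb, of f X g]) simp_all
qed

section \<open>The tangent axioms, checked on elements\<close>

lemmas self = universe_algebra_axioms

lemmas self_Hom_intros = self tan_Hom_intros

text \<open>Addition in the fibres is that of \<open>A\<close>, so the monoid laws are module axioms
  in the tangent coordinate. The rest is the evaluation of nested pairings, each of which first
  needs equal base points of its two legs.\<close>

lemma additive_bundle_ALG:
  "comm_monoid_in_slice (ALG R P) (tan_p A) (semidirect 2 A) (\<lambda>j. tan_q 2 j A)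
    (semidirect 3 A) (\<lambda>j. tan_q 3 j A) (tan_s A) (tan_z A)"
proof -
  let ?C = "ALG R P" and ?E3 = "semidirect 3 A"
  let ?s12 = "tan_s A \<cdot>\<^sub>P pair (tan_q 3 1 A) (tan_q 3 2 A)"
    and ?s23 = "tan_s A \<cdot>\<^sub>P pair (tan_q 3 2 A) (tan_q 3 3 A)"
  note Hom = self_Hom_intros
  note q = tan_q_Hom_numeral[OF self]
  have zp: "tan_z A \<cdot>\<^sub>P tan_p A \<in> Hom ?C (tan_T A) (tan_T A)"
    and idT: "Id ?C (tan_T A) \<in> Hom ?C (tan_T A) (tan_T A)"
    by (rule Hom)+
  have pb: "is_nfold_pullback ?C n (tan_p A) (semidirect n A) (\<lambda>j. tan_q n j A)" if "1 \<le> n" for n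
    using concrete_pullback_imp_nfold_pullback[OF concrete_pullback_tan_p[OF self that]] .
  have p_eq: "\<forall>x \<in> carrier ?E3. fn (tan_p A) (fn (tan_q 3 1 A) x) = fn (tan_p A) (fn (tan_q 3 2 A) x)"
    "\<forall>x \<in> carrier ?E3. fn (tan_p A) (fn (tan_q 3 2 A) x) = fn (tan_p A) (fn (tan_q 3 3 A) x)"
    by (auto simp: in_semidirect_3_iff)
  note p12 = pair_semidirect[OF q(3,4) p_eq(1)] and p23 = pair_semidirect[OF q(4,5) p_eq(2)]
  have s12: "?s12 \<in> Hom ?C ?E3 (tan_T A)"
    and s23: "?s23 \<in> Hom ?C ?E3 (tan_T A)"
    by (rule Hom p12(1) p23(1))+
  have v12: "fn ?s12 (Tup [a, b, c, d]) = Tup [a, b \<oplus>\<^bsub>A\<^esub> c]"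
    and v23: "fn ?s23 (Tup [a, b, c, d]) = Tup [a, c \<oplus>\<^bsub>A\<^esub> d]"
    if "a \<in> carrier A" "b \<in> carrier A" "c \<in> carrier A" "d \<in> carrier A" for a b c d
    using that by (simp_all add: Hom_src[OF p12(1)] Hom_src[OF p23(1)]
        p12(2)[of _ a b c] p23(2)[of _ a c d])
  have p123: "\<forall>x \<in> carrier ?E3.
      fn (tan_p A) (fn ?s12 x) = fn (tan_p A) (fn (tan_q 3 3 A) x)"
    "\<forall>x \<in> carrier ?E3.
      fn (tan_p A) (fn (tan_q 3 1 A) x) = fn (tan_p A) (fn ?s23 x)"
    by (auto simp: in_semidirect_3_iff v12 v23)
  note l = pair_semidirect[OF s12 q(5) p123(1)] and r = pair_semidirect[OF q(3) s23 p123(2)]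
  have assoc: "tan_s A \<cdot>\<^sub>P pair ?s12 (tan_q 3 3 A) =
      tan_s A \<cdot>\<^sub>P pair (tan_q 3 1 A) ?s23"
  proof (rule arrow_eqI)
    fix x assume "x \<in> carrier ?E3"
    then obtain a b c d where x: "x = Tup [a, b, c, d]"
      and abcd: "a \<in> carrier A" "b \<in> carrier A" "c \<in> carrier A" "d \<in> carrier A"
      by (auto simp: in_semidirect_3_iff)
    show "fn (tan_s A \<cdot>\<^sub>P pair ?s12 (tan_q 3 3 A)) x =
        fn (tan_s A \<cdot>\<^sub>P pair (tan_q 3 1 A) ?s23) x"
      using x abcd by (simp add: Hom_src[OF l(1)] Hom_src[OF r(1)] v12 v23 M.a_assoc
          l(2)[of _ a "b \<oplus>\<^bsub>A\<^esub> c" d] r(2)[of _ a b "c \<oplus>\<^bsub>A\<^esub> d"])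
  qed (rule Hom l(1) r(1))+
  have u: "\<forall>x \<in> carrier (tan_T A).
      fn (tan_p A) (fn (tan_z A \<cdot>\<^sub>P tan_p A) x) = fn (tan_p A) (fn (Id ?C (tan_T A)) x)"
    by (auto simp: in_tan_T_iff)
  then have u': "\<forall>x \<in> carrier (tan_T A).
      fn (tan_p A) (fn (Id ?C (tan_T A)) x) = fn (tan_p A) (fn (tan_z A \<cdot>\<^sub>P tan_p A) x)"
    by simp
  note zl = pair_semidirect[OF zp idT u] and zr = pair_semidirect[OF idT zp u']
  have unit_l: "tan_s A \<cdot>\<^sub>P pair (tan_z A \<cdot>\<^sub>P tan_p A) (Id ?C (tan_T A)) = Id ?C (tan_T A)"
  proof (rule arrow_eqI)
    fix x assume "x \<in> carrier (tan_T A)"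
    then obtain a b where "x = Tup [a, b]" "a \<in> carrier A" "b \<in> carrier A"
      by (auto simp: in_tan_T_iff)
    then show "fn (tan_s A \<cdot>\<^sub>P pair (tan_z A \<cdot>\<^sub>P tan_p A) (Id ?C (tan_T A))) x = fn (Id ?C (tan_T A)) x"
      by (simp add: Hom_src[OF zl(1)] zl(2)[of _ a "\<zero>\<^bsub>A\<^esub>" b])
  qed (rule Hom zl(1))+
  have unit_r: "tan_s A \<cdot>\<^sub>P pair (Id ?C (tan_T A)) (tan_z A \<cdot>\<^sub>P tan_p A) = Id ?C (tan_T A)"
  proof (rule arrow_eqI)
    fix x assume "x \<in> carrier (tan_T A)"
    then obtain a b where "x = Tup [a, b]" "a \<in> carrier A" "b \<in> carrier A"
      by (auto simp: in_tan_T_iff)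
    then show "fn (tan_s A \<cdot>\<^sub>P pair (Id ?C (tan_T A)) (tan_z A \<cdot>\<^sub>P tan_p A)) x = fn (Id ?C (tan_T A)) x"
      by (simp add: Hom_src[OF zr(1)] zr(2)[of _ a b "\<zero>\<^bsub>A\<^esub>"])
  qed (rule Hom zr(1))+
  have sw: "\<forall>x \<in> carrier (semidirect 2 A).
      fn (tan_p A) (fn (tan_q 2 2 A) x) = fn (tan_p A) (fn (tan_q 2 1 A) x)"
    by (auto simp: in_semidirect_2_iff)
  note swap = pair_semidirect[OF q(2,1) sw]
  have comm: "tan_s A \<cdot>\<^sub>P pair (tan_q 2 2 A) (tan_q 2 1 A) = tan_s A"
  proof (rule arrow_eqI)
    fix x assume "x \<in> carrier (semidirect 2 A)"
    then obtain a b c where "x = Tup [a, b, c]" "a \<in> carrier A" "b \<in> carrier A" "c \<in> carrier A"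
      by (auto simp: in_semidirect_2_iff)
    then show "fn (tan_s A \<cdot>\<^sub>P pair (tan_q 2 2 A) (tan_q 2 1 A)) x = fn (tan_s A) x"
      by (simp add: Hom_src[OF swap(1)] swap(2)[of _ a c b] M.a_comm)
  qed (rule Hom swap(1))+
  have ps: "tan_p A \<cdot>\<^sub>P tan_s A = tan_p A \<cdot>\<^sub>P tan_q 2 1 A"
    by (rule arrow_eqI, (rule Hom)+) (auto simp: in_semidirect_2_iff)
  have pz: "tan_p A \<cdot>\<^sub>P tan_z A = Id ?C A"
    by (rule arrow_eqI, (rule Hom)+) auto
  show ?thesis
    unfolding comm_monoid_in_slice_def Let_def ALG_simps tan_arrow_ends
    using pb[of 2] pb[of 3] tan_s_Hom[OF self] tan_z_Hom[OF self] ps pz assoc unit_l unit_r comm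
    by simp
qed

lemma tangent_equations:
  "tan_Tm (tan_p A) \<cdot>\<^sub>P tan_l A = tan_z A \<cdot>\<^sub>P tan_p A"
  "tan_l A \<cdot>\<^sub>P tan_z A = tan_Tm (tan_z A) \<cdot>\<^sub>P tan_z A"
  "tan_p (tan_T A) \<cdot>\<^sub>P tan_c A = tan_Tm (tan_p A)"
  "tan_c A \<cdot>\<^sub>P tan_Tm (tan_z A) = tan_z (tan_T A)"
  "tan_c A \<cdot>\<^sub>P tan_c A = Id (ALG R P) (tan_T (tan_T A))"
  "tan_c A \<cdot>\<^sub>P tan_l A = tan_l A"
  "tan_Tm (tan_l A) \<cdot>\<^sub>P tan_l A = tan_l (tan_T A) \<cdot>\<^sub>P tan_l A"
  "tan_p A \<cdot>\<^sub>P tan_n A = tan_p A"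
  by (rule arrow_eqI, (rule self_Hom_intros)+, (auto simp: in_tan_T_iff)[])+

text \<open>Elements of the triple tangent algebra have eight entries, indexed by subsets of three
  tangent directions. The two flips exchange neighbouring directions, so the first equation is the
  braid relation for transpositions of three letters.\<close>

lemma tangent_equations_TTT:
  "tan_Tm (tan_c A) \<cdot>\<^sub>P tan_c (tan_T A) \<cdot>\<^sub>P tan_Tm (tan_c A) =
    tan_c (tan_T A) \<cdot>\<^sub>P tan_Tm (tan_c A) \<cdot>\<^sub>P tan_c (tan_T A)"
  "tan_c (tan_T A) \<cdot>\<^sub>P tan_Tm (tan_c A) \<cdot>\<^sub>P tan_l (tan_T A) =
    tan_Tm (tan_l A) \<cdot>\<^sub>P tan_c A"
  by (rule arrow_eqI, (rule self_Hom_intros)+, (auto simp: in_tan_T_iff)[])+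

end

context universe_algebra
begin

lemma lift_s_ALG:
  "tan_l A \<cdot>\<^sub>P tan_s A = tan_Tm (tan_s A) \<cdot>\<^sub>P
    pairT (tan_l A \<cdot>\<^sub>P tan_q 2 1 A) (tan_l A \<cdot>\<^sub>P tan_q 2 2 A)" (is "?L = ?R")
proof -
  have h: "tan_l A \<cdot>\<^sub>P tan_q 2 1 A \<in> Hom (ALG R P) (semidirect 2 A) (tan_T (tan_T A))"
    "tan_l A \<cdot>\<^sub>P tan_q 2 2 A \<in> Hom (ALG R P) (semidirect 2 A) (tan_T (tan_T A))"
    by (rule self_Hom_intros)+
  have eq: "\<forall>x \<in> carrier (semidirect 2 A).
      fn (tan_Tm (tan_p A)) (fn (tan_l A \<cdot>\<^sub>P tan_q 2 1 A) x) =
      fn (tan_Tm (tan_p A)) (fn (tan_l A \<cdot>\<^sub>P tan_q 2 2 A) x)"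
    by (auto simp: in_semidirect_2_iff)
  note pair = pairT_semidirect[OF h eq]
  show ?thesis
  proof (rule arrow_eqI)
    fix x assume "x \<in> carrier (semidirect 2 A)"
    then obtain a b c where "x = Tup [a, b, c]" "a \<in> carrier A" "b \<in> carrier A" "c \<in> carrier A"
      by (auto simp: in_semidirect_2_iff)
    \<comment> \<open>The two lifts are \<open>((a, 0), (0, b))\<close> and
      \<open>((a, 0), (0, c))\<close>; the instance of \<open>pair(2)\<close> names their
      entries.\<close>
    then show "fn ?L x = fn ?R x"
      by (simp add: Hom_src[OF pair(1)] pair(2)[of _ a "\<zero>\<^bsub>A\<^esub>" "\<zero>\<^bsub>A\<^esub>" b "\<zero>\<^bsub>A\<^esub>" c])
  qed (rule self_Hom_intros pair(1))+
qed

lemma flip_s_ALG: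
  "tan_c A \<cdot>\<^sub>P tan_Tm (tan_s A) = tan_s (tan_T A) \<cdot>\<^sub>P
    pairing (ALG R P) (semidirect 2 (tan_T A)) (tan_q 2 1 (tan_T A)) (tan_q 2 2 (tan_T A))
      (tan_c A \<cdot>\<^sub>P tan_Tm (tan_q 2 1 A)) (tan_c A \<cdot>\<^sub>P tan_Tm (tan_q 2 2 A))" (is "?L = ?R")
proof -
  interpret T: universe_algebra R P "tan_T A" by (rule algebra_tan_T)
  have h: "tan_c A \<cdot>\<^sub>P tan_Tm (tan_q 2 1 A) \<in> Hom (ALG R P) (tan_T (semidirect 2 A)) (tan_T (tan_T A))"
    "tan_c A \<cdot>\<^sub>P tan_Tm (tan_q 2 2 A) \<in> Hom (ALG R P) (tan_T (semidirect 2 A)) (tan_T (tan_T A))"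
    by (rule self_Hom_intros)+
  have eq: "\<forall>x \<in> carrier (tan_T (semidirect 2 A)).
      fn (tan_p (tan_T A)) (fn (tan_c A \<cdot>\<^sub>P tan_Tm (tan_q 2 1 A)) x) =
      fn (tan_p (tan_T A)) (fn (tan_c A \<cdot>\<^sub>P tan_Tm (tan_q 2 2 A)) x)"
    by (auto simp: in_semidirect_2_iff in_tan_T_iff)
  note pair = T.pair_semidirect[OF h eq]
  show ?thesis
  proof (rule arrow_eqI)
    fix x assume "x \<in> carrier (tan_T (semidirect 2 A))"
    then obtain a b b' c d d' where "x = Tup [Tup [a, b, b'], Tup [c, d, d']]"
      "a \<in> carrier A" "b \<in> carrier A" "b' \<in> carrier A" "c \<in> carrier A" "d \<in> carrier A" "d' \<in> carrier A"
      by (auto simp: in_semidirect_2_iff in_tan_T_iff)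
    \<comment> \<open>After the flip the two legs are \<open>((a, c), (b, d))\<close> and
      \<open>((a, c), (b', d'))\<close>, with common base point \<open>(a, c)\<close>.\<close>
    then show "fn ?L x = fn ?R x"
      by (simp add: Hom_src[OF pair(1)] pair(2)[of _ "Tup [a, c]" "Tup [b, d]" "Tup [b', d']"])
  qed (rule self_Hom_intros pair(1))+
qed

lemma s_n_ALG:
  "tan_s A \<cdot>\<^sub>P pair (Id (ALG R P) (tan_T A)) (tan_n A) = tan_z A \<cdot>\<^sub>P tan_p A" (is "?L = ?R")
proof -
  have h: "Id (ALG R P) (tan_T A) \<in> Hom (ALG R P) (tan_T A) (tan_T A)"
    "tan_n A \<in> Hom (ALG R P) (tan_T A) (tan_T A)"
    by (rule self_Hom_intros)+
  have eq: "\<forall>x \<in> carrier (tan_T A).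
      fn (tan_p A) (fn (Id (ALG R P) (tan_T A)) x) = fn (tan_p A) (fn (tan_n A) x)"
    by (auto simp: in_tan_T_iff)
  note pair = pair_semidirect[OF h eq]
  show ?thesis
  proof (rule arrow_eqI)
    fix x assume "x \<in> carrier (tan_T A)"
    then obtain a b where "x = Tup [a, b]" "a \<in> carrier A" "b \<in> carrier A"
      by (auto simp: in_tan_T_iff)
    then show "fn ?L x = fn ?R x"
      by (simp add: Hom_src[OF pair(1)] pair(2)[of _ a b "\<ominus>\<^bsub>A\<^esub> b"] M.r_neg)
  qed (rule self_Hom_intros pair(1))+
qed

text \<open>The candidate equalizer sends \<open>(a, b, c)\<close> to
  \<open>((a, c), (0, b))\<close>. On \<open>((a, b), (c, d))\<close> the parallel arrows give
  \<open>(a, c)\<close> and \<open>(a, 0)\<close>, so they agree exactly where the third entry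
  vanishes, which is the image of that injective map.\<close>

lemma lift_universal_ALG:
  "is_equalizer (ALG R P)
    (tan_Tm (tan_s A) \<cdot>\<^sub>P
      pairT (tan_l A \<cdot>\<^sub>P tan_q 2 1 A) (tan_z (tan_T A) \<cdot>\<^sub>P tan_q 2 2 A))
    (tan_Tm (tan_p A)) (tan_z A \<cdot>\<^sub>P tan_p A \<cdot>\<^sub>P tan_p (tan_T A))"
  (is "is_equalizer ?C ?e ?f ?g")
proof -
  have h: "tan_l A \<cdot>\<^sub>P tan_q 2 1 A \<in> Hom ?C (semidirect 2 A) (tan_T (tan_T A))"
    "tan_z (tan_T A) \<cdot>\<^sub>P tan_q 2 2 A \<in> Hom ?C (semidirect 2 A) (tan_T (tan_T A))"
    by (rule self_Hom_intros)+
  have eq: "\<forall>x \<in> carrier (semidirect 2 A).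
      fn (tan_Tm (tan_p A)) (fn (tan_l A \<cdot>\<^sub>P tan_q 2 1 A) x) =
      fn (tan_Tm (tan_p A)) (fn (tan_z (tan_T A) \<cdot>\<^sub>P tan_q 2 2 A) x)"
    by (auto simp: in_semidirect_2_iff)
  note pair = pairT_semidirect[OF h eq]
  have e: "?e \<in> Hom ?C (semidirect 2 A) (tan_T (tan_T A))"
    by (rule self_Hom_intros pair(1))+
  have f: "?f \<in> Hom ?C (tan_T (tan_T A)) (tan_T A)" and g: "?g \<in> Hom ?C (tan_T (tan_T A)) (tan_T A)"
    by (rule self_Hom_intros)+
  have e_value: "fn ?e (Tup [a, b, c]) = Tup [Tup [a, c], Tup [\<zero>\<^bsub>A\<^esub>, b]]"
    if "a \<in> carrier A" "b \<in> carrier A" "c \<in> carrier A" for a b c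
    using that by (simp add: Hom_src[OF pair(1)] pair(2)[of _ a "\<zero>\<^bsub>A\<^esub>" "\<zero>\<^bsub>A\<^esub>" b c "\<zero>\<^bsub>A\<^esub>"])
  have "?f \<cdot>\<^sub>P ?e = ?g \<cdot>\<^sub>P ?e"
  proof (rule arrow_eqI[OF Comp_ALG_Hom[OF e f] Comp_ALG_Hom[OF e g]])
    fix x assume "x \<in> carrier (semidirect 2 A)"
    then obtain a b c where "x = Tup [a, b, c]" "a \<in> carrier A" "b \<in> carrier A" "c \<in> carrier A"
      by (auto simp: in_semidirect_2_iff)
    then show "fn (?f \<cdot>\<^sub>P ?e) x = fn (?g \<cdot>\<^sub>P ?e) x"
      by (simp add: Hom_src[OF pair(1)] pair(2)[of _ a "\<zero>\<^bsub>A\<^esub>" "\<zero>\<^bsub>A\<^esub>" b c "\<zero>\<^bsub>A\<^esub>"])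
  qed
  moreover have "\<exists>!m. m \<in> Hom ?C X (semidirect 2 A) \<and> ?e \<cdot>\<^sub>P m = k"
    if k: "k \<in> Hom ?C X (tan_T (tan_T A))" and fgk: "?f \<cdot>\<^sub>P k = ?g \<cdot>\<^sub>P k" for X k
  proof -
    have "\<exists>!m. m \<in> Hom ?C X (semidirect 2 A) \<and> (\<forall>i \<in> {()}. ?e \<cdot>\<^sub>P m = k)"
    proof (rule joint_lift[OF Hom_algebras(1)[OF k] Hom_algebras(1)[OF e] e k])
      show "x = y" if "x \<in> carrier (semidirect 2 A)" "y \<in> carrier (semidirect 2 A)"
        "\<And>i. i \<in> {()} \<Longrightarrow> fn ?e x = fn ?e y" for x y
        using that by (auto simp: in_semidirect_2_iff e_value simp del: ALG_simps)
      show "\<exists>w \<in> carrier (semidirect 2 A). \<forall>i \<in> {()}. fn ?e w = fn k x" if x: "x \<in> carrier X" for x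
      proof -
        obtain a b c d where kx: "fn k x = Tup [Tup [a, b], Tup [c, d]]"
          and abcd: "a \<in> carrier A" "b \<in> carrier A" "c \<in> carrier A" "d \<in> carrier A"
          using Hom_fn_closed[OF k x] by (auto simp: in_tan_T_iff)
        have "Tup [a, c] = Tup [a, \<zero>\<^bsub>A\<^esub>]"
          using arg_cong[OF fgk, of "\<lambda>m. fn m x"] x abcd by (simp add: Hom_src[OF k] kx)
        \<comment> \<open>With \<open>c\<close> equal to zero the preimage is read off
          \<open>e_value\<close>, which exchanges the two tangent entries.\<close>
        then have "fn ?e (Tup [a, d, b]) = fn k x"
          using e_value[of a d b] abcd kx by simp
        then show ?thesis
          using abcd by (intro bexI[of _ "Tup [a, d, b]"]) auto
      qed
    qed
    then show ?thesis
      by simp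
  qed
  ultimately show ?thesis
    unfolding is_equalizer_def using e f g by (simp add: Hom_def)
qed

end

section \<open>Naturality and assembly of the structure\<close>

context operad
begin

text \<open>The source functor acts on arrows by a pairing of composites. Evaluated on tuples it
  applies the arrow to each entry, and naturality becomes additivity of the arrow.\<close>

lemma s_natural_ALG:
  "nat_trans (ALG R P) (semidirect 2)
    (\<lambda>\<phi>. pairing (ALG R P) (semidirect 2 (Cod (ALG R P) \<phi>)) (tan_q 2 1 (Cod (ALG R P) \<phi>))
      (tan_q 2 2 (Cod (ALG R P) \<phi>)) (tan_Tm \<phi> \<cdot>\<^sub>P tan_q 2 1 (Dom (ALG R P) \<phi>))
      (tan_Tm \<phi> \<cdot>\<^sub>P tan_q 2 2 (Dom (ALG R P) \<phi>)))
    tan_T tan_Tm tan_s" (is "nat_trans _ _ ?F _ _ _")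
proof (rule nat_transI)
  fix A B :: "('r, 'a universe, 'p) alg_data" and \<phi>
  assume \<phi>: "\<phi> \<in> Hom (ALG R P) A B"
  interpret A: universe_algebra R P A by (rule Hom_algebras(1)[OF \<phi>])
  interpret B: universe_algebra R P B by (rule Hom_algebras(2)[OF \<phi>])
  have h: "tan_Tm \<phi> \<cdot>\<^sub>P tan_q 2 1 A \<in> Hom (ALG R P) (semidirect 2 A) (tan_T B)"
    "tan_Tm \<phi> \<cdot>\<^sub>P tan_q 2 2 A \<in> Hom (ALG R P) (semidirect 2 A) (tan_T B)"
    by (rule A.self_Hom_intros \<phi>)+
  have eq: "\<forall>x \<in> carrier (semidirect 2 A).
      fn (tan_p B) (fn (tan_Tm \<phi> \<cdot>\<^sub>P tan_q 2 1 A) x) =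
      fn (tan_p B) (fn (tan_Tm \<phi> \<cdot>\<^sub>P tan_q 2 2 A) x)"
    by (auto simp: in_semidirect_2_iff Hom_src[OF \<phi>] Hom_fn_closed[OF \<phi>])
  note pair = B.pair_semidirect[OF h eq]
  show "?F \<phi> \<in> Hom (ALG R P) (semidirect 2 A) (semidirect 2 B)"
    using pair(1) by (simp add: Hom_src[OF \<phi>] Hom_tgt[OF \<phi>])
  fix x assume "x \<in> carrier (semidirect 2 A)"
  then obtain a b c where x: "x = Tup [a, b, c]" and abc: "a \<in> carrier A" "b \<in> carrier A" "c \<in> carrier A"
    by (auto simp: in_semidirect_2_iff)
  have "fn (B.pair (tan_Tm \<phi> \<cdot>\<^sub>P tan_q 2 1 A) (tan_Tm \<phi> \<cdot>\<^sub>P tan_q 2 2 A)) x =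
      Tup [fn \<phi> a, fn \<phi> b, fn \<phi> c]"
    using x abc by (intro pair(2)) (simp_all add: Hom_src[OF \<phi>])
  then show "fn (tan_s B) (fn (?F \<phi>) x) = fn (tan_Tm \<phi>) (fn (tan_s A) x)"
    using x abc linear_maps_add[OF alg_homs_linear[OF Hom_fn[OF \<phi>]]]
    by (simp add: Hom_src[OF \<phi>] Hom_tgt[OF \<phi>] Hom_fn_closed[OF \<phi>])
qed (simp_all add: tan_s_Hom tan_Tm_Hom)

text \<open>Consequences of linearity in the form that naturality of \<open>tan_z\<close>,
  \<open>tan_l\<close> and \<open>tan_n\<close> calls for, where zeros and negatives are pushed
  through an arrow.\<close>

lemma Hom_preserves:
  assumes \<phi>: "\<phi> \<in> Hom (ALG R P) A B"
  shows "fn \<phi> \<zero>\<^bsub>A\<^esub> = \<zero>\<^bsub>B\<^esub>" and "a \<in> carrier A \<Longrightarrow> fn \<phi> (\<ominus>\<^bsub>A\<^esub> a) = \<ominus>\<^bsub>B\<^esub> fn \<phi> a"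
    and "\<zero>\<^bsub>A\<^esub> \<in> carrier A" and "a \<in> carrier A \<Longrightarrow> \<ominus>\<^bsub>A\<^esub> a \<in> carrier A"
proof -
  interpret A: universe_algebra R P A by (rule Hom_algebras(1)[OF \<phi>])
  interpret B: universe_algebra R P B by (rule Hom_algebras(2)[OF \<phi>])
  note linear = A.module_axioms B.module_axioms alg_homs_linear[OF Hom_fn[OF \<phi>]]
  show "fn \<phi> \<zero>\<^bsub>A\<^esub> = \<zero>\<^bsub>B\<^esub>" "a \<in> carrier A \<Longrightarrow> fn \<phi> (\<ominus>\<^bsub>A\<^esub> a) = \<ominus>\<^bsub>B\<^esub> fn \<phi> a"
    using linear_maps_zero[OF linear] linear_maps_minus[OF linear] by auto
  show "\<zero>\<^bsub>A\<^esub> \<in> carrier A" "a \<in> carrier A \<Longrightarrow> \<ominus>\<^bsub>A\<^esub> a \<in> carrier A"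
    by auto
qed

lemma structure_maps_natural:
  "nat_trans (ALG R P) tan_T tan_Tm (\<lambda>A. A) (\<lambda>\<phi>. \<phi>) tan_p"
  "nat_trans (ALG R P) (\<lambda>A. A) (\<lambda>\<phi>. \<phi>) tan_T tan_Tm tan_z"
  "nat_trans (ALG R P) tan_T tan_Tm (\<lambda>A. tan_T (tan_T A)) (\<lambda>\<phi>. tan_Tm (tan_Tm \<phi>)) tan_l"
  "nat_trans (ALG R P) (\<lambda>A. tan_T (tan_T A)) (\<lambda>\<phi>. tan_Tm (tan_Tm \<phi>))
    (\<lambda>A. tan_T (tan_T A)) (\<lambda>\<phi>. tan_Tm (tan_Tm \<phi>)) tan_c"
  "nat_trans (ALG R P) tan_T tan_Tm tan_T tan_Tm tan_n"
  by (rule nat_transI; auto simp: tan_arrow_Hom tan_Tm_Hom in_tan_T_iff Hom_src Hom_fn_closed Hom_preserves)+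

lemma tangent_structure_ALG:
  "tangent_structure (ALG R P) tan_T tan_Tm semidirect tan_q tan_p tan_s tan_z tan_l tan_c"
proof (intro tangent_structure.intro tangent_structure_axioms.intro category_ALG endofunctor_tan_T
    structure_maps_natural s_natural_ALG)
  fix A :: "('r, 'b universe, 'p) alg_data" and n k :: nat
  assume "A \<in> Obj (ALG R P)"
  then interpret universe_algebra R P A
    by simp
  show "is_nfold_pullback (ALG R P) n ((tan_Tm ^^ k) (tan_p A)) ((tan_T ^^ k) (semidirect n A))
    (\<lambda>j. (tan_Tm ^^ k) (tan_q n j A))" if "n \<ge> 1"
    using concrete_pullback_imp_nfold_pullback[OF concrete_pullback_iterated[OF self that]] .
qed (use universe_algebra.additive_bundle_ALG universe_algebra.tangent_equations
    universe_algebra.tangent_equations_TTT universe_algebra.lift_s_ALG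
    universe_algebra.flip_s_ALG universe_algebra.lift_universal_ALG in \<open>simp_all only: Obj_ALG\<close>)

lemma rosicky_tangent_structure_ALG:
  "rosicky_tangent_structure (ALG R P) tan_T tan_Tm semidirect tan_q tan_p tan_s tan_z tan_l tan_c tan_n"
  by (intro rosicky_tangent_structure.intro rosicky_tangent_structure_axioms.intro tangent_structure_ALG
      structure_maps_natural)
    (use universe_algebra.tangent_equations universe_algebra.s_n_ALG in \<open>simp_all only: Obj_ALG\<close>)

end

theorem theorem4p3p3:
  fixes R :: "('r, 'x) ring_scheme" and P :: "('r, 'p) operad_data"
  assumes "cring R" and "operad R P"
  shows "rosicky_tangent_structure
           (ALG R P :: (('r, 'a universe, 'p) alg_data, ('r, 'a universe, 'p) alg_arrow) category)
           tan_T tan_Tm semidirect tan_q tan_p tan_s tan_z tan_l tan_c tan_n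
       \<and> cartesian_rosicky_tangent_category
           (ALG R P :: (('r, 'a universe, 'p) alg_data, ('r, 'a universe, 'p) alg_arrow) category)
           tan_T tan_Tm semidirect tan_q tan_p tan_s tan_z tan_l tan_c tan_n"
proof -
  interpret operad R P by fact
  show ?thesis
    by (intro conjI cartesian_rosicky_tangent_category.intro cartesian_rosicky_tangent_category_axioms.intro
        rosicky_tangent_structure_ALG has_finite_products_ALG preserves_finite_products_tan_T)
qed

end
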